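(* Let $\phi \in \mathcal F_{N}$, let $s, \tilde s\in \mathbb C[z,w]$ and let $g,\tilde g$ be functions on $\sigma(\Theta(N))$ such that both $(s,g)$ and $(\tilde s,\tilde g)$ are admissible decompositions of $\phi$ (as defined in the context). Then $$s(A,B) + \Xi\left(\int^{R_1,R_2}_{\sigma(\Theta(N))} g \, dE \right) = \tilde s(A,B) + \Xi\left(\int^{R_1,R_2}_{\sigma(\Theta(N))} \tilde g \, dE \right).$$
   Context: Setting. For bounded linear operators between Krein or Hilbert spaces, ${}^*$ denotes the adjoint with respect to the given inner products; $C'$ is the commutant of an operator $C$ in the algebra of bounded operators. A bounded linear operator $N$ on a Krein space $(\mathcal K,[.,.])$ is normal if $NN^*=N^*N$; put $A:=\frac{N+N^*}{2}$, $B:=\frac{N-N^*}{2i}$. A normal $N$ is definitizable if there are nonzero real polynomials $p,q\in\mathbb R[z]$ with $[p(A)x,x]\ge 0$ and $[q(B)x,x]\ge 0$ for all $x\in\mathcal K$. Fix a bounded normal definitizable $N$ and such $p,q$. Let $\mathcal V_1,\mathcal V_2,\mathcal V$ be Hilbert spaces and $T_1:\mathcal V_1\to\mathcal K$, $T_2:\mathcal V_2\to\mathcal K$, $T:\mathcal V\to\mathcal K$ bounded linear injective maps with $T_1T_1^*=p(A)$, $T_2T_2^*=q(B)$, $TT^*=p(A)+q(B)$ (these exist: e.g. $\mathcal V$ is the completion of $\mathcal K/\ker(p(A)+q(B))$ with respect to $[(p(A)+q(B)).,.]$ and $T$ is the adjoint of the canonical map $\mathcal K\to\mathcal V$; similarly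 for $T_1,T_2$ with $p(A)$, $q(B)$). Let $R_j:\mathcal V_j\to\mathcal V$ ($j=1,2$) be the injective contractions with $T_j=TR_j$; they satisfy $R_1R_1^*+R_2R_2^*=I$. For $C\in(TT^* )'$ let $\Theta(C)=T^{-1}CT$, i.e. the bounded operator on $\mathcal V$ determined by $T\Theta(C)=CT$; $\Theta:(TT^* )'\to(T^*T)'$ is a unital $*$-homomorphism. Let $\Xi:(T^*T)'\to(TT^* )'$, $\Xi(D)=TDT^*$. Then $\Theta(N)$ is a normal operator on the Hilbert space $\mathcal V$; $E$ denotes its spectral measure. Function classes. For $m,n\in\mathbb N$ (positive) let $I_{m,n}:=(\{0,\dots,m-1\}\times\{0,\dots,n-1\})\cup\{(m,0),(0,n)\}$, let $\mathcal A_{m,n}$ be the space of families $(a_{k,l})_{(k,l)\in I_{m,n}}$ of complex numbers and $\mathcal B_{m,n}$ the space of families indexed by $\{0,\dots,m-1\}\times\{0,\dots,n-1\}$, with componentwise addition, scalar multiplication and conjugation $\overline a=(\bar a_{k,l})$, and with multiplication $(a\cdot b)_{k,l}=\sum_{c=0}^k\sum_{d=0}^l a_{c,d}b_{k-c,l-d}$. They are commutative unital $*$-algebras. $\pi:\mathcal A_{m,n}\to\mathcal B_{m,n}$ drops the entries with indices $(m,0),(0,n)$; on $\mathcal B_{m,n}$, $\pi$ is the identity. Let $\mathfrak d_p(z)$, $\mathfrak d_q(z)$ be the multiplicity of $z\in\mathbb C$ as a zero of $p$, $q$; $Z^{\mathbb R}_p:=p^{-1}\{0\}\cap\mathbb R$,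 $Z^{\mathbb R}_q:=q^{-1}\{0\}\cap\mathbb R$, $Z^{\mathbb R}_p+iZ^{\mathbb R}_q:=\{x+iy: x\in Z^{\mathbb R}_p,y\in Z^{\mathbb R}_q\}$, $Z^i:=(p^{-1}\{0\}\times q^{-1}\{0\})\setminus(\mathbb R\times\mathbb R)\subseteq\mathbb C^2$. Put $\mathfrak C(z):=\mathbb C$ for $z\in\sigma(\Theta(N))\setminus(Z^{\mathbb R}_p+iZ^{\mathbb R}_q)$, $\mathfrak C(z):=\mathcal A_{\mathfrak d_p(\operatorname{Re}z),\mathfrak d_q(\operatorname{Im}z)}$ for $z\in Z^{\mathbb R}_p+iZ^{\mathbb R}_q$, $\mathfrak C(\xi,\eta):=\mathcal B_{\mathfrak d_p(\xi),\mathfrak d_q(\eta)}$ for $(\xi,\eta)\in Z^i$. $\mathcal M_N$ is the set of functions $\phi$ on $\big(\sigma(\Theta(N))\cup(Z^{\mathbb R}_p+iZ^{\mathbb R}_q)\big)\,\dot\cup\, Z^i$ with $\phi(z)\in\mathfrak C(z)$, with pointwise algebra operations. $\mathcal R$ is the set of $\phi\in\mathcal M_N$ with $\pi(\phi(z))=0$ for all $z\in(Z^{\mathbb R}_p+iZ^{\mathbb R}_q)\,\dot\cup\, Z^i$. $\mathcal F_N$ is the set of $\phi\in\mathcal M_N$ that are Borel measurable and bounded on $\sigma(\Theta(N))\setminus(Z^{\mathbb R}_p+iZ^{\mathbb R}_q)$ and such that for each $w\in\sigma(\Theta(N))\cap(Z^{\mathbb R}_p+iZ^{\mathbb R}_q)$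 the quotient $$\frac{\phi(z)-\sum_{k=0}^{\mathfrak d_p(\operatorname{Re}w)-1}\sum_{l=0}^{\mathfrak d_q(\operatorname{Im}w)-1}\phi(w)_{k,l}\operatorname{Re}(z-w)^k\operatorname{Im}(z-w)^l}{\max(|\operatorname{Re}(z-w)|^{\mathfrak d_p(\operatorname{Re}w)},|\operatorname{Im}(z-w)|^{\mathfrak d_q(\operatorname{Im}w)})}$$ is bounded for $z\in\sigma(\Theta(N))\cap U(w)\setminus\{w\}$, where $U(w)$ is a sufficiently small neighbourhood of $w$. A polynomial $s\in\mathbb C[z,w]$ gives $s_N\in\mathcal M_N$: $s_N(z)=s(\operatorname{Re}z,\operatorname{Im}z)$ for $z\in\sigma(\Theta(N))\setminus(Z^{\mathbb R}_p+iZ^{\mathbb R}_q)$; $s_N(z)_{k,l}=\frac1{k!l!}\frac{\partial^{k+l}s}{\partial x^k\partial y^l}(\operatorname{Re}z,\operatorname{Im}z)$, $(k,l)\in I_{\mathfrak d_p(\operatorname{Re}z),\mathfrak d_q(\operatorname{Im}z)}$, for $z\in Z^{\mathbb R}_p+iZ^{\mathbb R}_q$; $s_N(\xi,\eta)_{k,l}=\frac1{k!l!}\frac{\partial^{k+l}s}{\partial z^k\partial w^l}(\xi,\eta)$, $0\le k<\mathfrak d_p(\xi)$, $0\le l<\mathfrak d_q(\eta)$, for $(\xi,\eta)\in Z^i$. $p_N$ and $q_N$ are obtained from $p(z)$ and $q(w)$ regarded as elements of $\mathbb C[z,w]$. Admissible decompositions. $(s,g)$ is an admissible decomposition of $\phi\in\mathcal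 F_N$ if $s\in\mathbb C[z,w]$, $g$ is a function on $\sigma(\Theta(N))$ with values in $\mathbb C$ on $\sigma(\Theta(N))\setminus(Z^{\mathbb R}_p+iZ^{\mathbb R}_q)$, where it is bounded and measurable, and values $g(z)=(g(z)_1,g(z)_2)\in\mathbb C^2$ on $\sigma(\Theta(N))\cap(Z^{\mathbb R}_p+iZ^{\mathbb R}_q)$, $\phi-s_N\in\mathcal R$, and $\phi(z)=s_N(z)+(p_N+q_N)(z)\cdot g(z)$ for all $z\in\sigma(\Theta(N))$. Here $(p_N+q_N)(z)\cdot g(z)$ is the usual product $(p(\operatorname{Re}z)+q(\operatorname{Im}z))g(z)$ for $z\in\sigma(\Theta(N))\setminus(Z^{\mathbb R}_p+iZ^{\mathbb R}_q)$, and for $z\in\sigma(\Theta(N))\cap(Z^{\mathbb R}_p+iZ^{\mathbb R}_q)$ it is the element of $\mathfrak C(z)$ whose entries with $0\le k<\mathfrak d_p(\operatorname{Re}z)$, $0\le l<\mathfrak d_q(\operatorname{Im}z)$ are $0$, whose $(\mathfrak d_p(\operatorname{Re}z),0)$ entry is $(p_N+q_N)(z)_{\mathfrak d_p(\operatorname{Re}z),0}\,g(z)_1$ and whose $(0,\mathfrak d_q(\operatorname{Im}z))$ entry is $(p_N+q_N)(z)_{0,\mathfrak d_q(\operatorname{Im}z)}\,g(z)_2$. For such $g$, $$\int^{R_1,R_2}_{\sigma(\Theta(N))} g\,dE:=\int_{\sigma(\Theta(N))\setminus(Z^{\mathbb R}_p+iZ^{\mathbb R}_q)}g\,dE+\sum_{w\in\sigma(\Theta(N))\cap(Z^{\mathbb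 R}_p+iZ^{\mathbb R}_q)}\big(g(w)_1R_1R_1^*E\{w\}+g(w)_2R_2R_2^*E\{w\}\big).$$ *)

theory Defs
  imports
    "HOL-Analysis.Analysis"
    "HOL-Computational_Algebra.Polynomial"
    "HOL-Library.Nonpos_Ints"
begin

section \<open>Complex Banach and Hilbert spaces, Krein spaces\<close>

class complex_banach = banach +
  fixes scaleC :: "complex \<Rightarrow> 'a \<Rightarrow> 'a" (infixr \<open>*\<^sub>C\<close> 75)
  assumes scaleC_add_right: "c *\<^sub>C (x + y) = c *\<^sub>C x + c *\<^sub>C y"
    and scaleC_add_left: "(c + d) *\<^sub>C x = c *\<^sub>C x + d *\<^sub>C x"
    and scaleC_scaleC: "c *\<^sub>C d *\<^sub>C x = (c * d) *\<^sub>C x"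
    and scaleC_of_real: "complex_of_real r *\<^sub>C x = r *\<^sub>R x"
    and norm_scaleC: "norm (c *\<^sub>C x) = cmod c * norm x"

global_interpretation complex_vector:
    vector_space "scaleC :: complex \<Rightarrow> 'a \<Rightarrow> 'a::complex_banach"
  using scaleC_of_real[of 1]
  by unfold_locales (simp_all add: scaleC_add_right scaleC_add_left scaleC_scaleC)

text \<open>All inner products are linear in the first and conjugate linear in the second argument.\<close>

definition hermitian_form :: "('a::complex_banach \<Rightarrow> 'a \<Rightarrow> complex) \<Rightarrow> bool" where
  "hermitian_form f \<longleftrightarrow>
     (\<forall>x y z. f (x + y) z = f x z + f y z) \<and>
     (\<forall>c x y. f (c *\<^sub>C x) y = c * f x y) \<and>
     (\<forall>x y. f y x = cnj (f x y))"

class complex_hilbert = complex_banach +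
  fixes cinner :: "'a \<Rightarrow> 'a \<Rightarrow> complex"
  assumes cinner_add_left: "cinner (x + y) z = cinner x z + cinner y z"
    and cinner_scaleC_left: "cinner (c *\<^sub>C x) y = c * cinner x y"
    and cinner_commute: "cinner y x = cnj (cinner x y)"
    and cinner_self: "cinner x x = complex_of_real ((norm x)\<^sup>2)"

text \<open>
  A Krein space is a space with a Hermitian form \<open>f\<close> that has a fundamental decomposition
  into an \<open>f\<close>-orthogonal direct sum of subspaces \<open>P\<close> and \<open>M\<close> such that \<open>f\<close> on \<open>P\<close> and \<open>-f\<close>
  on \<open>M\<close> are Hilbert space inner products. It carries the topology of the resulting Hilbert space
  direct sum, which does not depend on the decomposition. Here the norm of the type is an arbitrary
  norm inducing that topology; this is what the two-sided estimate says. The lower estimate contains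
  the definiteness of \<open>f\<close> on \<open>P\<close> and of \<open>-f\<close> on \<open>M\<close>, and the completeness of these
  two subspaces comes from that of the type.
\<close>

definition krein_space :: "('k::complex_banach \<Rightarrow> 'k \<Rightarrow> complex) \<Rightarrow> bool" where
  "krein_space f \<longleftrightarrow> hermitian_form f \<and>
     (\<exists>P M. complex_vector.subspace P \<and> complex_vector.subspace M \<and>
        P \<inter> M = {0} \<and> (\<forall>x. \<exists>u\<in>P. \<exists>v\<in>M. x = u + v) \<and>
        (\<forall>u\<in>P. \<forall>v\<in>M. f u v = 0) \<and>
        (\<exists>a>0. \<exists>b. \<forall>u\<in>P. \<forall>v\<in>M.
            a * (norm (u + v))\<^sup>2 \<le> Re (f u u) - Re (f v v) \<and>
            Re (f u u) - Re (f v v) \<le> b * (norm (u + v))\<^sup>2))"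


section \<open>Bounded operators\<close>

definition bounded_clinear :: "('a::complex_banach \<Rightarrow> 'b::complex_banach) \<Rightarrow> bool" where
  "bounded_clinear C \<longleftrightarrow> bounded_linear C \<and> (\<forall>c x. C (c *\<^sub>C x) = c *\<^sub>C C x)"

definition adjoint_wrt ::
    "('a::complex_banach \<Rightarrow> 'a \<Rightarrow> complex) \<Rightarrow> ('b::complex_banach \<Rightarrow> 'b \<Rightarrow> complex) \<Rightarrow>
     ('a \<Rightarrow> 'b) \<Rightarrow> 'b \<Rightarrow> 'a" where
  "adjoint_wrt f g C = (THE D. bounded_clinear D \<and> (\<forall>x y. g (C x) y = f x (D y)))"

definition normal_wrt :: "('k::complex_banach \<Rightarrow> 'k \<Rightarrow> complex) \<Rightarrow> ('k \<Rightarrow> 'k) \<Rightarrow> bool" where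
  "normal_wrt f N \<longleftrightarrow> N \<circ> adjoint_wrt f f N = adjoint_wrt f f N \<circ> N"

definition re_part ::
    "('k::complex_banach \<Rightarrow> 'k \<Rightarrow> complex) \<Rightarrow> ('k \<Rightarrow> 'k) \<Rightarrow> 'k \<Rightarrow> 'k" where
  "re_part f N = (\<lambda>x. (1 / 2) *\<^sub>C (N x + adjoint_wrt f f N x))"

definition im_part ::
    "('k::complex_banach \<Rightarrow> 'k \<Rightarrow> complex) \<Rightarrow> ('k \<Rightarrow> 'k) \<Rightarrow> 'k \<Rightarrow> 'k" where
  "im_part f N = (\<lambda>x. (1 / (2 * \<i>)) *\<^sub>C (N x - adjoint_wrt f f N x))"

definition spectrum :: "('a::complex_banach \<Rightarrow> 'a) \<Rightarrow> complex set" where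
  "spectrum C = {z. \<not> (\<exists>D. bounded_clinear D \<and>
      D \<circ> (\<lambda>x. C x - z *\<^sub>C x) = id \<and> (\<lambda>x. C x - z *\<^sub>C x) \<circ> D = id)}"

definition Theta ::
    "('v::complex_banach \<Rightarrow> 'k::complex_banach) \<Rightarrow> ('k \<Rightarrow> 'k) \<Rightarrow> 'v \<Rightarrow> 'v" where
  "Theta T C = (THE D. bounded_clinear D \<and> T \<circ> D = C \<circ> T)"

definition Xi ::
    "('k::complex_banach \<Rightarrow> 'k \<Rightarrow> complex) \<Rightarrow> ('v::complex_hilbert \<Rightarrow> 'k) \<Rightarrow> ('v \<Rightarrow> 'v) \<Rightarrow> 'k \<Rightarrow> 'k"
  where "Xi f T D = T \<circ> D \<circ> adjoint_wrt cinner f T"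


section \<open>Polynomials\<close>

abbreviation cpoly :: "real poly \<Rightarrow> complex poly" where
  "cpoly \<equiv> map_poly complex_of_real"

definition poly_op :: "complex poly \<Rightarrow> ('k::complex_banach \<Rightarrow> 'k) \<Rightarrow> 'k \<Rightarrow> 'k" where
  "poly_op r A x = (\<Sum>i\<le>degree r. coeff r i *\<^sub>C (A ^^ i) x)"

text \<open>
  The ring \<open>\<complex>[z,w]\<close> is \<^typ>\<open>complex poly poly\<close>, with \<open>w\<close> the outer and \<open>z\<close> the
  inner variable: the coefficient of \<open>z^k w^l\<close> in \<open>s\<close> is \<open>coeff (coeff s l) k\<close>.
\<close>

definition poly2 :: "complex poly poly \<Rightarrow> complex \<Rightarrow> complex \<Rightarrow> complex" where
  "poly2 s x y = poly (poly s [:y:]) x"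

definition poly2_op ::
    "complex poly poly \<Rightarrow> ('k::complex_banach \<Rightarrow> 'k) \<Rightarrow> ('k \<Rightarrow> 'k) \<Rightarrow> 'k \<Rightarrow> 'k" where
  "poly2_op s A B x =
     (\<Sum>l\<le>degree s. \<Sum>k\<le>degree (coeff s l). coeff (coeff s l) k *\<^sub>C (A ^^ k) ((B ^^ l) x))"

definition in_first :: "real poly \<Rightarrow> complex poly poly" where
  "in_first p = [:cpoly p:]"

definition in_second :: "real poly \<Rightarrow> complex poly poly" where
  "in_second q = map_poly (\<lambda>c. [:complex_of_real c:]) q"

text \<open>\<open>taylor2 s x y k l\<close> is \<open>1/(k! l!)\<close> times the derivative of \<open>s\<close>, \<open>k\<close> times in \<open>z\<close> and
  \<open>l\<close> times in \<open>w\<close>, at \<open>(x, y)\<close>.\<close>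

definition taylor2 :: "complex poly poly \<Rightarrow> complex \<Rightarrow> complex \<Rightarrow> nat \<Rightarrow> nat \<Rightarrow> complex" where
  "taylor2 s x y k l =
     1 / (fact k * fact l) * poly2 ((map_poly pderiv ^^ k) ((pderiv ^^ l) s)) x y"

definition mult_zero :: "real poly \<Rightarrow> complex \<Rightarrow> nat" where
  "mult_zero p z = order z (cpoly p)"

definition Zreal :: "real poly \<Rightarrow> real poly \<Rightarrow> complex set" where
  "Zreal p q = {z. poly p (Re z) = 0 \<and> poly q (Im z) = 0}"

definition Zimag :: "real poly \<Rightarrow> real poly \<Rightarrow> (complex \<times> complex) set" where
  "Zimag p q = {\<xi>. poly (cpoly p) \<xi> = 0} \<times> {\<eta>. poly (cpoly q) \<eta> = 0} - \<real> \<times> \<real>"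


section \<open>The function classes\<close>

definition box_idx :: "nat \<Rightarrow> nat \<Rightarrow> (nat \<times> nat) set" where
  "box_idx m n = {..<m} \<times> {..<n}"

definition jet_idx :: "nat \<Rightarrow> nat \<Rightarrow> (nat \<times> nat) set" where
  "jet_idx m n = box_idx m n \<union> {(m, 0), (0, n)}"

definition idx_real :: "real poly \<Rightarrow> real poly \<Rightarrow> complex \<Rightarrow> (nat \<times> nat) set" where
  "idx_real p q z = jet_idx (mult_zero p (Re z)) (mult_zero q (Im z))"

definition idx_imag :: "real poly \<Rightarrow> real poly \<Rightarrow> complex \<times> complex \<Rightarrow> (nat \<times> nat) set" where
  "idx_imag p q = (\<lambda>(\<xi>, \<eta>). box_idx (mult_zero p \<xi>) (mult_zero q \<eta>))"

text \<open>
  Below, \<open>S\<close> stands for the spectrum of the operator \<open>Theta T N\<close>. An element of \<open>M_N S p q\<close>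
  is given by its restrictions to the three parts \<open>S - Zreal p q\<close> (scalar values),
  \<open>Zreal p q\<close> and \<open>Zimag p q\<close> (values that are families) of its domain. The
  components are \<open>0\<close> outside the respective part and, for the families, outside the
  respective index set, so that equality of elements is equality of the records.
\<close>

record mfun =
  regular :: "complex \<Rightarrow> complex"
  jet_real :: "complex \<Rightarrow> nat \<Rightarrow> nat \<Rightarrow> complex"
  jet_imag :: "complex \<times> complex \<Rightarrow> nat \<Rightarrow> nat \<Rightarrow> complex"

definition M_N :: "complex set \<Rightarrow> real poly \<Rightarrow> real poly \<Rightarrow> mfun set" where
  "M_N S p q = {\<phi>.
     (\<forall>z. z \<notin> S - Zreal p q \<longrightarrow> regular \<phi> z = 0) \<and>
     (\<forall>z k l. \<not> (z \<in> Zreal p q \<and> (k, l) \<in> idx_real p q z) \<longrightarrow> jet_real \<phi> z k l = 0) \<and>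
     (\<forall>\<zeta> k l. \<not> (\<zeta> \<in> Zimag p q \<and> (k, l) \<in> idx_imag p q \<zeta>) \<longrightarrow> jet_imag \<phi> \<zeta> k l = 0)}"

definition mfun_plus :: "mfun \<Rightarrow> mfun \<Rightarrow> mfun" where
  "mfun_plus \<phi> \<psi> =
     \<lparr>regular = (\<lambda>z. regular \<phi> z + regular \<psi> z),
      jet_real = (\<lambda>z k l. jet_real \<phi> z k l + jet_real \<psi> z k l),
      jet_imag = (\<lambda>\<zeta> k l. jet_imag \<phi> \<zeta> k l + jet_imag \<psi> \<zeta> k l)\<rparr>"

definition mfun_minus :: "mfun \<Rightarrow> mfun \<Rightarrow> mfun" where
  "mfun_minus \<phi> \<psi> =
     \<lparr>regular = (\<lambda>z. regular \<phi> z - regular \<psi> z),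
      jet_real = (\<lambda>z k l. jet_real \<phi> z k l - jet_real \<psi> z k l),
      jet_imag = (\<lambda>\<zeta> k l. jet_imag \<phi> \<zeta> k l - jet_imag \<psi> \<zeta> k l)\<rparr>"

definition R_N :: "complex set \<Rightarrow> real poly \<Rightarrow> real poly \<Rightarrow> mfun set" where
  "R_N S p q = {\<phi> \<in> M_N S p q.
     (\<forall>z\<in>Zreal p q. \<forall>(k, l) \<in> box_idx (mult_zero p (Re z)) (mult_zero q (Im z)).
        jet_real \<phi> z k l = 0) \<and>
     (\<forall>(\<xi>, \<eta>)\<in>Zimag p q. \<forall>(k, l) \<in> box_idx (mult_zero p \<xi>) (mult_zero q \<eta>).
        jet_imag \<phi> (\<xi>, \<eta>) k l = 0)}"

definition F_N :: "complex set \<Rightarrow> real poly \<Rightarrow> real poly \<Rightarrow> mfun set" where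
  "F_N S p q = {\<phi> \<in> M_N S p q.
     regular \<phi> \<in> borel_measurable (restrict_space borel (S - Zreal p q)) \<and>
     bounded (regular \<phi> ` (S - Zreal p q)) \<and>
     (\<forall>w \<in> S \<inter> Zreal p q.
        let m = mult_zero p (Re w); n = mult_zero q (Im w) in
        \<exists>U. open U \<and> w \<in> U \<and> U \<inter> Zreal p q = {w} \<and>
          bounded ((\<lambda>z.
            (regular \<phi> z - (\<Sum>k<m. \<Sum>l<n.
                jet_real \<phi> w k l * complex_of_real (Re (z - w) ^ k * Im (z - w) ^ l)))
            / complex_of_real (max (\<bar>Re (z - w)\<bar> ^ m) (\<bar>Im (z - w)\<bar> ^ n)))
          ` (S \<inter> U - {w})))}"

definition poly_N ::
    "complex set \<Rightarrow> real poly \<Rightarrow> real poly \<Rightarrow> complex poly poly \<Rightarrow> mfun" where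
  "poly_N S p q s =
     \<lparr>regular = (\<lambda>z. if z \<in> S - Zreal p q then poly2 s (Re z) (Im z) else 0),
      jet_real = (\<lambda>z k l. if z \<in> Zreal p q \<and> (k, l) \<in> idx_real p q z
                          then taylor2 s (Re z) (Im z) k l else 0),
      jet_imag = (\<lambda>(\<xi>, \<eta>) k l. if (\<xi>, \<eta>) \<in> Zimag p q \<and> (k, l) \<in> idx_imag p q (\<xi>, \<eta>)
                          then taylor2 s \<xi> \<eta> k l else 0)\<rparr>"


section \<open>Admissible decompositions\<close>

text \<open>
  A function on \<open>S\<close> with values in \<open>\<complex>\<close> on \<open>S - Zreal p q\<close> and in \<open>\<complex>\<^sup>2\<close> on
  \<open>S \<inter> Zreal p q\<close>. The values of the two components off these sets are never used.
\<close>

record gfun =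
  gscalar :: "complex \<Rightarrow> complex"
  gpair :: "complex \<Rightarrow> complex \<times> complex"

definition jet_times_pair ::
    "nat \<Rightarrow> nat \<Rightarrow> (nat \<Rightarrow> nat \<Rightarrow> complex) \<Rightarrow> complex \<times> complex \<Rightarrow> nat \<Rightarrow> nat \<Rightarrow> complex" where
  "jet_times_pair m n a c = (\<lambda>k l.
     if (k, l) = (m, 0) then a m 0 * fst c
     else if (k, l) = (0, n) then a 0 n * snd c
     else 0)"

definition admissible ::
    "complex set \<Rightarrow> real poly \<Rightarrow> real poly \<Rightarrow> mfun \<Rightarrow> complex poly poly \<Rightarrow> gfun \<Rightarrow> bool" where
  "admissible S p q \<phi> s g \<longleftrightarrow>
     (let s\<^sub>N = poly_N S p q s;
          pq\<^sub>N = mfun_plus (poly_N S p q (in_first p)) (poly_N S p q (in_second q))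
      in
        gscalar g \<in> borel_measurable (restrict_space borel (S - Zreal p q)) \<and>
        bounded (gscalar g ` (S - Zreal p q)) \<and>
        mfun_minus \<phi> s\<^sub>N \<in> R_N S p q \<and>
        (\<forall>z \<in> S - Zreal p q. regular \<phi> z = regular s\<^sub>N z + regular pq\<^sub>N z * gscalar g z) \<and>
        (\<forall>z \<in> S \<inter> Zreal p q. \<forall>k l. jet_real \<phi> z k l = jet_real s\<^sub>N z k l +
            jet_times_pair (mult_zero p (Re z)) (mult_zero q (Im z)) (jet_real pq\<^sub>N z) (gpair g z) k l))"


section \<open>Spectral measures\<close>

text \<open>Projection-valued measures on the Borel subsets of \<open>S\<close>.\<close>

definition proj_valued_measure ::
    "complex set \<Rightarrow> (complex set \<Rightarrow> 'v \<Rightarrow> 'v::complex_hilbert) \<Rightarrow> bool" where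
  "proj_valued_measure S E \<longleftrightarrow>
     (\<forall>X \<in> sets (restrict_space borel S).
        bounded_clinear (E X) \<and> E X \<circ> E X = E X \<and> adjoint_wrt cinner cinner (E X) = E X) \<and>
     E {} = (\<lambda>x. 0) \<and> E S = id \<and>
     (\<forall>X \<in> sets (restrict_space borel S). \<forall>Y \<in> sets (restrict_space borel S).
        E (X \<inter> Y) = E X \<circ> E Y) \<and>
     (\<forall>F. range F \<subseteq> sets (restrict_space borel S) \<and> disjoint_family F \<longrightarrow>
        (\<forall>x. (\<lambda>i. E (F i) x) sums E (\<Union>i::nat. F i) x))"

definition scalar_spectral_measure ::
    "complex set \<Rightarrow> (complex set \<Rightarrow> 'v \<Rightarrow> 'v::complex_hilbert) \<Rightarrow> 'v \<Rightarrow> complex measure" where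
  "scalar_spectral_measure S E x =
     measure_of S (sets (restrict_space borel S)) (\<lambda>X. ennreal (Re (cinner (E X x) x)))"

text \<open>
  The operator \<open>D\<close> with \<open>\<langle>D x, y\<rangle> = \<integral>\<^sub>X h d\<langle>E x, y\<rangle>\<close> for all \<open>x, y\<close>; by polarization it is
  enough to require this for \<open>x = y\<close>, where \<open>\<langle>E x, x\<rangle>\<close> is a positive measure.
\<close>

definition spectral_integral ::
    "complex set \<Rightarrow> (complex set \<Rightarrow> 'v \<Rightarrow> 'v::complex_hilbert) \<Rightarrow> complex set \<Rightarrow>
     (complex \<Rightarrow> complex) \<Rightarrow> 'v \<Rightarrow> 'v" where
  "spectral_integral S E X h = (THE D. bounded_clinear D \<and>
     (\<forall>x. cinner (D x) x = (LINT z:X|scalar_spectral_measure S E x. h z)))"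

definition spectral_measure_of ::
    "('v \<Rightarrow> 'v::complex_hilbert) \<Rightarrow> (complex set \<Rightarrow> 'v \<Rightarrow> 'v) \<Rightarrow> bool" where
  "spectral_measure_of C E \<longleftrightarrow>
     proj_valued_measure (spectrum C) E \<and>
     spectral_integral (spectrum C) E (spectrum C) (\<lambda>z. z) = C"

definition spectral_integral_R ::
    "complex set \<Rightarrow> real poly \<Rightarrow> real poly \<Rightarrow>
     ('v1::complex_hilbert \<Rightarrow> 'v::complex_hilbert) \<Rightarrow> ('v2::complex_hilbert \<Rightarrow> 'v) \<Rightarrow>
     (complex set \<Rightarrow> 'v \<Rightarrow> 'v) \<Rightarrow> gfun \<Rightarrow> 'v \<Rightarrow> 'v" where
  "spectral_integral_R S p q R1 R2 E g = (\<lambda>x.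
     spectral_integral S E (S - Zreal p q) (gscalar g) x +
     (\<Sum>w \<in> S \<inter> Zreal p q.
        fst (gpair g w) *\<^sub>C R1 (adjoint_wrt cinner cinner R1 (E {w} x)) +
        snd (gpair g w) *\<^sub>C R2 (adjoint_wrt cinner cinner R2 (E {w} x))))"

end

theory Submission
  imports Defs "HOL-Computational_Algebra.Fundamental_Theorem_Algebra"
begin

text \<open>
  Write \<open>r = s - s'\<close>, \<open>\<sigma>\<close> for the spectrum of \<open>\<Theta>(N)\<close>, \<open>Z\<close> for the set of points \<open>x + iy\<close> with
  \<open>p(x) = 0 = q(y)\<close>, and \<open>a\<close>, \<open>b\<close> for the real and imaginary part of \<open>\<Theta>(N)\<close>.

  At every common zero \<open>(\<xi>, \<eta>)\<close> of \<open>p(z)\<close> and \<open>q(w)\<close> the jets of \<open>s\<close> and \<open>s'\<close> agree with that of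
  \<open>\<phi>\<close> below the multiplicities. So the Taylor coefficients of \<open>r\<close> vanish there, and \<open>r\<close> lies in
  the ideal generated by \<open>p(z)\<close> and \<open>q(w)\<close>: \<open>r = p u + q v\<close> (\<open>ideal_membership\<close>). Therefore
  \<open>r(A,B) = p(A) u(A,B) + q(B) v(A,B)\<close>. Now \<open>p(A) = T R\<^sub>1 R\<^sub>1* T*\<close> and \<open>q(B) = T R\<^sub>2 R\<^sub>2* T*\<close>,
  and \<open>T*\<close> intertwines \<open>A\<close>, \<open>B\<close> with \<open>a\<close>, \<open>b\<close>; hence \<open>r(A,B) = \<Xi>(X)\<close> with
  \<open>X = R\<^sub>1 R\<^sub>1* u(a,b) + R\<^sub>2 R\<^sub>2* v(a,b)\<close>. What has to be shown is that \<open>X\<close> is the integral of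
  \<open>g' - g\<close> (\<open>calculus_split\<close>).

  At a point \<open>w\<close> of \<open>\<sigma> \<inter> Z\<close> the projection \<open>E{w}\<close> turns \<open>u(a,b)\<close> and \<open>v(a,b)\<close> into the numbers
  \<open>u(w)\<close> and \<open>v(w)\<close>, and comparing the two top entries of the jets of \<open>\<phi>\<close> at \<open>w\<close> shows that these
  are the components of \<open>g'(w) - g(w)\<close> (\<open>admissible_difference\<close>).

  Off \<open>Z\<close> let \<open>W = T*T = p(a) + q(b)\<close>. Injectivity of \<open>T\<close> gives \<open>R\<^sub>1 R\<^sub>1* W = p(a)\<close> and
  \<open>R\<^sub>2 R\<^sub>2* W = q(b)\<close>, so \<open>X W\<close> is \<open>r(a,b)\<close>, and on the range of \<open>E(\<sigma> - Z)\<close> this is also the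
  integral of \<open>g' - g\<close> multiplied by \<open>W\<close>, because \<open>(p + q)(g' - g) = r\<close> there. Finally \<open>W\<close> can be
  cancelled: if \<open>W x = 0\<close>, then \<open>p(a) x = q(b) x = 0\<close>, so \<open>p\<^sup>2 + q\<^sup>2\<close> has integral \<open>0\<close> with respect to
  \<open>\<langle>E x, x\<rangle>\<close> and this measure is concentrated on \<open>Z\<close>. Thus \<open>W\<close> is injective on the range of
  \<open>E(\<sigma> - Z)\<close>, and it is self-adjoint.

  Behind this stand three analytic facts: the Riesz theorem for Hilbert and Krein spaces
  (\<open>riesz_on_subspace\<close>, \<open>riesz_form_krein\<close>), which provides the adjoints; the boundedness of
  \<open>\<Theta>(N)\<close> (\<open>Theta_exists\<close>); and a multiplicative calculus of bounded Borel functions for a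
  projection-valued measure (\<open>represents_exists\<close>, \<open>represents_mult\<close>).
\<close>

section \<open>Bounded operators and Hermitian forms\<close>

lemma bounded_clinearI:
  assumes "\<And>x y. C (x + y) = C x + C y" "\<And>c x. C (c *\<^sub>C x) = c *\<^sub>C C x"
    and "\<And>x. norm (C x) \<le> K * norm x"
  shows "bounded_clinear C"
proof -
  have "C (r *\<^sub>R x) = r *\<^sub>R C x" for r x
    using assms(2)[of "complex_of_real r" x] by (simp add: scaleC_of_real)
  then have "bounded_linear C"
    using assms by (intro bounded_linear_intro[where K=K]) (auto simp: mult.commute)
  then show ?thesis using assms by (simp add: bounded_clinear_def)
qed

lemma bounded_clinearD:
  assumes "bounded_clinear C"
  shows "C (x + y) = C x + C y" "C (x - y) = C x - C y" "C (- x) = - C x" "C 0 = 0"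
    "C (c *\<^sub>C x) = c *\<^sub>C C x" "C (sum h I) = (\<Sum>i\<in>I. C (h i))"
proof -
  have l: "bounded_linear C" and c: "\<And>c x. C (c *\<^sub>C x) = c *\<^sub>C C x"
    using assms by (auto simp: bounded_clinear_def)
  interpret bounded_linear C by (rule l)
  show "C (x + y) = C x + C y" "C (x - y) = C x - C y" "C (- x) = - C x" "C 0 = 0"
    "C (c *\<^sub>C x) = c *\<^sub>C C x" "C (sum h I) = (\<Sum>i\<in>I. C (h i))"
    by (simp_all add: add diff neg zero sum c)
qed

lemma bounded_clinear_bound:
  assumes "bounded_clinear C"
  obtains K where "K > 0" "\<And>x. norm (C x) \<le> K * norm x"
  using bounded_linear.pos_bounded[of C] assms
  by (auto simp: bounded_clinear_def mult.commute)

lemma bounded_clinear_compose: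
  assumes "bounded_clinear C" "bounded_clinear D"
  shows "bounded_clinear (\<lambda>x. C (D x))"
  using assms bounded_linear_compose[of C D] by (simp add: bounded_clinear_def)

lemma bounded_clinear_add:
  assumes "bounded_clinear C" "bounded_clinear D"
  shows "bounded_clinear (\<lambda>x. C x + D x)"
  using assms bounded_linear_add[of C D] by (simp add: bounded_clinear_def scaleC_add_right)

lemma bounded_clinear_scaleC:
  assumes "bounded_clinear C"
  shows "bounded_clinear (\<lambda>x. c *\<^sub>C C x)"
proof -
  obtain K where K: "\<And>x. norm (C x) \<le> K * norm x"
    using assms by (metis bounded_clinear_bound)
  have "cmod c * norm (C x) \<le> cmod c * K * norm x" for x
    using K[of x] by (simp add: mult.assoc mult_left_mono)
  then show ?thesis
    by (intro bounded_clinearI[where K="cmod c * K"])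
      (simp_all add: bounded_clinearD[OF assms] scaleC_add_right scaleC_scaleC norm_scaleC mult.commute)
qed

lemma bounded_clinear_diff:
  assumes "bounded_clinear C" "bounded_clinear D"
  shows "bounded_clinear (\<lambda>x. C x - D x)"
  using bounded_clinear_add[OF assms(1) bounded_clinear_scaleC[OF assms(2), of "-1"]]
    scaleC_of_real[of "-1"] by simp

lemma bounded_clinear_zero: "bounded_clinear (\<lambda>x. 0)"
  by (rule bounded_clinearI[where K=0]) auto

lemma bounded_clinear_ident: "bounded_clinear (\<lambda>x. x)"
  by (rule bounded_clinearI[where K=1]) auto

lemmas bounded_clinear_intros = bounded_clinear_compose bounded_clinear_add bounded_clinear_diff
  bounded_clinear_scaleC bounded_clinear_zero bounded_clinear_ident

lemma hermitian_formD:
  assumes "hermitian_form f"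
  shows "f (x + y) z = f x z + f y z" "f x (y + z) = f x y + f x z"
    "f (c *\<^sub>C x) y = c * f x y" "f x (c *\<^sub>C y) = cnj c * f x y"
    "f (x - y) z = f x z - f y z" "f x (y - z) = f x y - f x z"
    "f 0 y = 0" "f x 0 = 0" "f (- x) y = - f x y" "f x (- y) = - f x y"
proof -
  have a: "f (x + y) z = f x z + f y z" and c: "f (c *\<^sub>C x) y = c * f x y" and
    h: "f y x = cnj (f x y)" for x y z c
    using assms unfolding hermitian_form_def by blast+
  have a2: "f x (y + z) = f x y + f x z" for x y z
    by (subst (1 2 3) h) (simp add: a)
  have c2: "f x (c *\<^sub>C y) = cnj c * f x y" for x y c
    by (subst (1 2) h) (simp add: c)
  have m: "- x = (-1) *\<^sub>C x" for x :: 'a using scaleC_of_real[of "-1" x] by simp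
  have n: "f (- x) y = - f x y" "f x (- y) = - f x y" for x y
    unfolding m c c2 by simp_all
  have d: "f (x - y) z = f x z - f y z" "f x (y - z) = f x y - f x z" for x y z
    using a[of x "-y" z] a2[of x y "-z"] by (simp_all add: n)
  have z: "f 0 y = 0" "f x 0 = 0" for x y using d(1)[of 0 0 y] d(2)[of x 0 0] by auto
  show "f (x + y) z = f x z + f y z" by (rule a)
  show "f x (y + z) = f x y + f x z" by (rule a2)
  show "f (c *\<^sub>C x) y = c * f x y" by (rule c)
  show "f x (c *\<^sub>C y) = cnj c * f x y" by (rule c2)
  show "f (x - y) z = f x z - f y z" "f x (y - z) = f x y - f x z" by (rule d)+
  show "f 0 y = 0" "f x 0 = 0" by (rule z)+
  show "f (- x) y = - f x y" "f x (- y) = - f x y" by (rule n)+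
qed

lemma hermitian_form_commute: "hermitian_form f \<Longrightarrow> f y x = cnj (f x y)"
  unfolding hermitian_form_def by blast

lemma hermitian_form_cinner: "hermitian_form (cinner :: 'a::complex_hilbert \<Rightarrow> _)"
  unfolding hermitian_form_def
  by (metis cinner_add_left cinner_scaleC_left cinner_commute)

lemmas cinner_simps = hermitian_formD[OF hermitian_form_cinner]

text \<open>
  A Krein space carries no distinguished inner product, only inner products that induce the topology
  of its norm. The constants of the equivalence are kept in the notion, since they give the norm
  bounds of representing vectors.
\<close>

definition "equivalent_inner_product f a b \<longleftrightarrow> hermitian_form f \<and> a > 0 \<and>
   (\<forall>x. a * (norm x)\<^sup>2 \<le> Re (f x x) \<and> Re (f x x) \<le> b * (norm x)\<^sup>2)"

text \<open>
  Expanding \<open>f (x - c y) (x - c y) \<ge> 0\<close> for \<open>c = t f(x,y)\<close> with real \<open>t\<close> gives a quadratic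
  polynomial in \<open>t\<close>. Its value at \<open>t = 1 / f(y,y)\<close> yields the inequality; if \<open>f(y,y) = 0\<close>, it is
  affine and nonnegative, thus constant.
\<close>

lemma Cauchy_Schwarz_form:
  assumes h: "hermitian_form f" and pos: "\<And>x. 0 \<le> Re (f x x)"
  shows "(cmod (f x y))\<^sup>2 \<le> Re (f x x) * Re (f y y)"
proof -
  have quad: "0 \<le> Re (f x x) - 2 * t * (cmod (f x y))\<^sup>2 + t\<^sup>2 * (cmod (f x y))\<^sup>2 * Re (f y y)" for t :: real
  proof -
    define c where "c = complex_of_real t * f x y"
    have "0 \<le> Re (f (x - c *\<^sub>C y) (x - c *\<^sub>C y))" by (rule pos)
    also have "f (x - c *\<^sub>C y) (x - c *\<^sub>C y) = f x x - cnj c * f x y - c * cnj (f x y) + c * cnj c * f y y"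
      using hermitian_form_commute[OF h, of y x]
      by (simp add: hermitian_formD[OF h] algebra_simps)
    also have "\<dots> = f x x - complex_of_real (2 * t * (cmod (f x y))\<^sup>2) + complex_of_real (t\<^sup>2 * (cmod (f x y))\<^sup>2) * f y y"
      unfolding c_def by (simp add: algebra_simps complex_norm_square[symmetric] power2_eq_square flip: of_real_mult)
        (simp add: complex_norm_square[unfolded power2_eq_square] mult_ac)
    finally show ?thesis by simp
  qed
  let ?c = "(cmod (f x y))\<^sup>2"
  show ?thesis
  proof (cases "Re (f y y) = 0")
    case True
    have "?c = 0"
    proof (rule ccontr)
      assume "?c \<noteq> 0"
      then have "0 < ?c" by simp
      then show False
        using quad[of "(Re (f x x) + 1) / (2 * ?c)"] True by (simp add: field_simps)
    qed
    then show ?thesis using True by simp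
  next
    case False
    then have "0 < Re (f y y)" using pos[of y] by simp
    then show ?thesis using quad[of "1 / Re (f y y)"]
      by (simp add: field_simps power2_eq_square)
  qed
qed

lemma inner_product_bounded:
  assumes "equivalent_inner_product g a b"
  shows "cmod (g x y) \<le> b * norm x * norm y"
proof -
  have herm: "hermitian_form g" and a: "a > 0" and
    lo: "a * (norm x)\<^sup>2 \<le> Re (g x x)" and up: "Re (g x x) \<le> b * (norm x)\<^sup>2" for x
    using assms by (auto simp: equivalent_inner_product_def)
  have pos: "0 \<le> Re (g x x)" for x using lo[of x] a by (smt (verit) mult_nonneg_nonneg zero_le_power2)
  have "(cmod (g x y))\<^sup>2 \<le> (b * (norm x)\<^sup>2) * (b * (norm y)\<^sup>2)"
    using Cauchy_Schwarz_form[OF herm pos, of x y] up[of y] up[of x] pos[of y] pos[of x]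
    by (meson mult_mono order_trans)
  also have "\<dots> = (b * norm x * norm y)\<^sup>2" by (simp add: power2_eq_square)
  finally have le: "(cmod (g x y))\<^sup>2 \<le> (b * norm x * norm y)\<^sup>2" .
  show ?thesis
  proof (cases "x = 0")
    case False
    have "0 \<le> b * (norm x)\<^sup>2" using pos[of x] up[of x] by linarith
    then have "b \<ge> 0" using False by (simp add: zero_le_mult_iff)
    then show ?thesis by (intro power2_le_imp_le[OF le]) auto
  qed (simp add: hermitian_formD[OF herm])
qed

text \<open>
  The representing vector minimizes \<open>J(x) = f(x,x) - 2 Re h(x)\<close>. By the parallelogram law a minimizing
  sequence in \<open>L\<close> is Cauchy, and the first variation of \<open>J\<close> along the sequence gives \<open>h = f(_, y)\<close> in
  the limit. As \<open>L\<close> may fail to be closed, the lemma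
  includes the extension of a bounded functional from \<open>L\<close>, which is used for the lifted operators below.
\<close>

lemma riesz_on_subspace:
  fixes f :: "'a::complex_banach \<Rightarrow> 'a \<Rightarrow> complex"
  assumes eq: "equivalent_inner_product f a b"
    and L: "0 \<in> L" "\<And>x y. x \<in> L \<Longrightarrow> y \<in> L \<Longrightarrow> x + y \<in> L" "\<And>c x. x \<in> L \<Longrightarrow> c *\<^sub>C x \<in> L"
    and h: "\<And>x y. x \<in> L \<Longrightarrow> y \<in> L \<Longrightarrow> h (x + y) = h x + h y"
      "\<And>c x. x \<in> L \<Longrightarrow> h (c *\<^sub>C x) = c * h x"
      "\<And>x. x \<in> L \<Longrightarrow> cmod (h x) \<le> c * norm x"
    and c0: "0 \<le> c"
  shows "\<exists>y. norm y \<le> c / a \<and> (\<forall>x\<in>L. h x = f x y)"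
proof -
  have herm: "hermitian_form f" and a: "a > 0" and
    lo: "a * (norm x)\<^sup>2 \<le> Re (f x x)" and up: "Re (f x x) \<le> b * (norm x)\<^sup>2" for x
    using eq by (auto simp: equivalent_inner_product_def)
  note fs = hermitian_formD[OF herm]
  have pos: "0 \<le> Re (f x x)" for x using lo[of x] a by (smt (verit) mult_nonneg_nonneg zero_le_power2)
  have half: "(1/2) *\<^sub>C x = (1/2) *\<^sub>R x" for x :: 'a using scaleC_of_real[of "1/2" x] by simp
  define J where "J x = Re (f x x) - 2 * Re (h x)" for x
  have Jlow: "- (c\<^sup>2 / a) \<le> J x" if "x \<in> L" for x
  proof -
    have "Re (h x) \<le> c * norm x" using h(3)[OF that] complex_Re_le_cmod order_trans by blast
    then have "J x \<ge> a * (norm x)\<^sup>2 - 2 * (c * norm x)" using lo[of x] by (simp add: J_def)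
    moreover have "a * (norm x)\<^sup>2 - 2 * (c * norm x) + c\<^sup>2 / a = (a * norm x - c)\<^sup>2 / a"
      using a by (simp add: field_simps power2_eq_square)
    moreover have "\<dots> \<ge> 0" using a by simp
    ultimately show ?thesis by linarith
  qed
  define m where "m = Inf (J ` L)"
  have bdd: "bdd_below (J ` L)" using Jlow by (auto intro!: bdd_belowI[where m="- (c\<^sup>2 / a)"])
  have mle: "m \<le> J x" if "x \<in> L" for x
    unfolding m_def using that bdd by (auto intro: cInf_lower)
  have "\<exists>x\<in>L. J x < m + inverse (real (Suc n))" for n
  proof -
    have "m < m + inverse (real (Suc n))" by simp
    then show ?thesis using L(1) unfolding m_def by (subst (asm) cInf_less_iff[OF _ bdd]) auto
  qed
  then obtain X where XL: "\<And>n. X n \<in> L" and XJ: "\<And>n. J (X n) < m + inverse (real (Suc n))"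
    by metis
  have par: "a / 4 * (norm (x - y))\<^sup>2 \<le> (J x + J y) / 2 - m" if "x \<in> L" "y \<in> L" for x y
  proof -
    let ?z = "(1/2) *\<^sub>C (x + y)"
    have "m \<le> J ?z" using that L by (intro mle) auto
    moreover have "J ?z = (J x + J y) / 2 - Re (f (x - y) (x - y)) / 4"
      using that L hermitian_form_commute[OF herm, of x y]
      by (simp add: J_def fs h field_simps)
    ultimately show ?thesis using lo[of "x - y"] by linarith
  qed
  have Jlim: "(\<lambda>n. J (X n)) \<longlonglongrightarrow> m"
  proof (rule tendsto_sandwich[where f="\<lambda>n. m" and h="\<lambda>n. m + inverse (real (Suc n))"])
    show "(\<lambda>n. m + inverse (real (Suc n))) \<longlonglongrightarrow> m"
      using tendsto_add[OF tendsto_const LIMSEQ_inverse_real_of_nat, of m] by simp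
    show "(\<lambda>n. m) \<longlonglongrightarrow> m" by simp
    show "\<forall>\<^sub>F n in sequentially. m \<le> J (X n)" using mle[OF XL] by simp
    show "\<forall>\<^sub>F n in sequentially. J (X n) \<le> m + inverse (real (Suc n))"
      using less_imp_le[OF XJ] by (intro always_eventually) blast
  qed
  have "Cauchy X"
  proof (rule metric_CauchyI)
    fix e :: real assume e: "e > 0"
    have "a / 4 * e\<^sup>2 > 0" using a e by simp
    from order_tendstoD(2)[OF Jlim, of "m + a / 4 * e\<^sup>2"] this
    obtain M where M: "\<And>n. n \<ge> M \<Longrightarrow> J (X n) < m + a / 4 * e\<^sup>2"
      by (auto simp: eventually_sequentially)
    show "\<exists>M. \<forall>i\<ge>M. \<forall>n\<ge>M. dist (X i) (X n) < e"
    proof (intro exI allI impI)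
      fix i n assume i: "M \<le> i" and n: "M \<le> n"
      have "a / 4 * (norm (X i - X n))\<^sup>2 < a / 4 * e\<^sup>2"
        using par[OF XL XL, of i n] M[OF i] M[OF n] by argo
      then have "(norm (X i - X n))\<^sup>2 < e\<^sup>2" using a by simp
      then show "dist (X i) (X n) < e" using e by (simp add: dist_norm power_less_imp_less_base)
    qed
  qed
  then obtain y where y: "X \<longlonglongrightarrow> y" using Cauchy_convergent convergent_def by blast
  have lim_f: "(\<lambda>n. f z (X n)) \<longlonglongrightarrow> f z y" for z
  proof (rule Lim_null[THEN iffD2], rule Lim_null_comparison)
    show "\<forall>\<^sub>F n in sequentially. norm (f z (X n) - f z y) \<le> b * norm z * norm (X n - y)"
      using inner_product_bounded[OF eq, of z "X _ - y"] by (auto intro!: always_eventually simp: fs)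
    show "(\<lambda>n. b * norm z * norm (X n - y)) \<longlonglongrightarrow> 0"
      using y by (intro tendsto_mult_right_zero tendsto_norm_zero) (simp add: LIM_zero)
  qed
  have ReEq: "Re (f z y) = Re (h z)" if z: "z \<in> L" for z
  proof -
    define d where "d = Re (f z y) - Re (h z)"
    have ineq: "0 \<le> 2 * t * d + t\<^sup>2 * Re (f z z)" for t :: real
    proof -
      have "0 \<le> (J (X n) - m) + 2 * t * (Re (f z (X n)) - Re (h z)) + t\<^sup>2 * Re (f z z)" for n
      proof -
        let ?w = "X n + complex_of_real t *\<^sub>C z"
        have "m \<le> J ?w" using z XL L by (intro mle) auto
        also have "J ?w = J (X n) + 2 * t * (Re (f z (X n)) - Re (h z)) + t\<^sup>2 * Re (f z z)"
          using hermitian_form_commute[OF herm, of z "X n"] z XL L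
          by (simp add: J_def fs h algebra_simps power2_eq_square)
        finally show ?thesis by simp
      qed
      moreover have "(\<lambda>n. (J (X n) - m) + 2 * t * (Re (f z (X n)) - Re (h z)) + t\<^sup>2 * Re (f z z))
          \<longlonglongrightarrow> (m - m) + 2 * t * (Re (f z y) - Re (h z)) + t\<^sup>2 * Re (f z z)"
        by (intro tendsto_intros Jlim tendsto_Re lim_f)
      ultimately show ?thesis unfolding d_def
        by (intro LIMSEQ_le_const[where X="\<lambda>n. (J (X n) - m) + 2 * t * (Re (f z (X n)) - Re (h z)) + t\<^sup>2 * Re (f z z)"]) auto
    qed
    have "d = 0"
    proof (rule ccontr)
      assume d: "d \<noteq> 0"
      let ?g = "Re (f z z)"
      have g: "?g + 1 > 0" using pos[of z] by linarith
      \<comment> \<open>\<open>t = -e\<close> makes the linear term dominate, also when \<open>?g = 0\<close>\<close>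
      define e where "e = d / (?g + 1)"
      have de: "d = e * (?g + 1)" "e \<noteq> 0" using g d by (auto simp: e_def)
      have "2 * (- e) * d + (- e)\<^sup>2 * ?g = - (e\<^sup>2 * (?g + 2))"
        unfolding de by (simp add: algebra_simps power2_eq_square)
      moreover have "e\<^sup>2 * (?g + 2) > 0" using de g by (intro mult_pos_pos) auto
      ultimately show False using ineq[of "- e"] by linarith
    qed
    then show ?thesis by (simp add: d_def)
  qed
  have hz: "h z = f z y" if z: "z \<in> L" for z
  proof (rule complex_eqI)
    show "Re (h z) = Re (f z y)" using ReEq[OF z] by simp
    show "Im (h z) = Im (f z y)"
      using ReEq[OF L(3)[OF z, of "\<i>"]] z by (simp add: fs h)
  qed
  have "norm y \<le> c / a"
  proof (cases "y = 0")
    case False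
    have "Re (f (X n) y) \<le> c * norm (X n)" for n
      using hz[OF XL] h(3)[OF XL] complex_Re_le_cmod order_trans by metis
    moreover have "(\<lambda>n. Re (f (X n) y)) \<longlonglongrightarrow> Re (f y y)"
      using tendsto_Re[OF lim_f[of y]] hermitian_form_commute[OF herm, of y "X _"] by simp
    moreover have "(\<lambda>n. c * norm (X n)) \<longlonglongrightarrow> c * norm y" by (intro tendsto_intros y)
    ultimately have "Re (f y y) \<le> c * norm y" by (blast intro: LIMSEQ_le)
    then have "a * norm y * norm y \<le> c * norm y" using lo[of y] by (simp add: power2_eq_square)
    then show ?thesis using a False by (simp add: field_simps)
  next
    case True
    then show ?thesis using a c0 by simp
  qed
  then show ?thesis using hz by blast
qed

text \<open>
  This is the common ground of Hilbert and Krein spaces: the form is continuous and nondegenerate, and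
  it represents all bounded linear functionals, with a uniform bound for the representing vectors.
\<close>

definition riesz_form :: "('a::complex_banach \<Rightarrow> 'a \<Rightarrow> complex) \<Rightarrow> bool" where
  "riesz_form f \<longleftrightarrow> hermitian_form f \<and>
     (\<exists>K. \<forall>x y. cmod (f x y) \<le> K * norm x * norm y) \<and>
     (\<forall>y. (\<forall>x. f x y = 0) \<longrightarrow> y = 0) \<and>
     (\<exists>K. \<forall>h c. c \<ge> 0 \<and> (\<forall>x y. h (x + y) = h x + h y) \<and> (\<forall>c x. h (c *\<^sub>C x) = c * h x) \<and>
        (\<forall>x. cmod (h x) \<le> c * norm x) \<longrightarrow> (\<exists>y. norm y \<le> K * c \<and> (\<forall>x. h x = f x y)))"

lemma inner_product_definite:
  assumes "equivalent_inner_product g a b" "g x x = 0"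
  shows "x = 0"
proof -
  have "a > 0" "a * (norm x)\<^sup>2 \<le> 0"
    using assms by (auto simp: equivalent_inner_product_def dest!: spec[of _ x])
  then show ?thesis by (simp add: mult_le_0_iff)
qed

text \<open>
  An indefinite form that becomes an inner product \<open>g\<close> after a bounded change of sign \<open>J\<close> inherits
  the Riesz theorem from \<open>g\<close>: if \<open>g(_, y)\<close> represents a functional, so does \<open>f(_, J y)\<close>.
\<close>

lemma riesz_formI_involution:
  assumes g: "equivalent_inner_product g a b"
    and f: "hermitian_form f"
    and J: "\<And>x. J (J x) = x" "\<And>x. norm (J x) \<le> d * norm x" "\<And>x y. g x y = f x (J y)"
    and d: "d \<ge> 0"
  shows "riesz_form f"
proof -
  have a: "a > 0"
    using g unfolding equivalent_inner_product_def by blast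
  have fJ: "f x y = g x (J y)" for x y by (simp add: J)
  have 1: "cmod (f x y) \<le> (\<bar>b\<bar> * d) * norm x * norm y" for x y
  proof -
    have "cmod (f x y) \<le> b * norm x * norm (J y)"
      unfolding fJ by (rule inner_product_bounded[OF g])
    also have "\<dots> \<le> \<bar>b\<bar> * norm x * norm (J y)" by (intro mult_right_mono) auto
    also have "\<dots> \<le> \<bar>b\<bar> * norm x * (d * norm y)" by (intro mult_left_mono J) auto
    finally show ?thesis by (simp add: mult_ac)
  qed
  have 2: "y = 0" if "\<forall>x. f x y = 0" for y
  proof -
    have "J y = 0" using that inner_product_definite[OF g, of "J y"] by (simp add: fJ)
    then have "J (J y) = J 0" by simp
    moreover have "J 0 = 0" using J(2)[of 0] by simp
    ultimately show ?thesis by (simp add: J)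
  qed
  have 3: "\<exists>y. norm y \<le> d / a * c \<and> (\<forall>x. h x = f x y)"
    if "c \<ge> 0" "\<forall>x y. h (x + y) = h x + h y" "\<forall>c x. h (c *\<^sub>C x) = c * h x"
      "\<forall>x. cmod (h x) \<le> c * norm x" for h c
  proof -
    have "\<exists>y. norm y \<le> c / a \<and> (\<forall>x\<in>UNIV. h x = g x y)"
      using that by (intro riesz_on_subspace[OF g]) simp_all
    then obtain y where y: "norm y \<le> c / a" "\<And>x. h x = g x y" by blast
    have "norm (J y) \<le> d * (c / a)" using J(2)[of y] mult_left_mono[OF y(1) d] by linarith
    then show ?thesis using y(2) J by (intro exI[of _ "J y"]) (simp add: mult_ac)
  qed
  show ?thesis unfolding riesz_form_def
  proof (intro conjI f)
    show "\<exists>K. \<forall>x y. cmod (f x y) \<le> K * norm x * norm y" using 1 by blast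
    show "\<forall>y. (\<forall>x. f x y = 0) \<longrightarrow> y = 0" using 2 by blast
    show "\<exists>K. \<forall>h c. c \<ge> 0 \<and> (\<forall>x y. h (x + y) = h x + h y) \<and> (\<forall>c x. h (c *\<^sub>C x) = c * h x) \<and>
        (\<forall>x. cmod (h x) \<le> c * norm x) \<longrightarrow> (\<exists>y. norm y \<le> K * c \<and> (\<forall>x. h x = f x y))"
      by (rule exI[of _ "d / a"], intro allI impI, elim conjE) (rule 3)
  qed
qed

lemma equivalent_inner_product_cinner:
  "equivalent_inner_product (cinner :: 'a::complex_hilbert \<Rightarrow> _) 1 1"
  by (simp add: equivalent_inner_product_def hermitian_form_cinner cinner_self)

lemma riesz_form_cinner: "riesz_form (cinner :: 'a::complex_hilbert \<Rightarrow> _)"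
  by (rule riesz_formI_involution[OF equivalent_inner_product_cinner hermitian_form_cinner,
        where J=id and d=1]) auto

text \<open>
  The involution is the fundamental symmetry \<open>u + v \<mapsto> u - v\<close> of a fundamental decomposition.
  It is bounded because it preserves the inner product \<open>g\<close>.
\<close>

lemma riesz_form_krein:
  assumes "krein_space f"
  shows "riesz_form f"
proof -
  obtain P M a b where herm: "hermitian_form f" and P: "complex_vector.subspace P"
    and M: "complex_vector.subspace M" and PM: "P \<inter> M = {0}" and
    dec: "\<forall>x. \<exists>u\<in>P. \<exists>v\<in>M. x = u + v" and orth: "\<forall>u\<in>P. \<forall>v\<in>M. f u v = 0" and a: "a > 0" and
    ab: "\<forall>u\<in>P. \<forall>v\<in>M.
            a * (norm (u + v))\<^sup>2 \<le> Re (f u u) - Re (f v v) \<and>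
            Re (f u u) - Re (f v v) \<le> b * (norm (u + v))\<^sup>2"
    using assms unfolding krein_space_def by (elim conjE exE) (rule that; assumption)
  note fs = hermitian_formD[OF herm]
  have orth': "f v u = 0" if "u \<in> P" "v \<in> M" for u v
    using hermitian_form_commute[OF herm, of v u] orth that by simp
  obtain pr mi where pm: "\<And>x. pr x \<in> P" "\<And>x. mi x \<in> M" "\<And>x. x = pr x + mi x"
    using dec by metis
  have unique: "pr x = u \<and> mi x = v" if "u \<in> P" "v \<in> M" "x = u + v" for x u v
  proof -
    have "pr x - u = v - mi x" using pm(3)[of x] that by (simp add: algebra_simps)
    moreover have "pr x - u \<in> P" "v - mi x \<in> M"
      using that pm P M by (auto intro: complex_vector.subspace_diff)
    ultimately have "pr x - u \<in> P \<inter> M" by auto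
    then have "pr x - u = 0" using PM by blast
    with \<open>pr x - u = v - mi x\<close> show ?thesis by simp
  qed
  define J where "J x = pr x - mi x" for x
  have prJ: "pr (J x) = pr x" "mi (J x) = - mi x" for x
    using unique[of "pr x" "- mi x" "J x"] pm M
    by (auto simp: J_def intro: complex_vector.subspace_neg)
  have JJ: "J (J x) = x" for x
    using pm(3)[of x] by (simp add: J_def[of "J x"] prJ)
  define g where "g x y = f x (J y)" for x y
  have g_alt: "g x y = f (pr x) (pr y) - f (mi x) (mi y)" for x y
  proof -
    have "g x y = f (pr x + mi x) (pr y - mi y)" unfolding g_def J_def using pm(3)[of x] by simp
    then show ?thesis
      using orth[rule_format, OF pm(1) pm(2), of x y] orth'[OF pm(1)[of y] pm(2)[of x]] by (simp add: fs)
  qed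
  have add: "pr (x + y) = pr x + pr y \<and> mi (x + y) = mi x + mi y" for x y
    using pm(1,2)[of x] pm(1,2)[of y] pm(3)[of x] pm(3)[of y] P M
    by (intro unique) (auto intro: complex_vector.subspace_add simp: algebra_simps)
  have scl: "pr (c *\<^sub>C x) = c *\<^sub>C pr x \<and> mi (c *\<^sub>C x) = c *\<^sub>C mi x" for x c
    using pm(1,2)[of x] pm(3)[of x] P M
    by (intro unique) (auto intro: complex_vector.subspace_scale simp flip: scaleC_add_right)
  have "g y x = cnj (g x y)" for x y
    unfolding g_alt
    by (subst (1 2) hermitian_form_commute[OF herm]) simp
  then have "hermitian_form g"
    unfolding hermitian_form_def
    by (simp add: g_alt add scl fs algebra_simps)
  moreover have "a * (norm x)\<^sup>2 \<le> Re (g x x) \<and> Re (g x x) \<le> b * (norm x)\<^sup>2" for x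
    using ab[rule_format, OF pm(1,2), of x x] pm(3)[of x] by (simp add: g_alt)
  ultimately have eq: "equivalent_inner_product g a b"
    using a by (simp add: equivalent_inner_product_def)
  have gJ: "g (J x) (J x) = g x x" for x by (simp add: g_alt prJ fs)
  define d where "d = sqrt (\<bar>b\<bar> / a)"
  have "norm (J x) \<le> d * norm x" for x
  proof -
    have "a * (norm (J x))\<^sup>2 \<le> Re (g (J x) (J x))"
      using eq unfolding equivalent_inner_product_def by blast
    also have "\<dots> \<le> b * (norm x)\<^sup>2"
      unfolding gJ using eq unfolding equivalent_inner_product_def by blast
    also have "\<dots> \<le> \<bar>b\<bar> * (norm x)\<^sup>2" by (intro mult_right_mono) auto
    finally have "(norm (J x))\<^sup>2 \<le> (d * norm x)\<^sup>2"
      using a by (simp add: d_def field_simps power_mult_distrib)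
    then show ?thesis using a by (auto intro: power2_le_imp_le simp: d_def)
  qed
  then show ?thesis
    using JJ a by (intro riesz_formI_involution[OF eq herm, where J=J and d=d]) (auto simp: g_def d_def)
qed

lemma riesz_form_nondegenerate:
  assumes "riesz_form f" "\<And>x. f x y = f x z"
  shows "y = z"
proof -
  have "f x (y - z) = 0" for x
    using assms by (simp add: riesz_form_def hermitian_formD)
  then show ?thesis using assms(1) unfolding riesz_form_def by (metis eq_iff_diff_eq_0)
qed

lemma riesz_form_hermitian: "riesz_form f \<Longrightarrow> hermitian_form f"
  by (simp add: riesz_form_def)

lemma adjoint_exists:
  assumes f: "riesz_form f" and g: "riesz_form g" and C: "bounded_clinear C"
  shows "\<exists>D. bounded_clinear D \<and> (\<forall>x y. g (C x) y = f x (D y))"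
proof -
  note fs = hermitian_formD[OF riesz_form_hermitian[OF f]]
  note gs = hermitian_formD[OF riesz_form_hermitian[OF g]]
  obtain Kg where Kg: "\<And>x y. cmod (g x y) \<le> Kg * norm x * norm y"
    using g by (auto simp: riesz_form_def)
  obtain Kf where Kf: "\<And>h c. c \<ge> 0 \<and> (\<forall>x y. h (x + y) = h x + h y) \<and> (\<forall>c x. h (c *\<^sub>C x) = c * h x) \<and>
        (\<forall>x. cmod (h x) \<le> c * norm x) \<Longrightarrow> (\<exists>y. norm y \<le> Kf * c \<and> (\<forall>x. h x = f x y))"
    using f by (auto simp: riesz_form_def)
  obtain KC where KC: "KC > 0" "\<And>x. norm (C x) \<le> KC * norm x"
    using bounded_clinear_bound[OF C] by blast
  define c where "c = \<bar>Kg\<bar> * KC"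
  have c: "c \<ge> 0" using KC by (simp add: c_def)
  have bd: "cmod (g (C x) y) \<le> c * norm y * norm x" for x y
  proof -
    have "cmod (g (C x) y) \<le> Kg * norm (C x) * norm y" by (rule Kg)
    also have "\<dots> \<le> \<bar>Kg\<bar> * norm (C x) * norm y" by (intro mult_right_mono) auto
    also have "\<dots> \<le> \<bar>Kg\<bar> * (KC * norm x) * norm y"
      by (intro mult_right_mono mult_left_mono KC) auto
    finally show ?thesis by (simp add: c_def mult_ac)
  qed
  have "\<exists>z. norm z \<le> Kf * (c * norm y) \<and> (\<forall>x. g (C x) y = f x z)" for y
    using c bd by (intro Kf) (auto simp: bounded_clinearD[OF C] gs)
  then obtain D where D: "\<And>y. norm (D y) \<le> Kf * (c * norm y)" "\<And>x y. g (C x) y = f x (D y)"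
    by metis
  have "bounded_clinear D"
  proof (rule bounded_clinearI)
    show "norm (D y) \<le> (Kf * c) * norm y" for y using D(1)[of y] by (simp add: mult_ac)
    show "D (x + y) = D x + D y" for x y
      by (rule riesz_form_nondegenerate[OF f]) (simp add: fs gs flip: D(2))
    show "D (c *\<^sub>C y) = c *\<^sub>C D y" for c y
      by (rule riesz_form_nondegenerate[OF f]) (simp add: fs gs flip: D(2))
  qed
  then show ?thesis using D by blast
qed

lemma adjoint_eqI:
  assumes f: "riesz_form f" and D: "bounded_clinear D" "\<And>x y. g (C x) y = f x (D y)"
  shows "adjoint_wrt f g C = D"
  unfolding adjoint_wrt_def
proof (rule the_equality)
  fix D' assume "bounded_clinear D' \<and> (\<forall>x y. g (C x) y = f x (D' y))"
  then show "D' = D" using D(2) by (intro ext riesz_form_nondegenerate[OF f]) simp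
qed (use D in auto)

lemma
  assumes "riesz_form f" "riesz_form g" "bounded_clinear C"
  shows bounded_clinear_adjoint: "bounded_clinear (adjoint_wrt f g C)"
    and adjoint_works: "g (C x) y = f x (adjoint_wrt f g C y)"
  using adjoint_exists[OF assms] adjoint_eqI[OF assms(1), of _ g C] by (metis)+

lemma adjoint_works':
  assumes "riesz_form f" "riesz_form g" "bounded_clinear C"
  shows "g x (C y) = f (adjoint_wrt f g C x) y"
  using adjoint_works[OF assms, of y x] assms(1,2)
  by (metis hermitian_form_commute riesz_form_hermitian)

section \<open>Common Taylor zeros and the ideal generated by \<open>p(z)\<close> and \<open>q(w)\<close>\<close>

lemma const_poly_mult: "[:a:] * s = smult a s" for s :: "'a::comm_ring_1 poly"
  by simp

text \<open>
  Over the complex numbers both polynomials are products of powers of linear factors.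
\<close>

lemma poly_dvd_if_root_powers_dvd:
  fixes P t :: "complex poly"
  assumes P: "P \<noteq> 0" and dvd: "\<And>x. poly P x = 0 \<Longrightarrow> [:-x, 1:] ^ order x P dvd t"
  shows "P dvd t"
proof (cases "t = 0")
  case False
  have roots: "{x. poly P x = 0} \<subseteq> {x. poly t x = 0}"
  proof safe
    fix x assume x: "poly P x = 0"
    then have "order x P \<noteq> 0" using P by (simp add: order_root)
    then have "[:-x, 1:] dvd [:-x, 1:] ^ order x P" by (intro dvd_power) auto
    then show "poly t x = 0" using dvd[OF x] by (meson dvd_trans poly_eq_0_iff_dvd)
  qed
  have "(\<Prod>x | poly P x = 0. [:-x, 1:] ^ order x P) dvd (\<Prod>x | poly t x = 0. [:-x, 1:] ^ order x t)"
  proof (rule prod_dvd_prod_subset2[OF _ roots])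
    show "finite {x. poly t x = 0}" using False by (rule poly_roots_finite)
    fix x assume "x \<in> {x. poly P x = 0}"
    then have "order x P \<le> order x t" using dvd[of x] False order_divides[of x _ t] by auto
    then show "[:-x, 1:] ^ order x P dvd [:-x, 1:] ^ order x t" by (rule le_imp_power_dvd)
  qed
  then have "smult (lead_coeff P) (\<Prod>x | poly P x = 0. [:-x, 1:] ^ order x P) dvd
             smult (lead_coeff t) (\<Prod>x | poly t x = 0. [:-x, 1:] ^ order x t)"
    using P False by (simp add: smult_dvd_iff dvd_smult)
  then show ?thesis by (simp only: complex_poly_decompose)
qed auto

lemma power_dvd_iff_shift:
  fixes t :: "complex poly"
  shows "[:-x, 1:] ^ m dvd t \<longleftrightarrow> (\<forall>k<m. coeff (pcompose t [:x, 1:]) k = 0)"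
proof -
  have pw: "pcompose (a ^ n) b = pcompose a b ^ n" for a b :: "complex poly" and n
    by (induction n) (simp_all add: pcompose_mult pcompose_1)
  have inv: "pcompose [:x, 1:] [:-x, 1:] = [:0, 1:]" "pcompose [:-x, 1:] [:x, 1:] = [:0, 1:]"
    by (simp_all add: pcompose_pCons)
  have id: "pcompose (pcompose t [:x, 1:]) [:-x, 1:] = t"
    by (simp only: pcompose_assoc[symmetric] inv) (rule pcompose_idR)
  have "[:-x, 1:] ^ m dvd t \<longleftrightarrow> [:0, 1:] ^ m dvd pcompose t [:x, 1:]"
  proof
    assume "[:-x, 1:] ^ m dvd t"
    then obtain s where "t = [:-x, 1:] ^ m * s" by (elim dvdE)
    then show "[:0, 1:] ^ m dvd pcompose t [:x, 1:]" by (simp only: pcompose_mult pw inv) simp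
  next
    assume "[:0, 1:] ^ m dvd pcompose t [:x, 1:]"
    then obtain s where "pcompose t [:x, 1:] = [:0, 1:] ^ m * s" by (elim dvdE)
    then have "t = pcompose ([:0, 1:] ^ m * s) [:-x, 1:]" using id by simp
    also have "\<dots> = [:-x, 1:] ^ m * pcompose s [:-x, 1:]"
      by (simp only: pcompose_mult pw) (simp add: pcompose_pCons)
    finally show "[:-x, 1:] ^ m dvd t" by simp
  qed
  then show ?thesis by (simp add: monom_1_dvd_iff'[symmetric] monom_altdef)
qed

text \<open>
  The polynomial \<open>s(x + z, y + w)\<close>. Its coefficients are the Taylor coefficients of \<open>s\<close> at \<open>(x,y)\<close>,
  and \<open>shift2 x y\<close> is a ring homomorphism, so that products of jets become products of polynomials.
\<close>

definition shift2 :: "complex \<Rightarrow> complex \<Rightarrow> complex poly poly \<Rightarrow> complex poly poly" where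
  "shift2 x y s = pcompose (map_poly (\<lambda>c. pcompose c [:x, 1:]) s) [:[:y:], 1:]"

lemma map_poly_add_hom:
  assumes "\<And>a b. h (a + b) = h a + h b" "h 0 = 0"
  shows "map_poly h (s + t) = map_poly h s + map_poly h t"
  by (rule poly_eqI) (simp add: coeff_map_poly assms)

lemma map_poly_mult_hom:
  assumes "\<And>a b. h (a + b) = h a + h b" "h 0 = 0" "\<And>a b. h (a * b) = h a * h b"
  shows "map_poly h (s * t) = map_poly h s * map_poly h t"
proof (rule poly_eqI)
  have "h (sum f A) = (\<Sum>x\<in>A. h (f x))" for f :: "nat \<Rightarrow> _" and A
    by (induction A rule: infinite_finite_induct) (simp_all add: assms)
  then show "coeff (map_poly h (s * t)) n = coeff (map_poly h s * map_poly h t) n" for n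
    by (simp add: coeff_map_poly assms coeff_mult)
qed

lemma shift2_add: "shift2 x y (s + t) = shift2 x y s + shift2 x y t"
  unfolding shift2_def by (simp add: map_poly_add_hom pcompose_add)

lemma shift2_mult: "shift2 x y (s * t) = shift2 x y s * shift2 x y t"
  unfolding shift2_def by (simp add: map_poly_mult_hom pcompose_add pcompose_mult)

lemma shift2_pCons: "shift2 x y (pCons c s) = [:pcompose c [:x, 1:]:] + [:[:y:], 1:] * shift2 x y s"
  unfolding shift2_def by (simp add: map_poly_pCons pcompose_pCons)

lemma shift2_0: "shift2 x y 0 = 0"
  by (simp add: shift2_def)

lemma coeff_linear_mult:
  "coeff ([:a, 1:] * s) l = a * coeff s l + (if l = 0 then 0 else coeff s (l - 1))"
  for s :: "'a::comm_ring_1 poly"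
  by (simp add: coeff_pCons split: nat.split)

text \<open>
  The two shifts can be separated: the coefficient of \<open>z^k\<close> in the shift of the inner variable is a
  polynomial in \<open>w\<close>, to which the one-variable theory applies.
\<close>

lemma coeff_shift2:
  "coeff (coeff (shift2 x y s) l) k =
     coeff (pcompose (map_poly (\<lambda>c. coeff (pcompose c [:x, 1:]) k) s) [:y, 1:]) l"
proof (induction s arbitrary: l rule: pCons_induct)
  case 0
  then show ?case by (simp add: shift2_0)
next
  case (pCons c s)
  show ?case
    by (simp only: shift2_pCons coeff_add coeff_linear_mult)
      (auto simp: map_poly_pCons pcompose_pCons coeff_linear_mult pCons.IH coeff_pCons const_poly_mult simp del: mult_pCons_left split: nat.split)
qed

lemma pderiv_shift2: "pderiv (shift2 x y s) = shift2 x y (pderiv s)"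
proof -
  have "pderiv (map_poly (\<lambda>c. pcompose c [:x, 1:]) s) = map_poly (\<lambda>c. pcompose c [:x, 1:]) (pderiv s)"
    by (rule poly_eqI) (simp add: coeff_pderiv coeff_map_poly pcompose_mult of_nat_poly pcompose_add pcompose_1 pcompose_smult)
  then show ?thesis by (simp add: shift2_def pderiv_pcompose pderiv_pCons)
qed

lemma map_pderiv_shift2: "map_poly pderiv (shift2 x y s) = shift2 x y (map_poly pderiv s)"
proof (induction s rule: pCons_induct)
  case 0
  then show ?case by (simp add: shift2_0)
next
  case (pCons c s)
  have "map_poly pderiv ([:[:y:], 1:] * t) = [:[:y:], 1:] * map_poly pderiv t" for t :: "complex poly poly"
    by (rule poly_eqI) (simp add: coeff_map_poly coeff_linear_mult const_poly_mult pderiv_add pderiv_smult del: mult_pCons_left)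
  moreover have "pderiv (pcompose c [:x, 1:]) = pcompose (pderiv c) [:x, 1:]"
    by (simp add: pderiv_pcompose pderiv_pCons)
  ultimately show ?case
    by (simp add: shift2_pCons map_poly_pCons map_poly_add_hom pderiv_add pCons.IH del: mult_pCons_left)
qed

lemma poly2_shift2: "poly2 s x y = coeff (coeff (shift2 x y s) 0) 0"
proof -
  have "poly2 s x y = poly (poly (shift2 x y s) 0) 0"
    unfolding poly2_def
    by (induction s rule: pCons_induct) (simp_all add: shift2_pCons shift2_0 poly_pcompose)
  then show ?thesis by (simp add: poly_0_coeff_0)
qed

text \<open>
  Shifting commutes with both derivatives, so it suffices to look at the point \<open>(0,0)\<close>.
\<close>

lemma taylor2_eq_coeff: "taylor2 s x y k l = coeff (coeff (shift2 x y s) l) k"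
proof -
  have 1: "shift2 x y ((pderiv ^^ l) s) = (pderiv ^^ l) (shift2 x y s)" for l s
    by (induction l) (simp_all add: pderiv_shift2[symmetric])
  have 2: "shift2 x y ((map_poly pderiv ^^ k) s) = (map_poly pderiv ^^ k) (shift2 x y s)" for k s
    by (induction k) (simp_all add: map_pderiv_shift2[symmetric])
  have 3: "coeff ((map_poly pderiv ^^ k) t) 0 = (pderiv ^^ k) (coeff t 0)" for t :: "complex poly poly"
    by (induction k) (simp_all add: coeff_map_poly)
  have "poly2 ((map_poly pderiv ^^ k) ((pderiv ^^ l) s)) x y =
      coeff ((pderiv ^^ k) (fact l * coeff (shift2 x y s) l)) 0"
    by (simp add: poly2_shift2 1 2 3 coeff_higher_pderiv pochhammer_fact)
  also have "fact l * coeff (shift2 x y s) l = smult (fact l) (coeff (shift2 x y s) l)"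
  proof -
    have "(fact l :: complex poly) = [:fact l:]"
      by (metis of_nat_fact of_nat_poly)
    then show ?thesis by simp
  qed
  also have "coeff ((pderiv ^^ k) \<dots>) 0 = fact l * (fact k * coeff (coeff (shift2 x y s) l) k)"
    by (simp add: higher_pderiv_smult coeff_higher_pderiv pochhammer_fact)
  finally show ?thesis by (simp add: taylor2_def)
qed

lemma taylor2_add: "taylor2 (s + t) x y k l = taylor2 s x y k l + taylor2 t x y k l"
  by (simp add: taylor2_eq_coeff shift2_add)

lemma taylor2_diff: "taylor2 (s - t) x y k l = taylor2 s x y k l - taylor2 t x y k l"
  using taylor2_add[of "s - t" t] by simp

lemma poly2_add: "poly2 (s + t) x y = poly2 s x y + poly2 t x y"
  and poly2_mult: "poly2 (s * t) x y = poly2 s x y * poly2 t x y"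
  and poly2_diff: "poly2 (s - t) x y = poly2 s x y - poly2 t x y"
  by (simp_all add: poly2_def)

lemma poly2_in_first: "poly2 (in_first p) x y = poly (cpoly p) x"
  by (simp add: poly2_def in_first_def)

lemma in_second_eq: "in_second q = map_poly (\<lambda>c. [:c:]) (cpoly q)"
  unfolding in_second_def by (rule poly_eqI) (simp add: coeff_map_poly)

lemma poly2_in_second: "poly2 (in_second q) x y = poly (cpoly q) y"
proof -
  have "poly (poly (map_poly (\<lambda>c. [:c:]) r) [:y:]) x = poly r y" for r :: "complex poly"
    by (induction r rule: pCons_induct) (simp_all add: map_poly_pCons)
  then show ?thesis by (simp add: poly2_def in_second_eq)
qed

lemma shift2_in_first: "shift2 x y (in_first p) = [:pcompose (cpoly p) [:x, 1:]:]"
  by (simp add: in_first_def shift2_pCons shift2_0)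

lemma shift2_in_second: "shift2 x y (in_second q) = map_poly (\<lambda>c. [:c:]) (pcompose (cpoly q) [:y, 1:])"
proof -
  have "shift2 x y (map_poly (\<lambda>c. [:c:]) r) = map_poly (\<lambda>c. [:c:]) (pcompose r [:y, 1:])" for r :: "complex poly"
  proof (induction r rule: pCons_induct)
    case (pCons a r)
    have "map_poly (\<lambda>c. [:c:]) ([:y, 1:] * t) = [:[:y:], 1:] * map_poly (\<lambda>c. [:c:]) t" for t :: "complex poly"
      by (rule poly_eqI) (simp add: coeff_map_poly coeff_linear_mult del: mult_pCons_left)
    then show ?case
      by (simp add: map_poly_pCons shift2_pCons pCons.IH pcompose_pCons map_poly_add_hom del: mult_pCons_left)
  qed (simp add: shift2_0)
  then show ?thesis by (simp add: in_second_eq)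
qed

lemma taylor2_in_first_mult:
  "taylor2 (in_first p * u) x y k l =
     (\<Sum>i\<le>k. coeff (pcompose (cpoly p) [:x, 1:]) i * taylor2 u x y (k - i) l)"
  by (simp add: taylor2_eq_coeff shift2_mult shift2_in_first coeff_mult)

lemma taylor2_in_second_mult:
  "taylor2 (in_second q * v) x y k l =
     (\<Sum>i\<le>l. coeff (pcompose (cpoly q) [:y, 1:]) i * taylor2 v x y k (l - i))"
  by (simp add: taylor2_eq_coeff shift2_mult shift2_in_second coeff_mult[of "map_poly _ _"]
      coeff_map_poly coeff_sum)

lemma coeff_shift_below_order:
  assumes "k < mult_zero p x"
  shows "coeff (pcompose (cpoly p) [:x, 1:]) k = 0"
  using power_dvd_iff_shift[of x "mult_zero p x" "cpoly p"] order_1[of x "cpoly p"] assms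
  by (simp add: mult_zero_def)

lemma cpoly_eq_0_iff [simp]: "cpoly p = 0 \<longleftrightarrow> p = 0"
  by (simp add: map_poly_eq_0_iff)

text \<open>
  Otherwise \<open>x\<close> would be a zero of higher multiplicity.
\<close>

lemma coeff_shift_at_order:
  assumes "p \<noteq> 0"
  shows "coeff (pcompose (cpoly p) [:x, 1:]) (mult_zero p x) \<noteq> 0"
proof
  assume "coeff (pcompose (cpoly p) [:x, 1:]) (mult_zero p x) = 0"
  then have "[:-x, 1:] ^ Suc (order x (cpoly p)) dvd cpoly p"
    using power_dvd_iff_shift[of x "Suc (mult_zero p x)" "cpoly p"] coeff_shift_below_order[of _ p x]
    by (auto simp: mult_zero_def less_Suc_eq)
  then show False using order_2[of "cpoly p" x] assms by simp
qed

lemma taylor2_in_first_mult_low: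
  assumes "k < mult_zero p x"
  shows "taylor2 (in_first p * u) x y k l = 0"
  unfolding taylor2_in_first_mult using assms by (intro sum.neutral) (auto intro: coeff_shift_below_order)

lemma taylor2_in_second_mult_low:
  assumes "l < mult_zero q y"
  shows "taylor2 (in_second q * u) x y k l = 0"
  unfolding taylor2_in_second_mult using assms by (intro sum.neutral) (auto intro: coeff_shift_below_order)

lemma taylor2_in_first_mult_order:
  "taylor2 (in_first p * u) x y (mult_zero p x) l =
     coeff (pcompose (cpoly p) [:x, 1:]) (mult_zero p x) * taylor2 u x y 0 l"
proof -
  have "taylor2 (in_first p * u) x y (mult_zero p x) l =
     (\<Sum>i\<in>{mult_zero p x}. coeff (pcompose (cpoly p) [:x, 1:]) i * taylor2 u x y (mult_zero p x - i) l)"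
    unfolding taylor2_in_first_mult
    by (rule sum.mono_neutral_right) (auto intro: coeff_shift_below_order)
  then show ?thesis by simp
qed

lemma taylor2_in_second_mult_order:
  "taylor2 (in_second q * u) x y k (mult_zero q y) =
     coeff (pcompose (cpoly q) [:y, 1:]) (mult_zero q y) * taylor2 u x y k 0"
proof -
  have "taylor2 (in_second q * u) x y k (mult_zero q y) =
     (\<Sum>i\<in>{mult_zero q y}. coeff (pcompose (cpoly q) [:y, 1:]) i * taylor2 u x y k (mult_zero q y - i))"
    unfolding taylor2_in_second_mult
    by (rule sum.mono_neutral_right) (auto intro: coeff_shift_below_order)
  then show ?thesis by simp
qed

lemma taylor2_0_0: "taylor2 u x y 0 0 = poly2 u x y"
  by (simp add: taylor2_def)

text \<open>
  Dividing \<open>r\<close> by \<open>q(w)\<close>, whose leading coefficient is a unit of \<open>\<complex>[z]\<close>, leaves a remainder \<open>t\<close> of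
  smaller degree in \<open>w\<close> that inherits the vanishing Taylor coefficients. For a zero \<open>\<xi>\<close> of \<open>p\<close> and
  \<open>k\<close> below its multiplicity, the \<open>k\<close>-th Taylor coefficient of \<open>t\<close> at \<open>\<xi>\<close> in the variable \<open>z\<close> is a
  polynomial in \<open>w\<close> that is divisible by \<open>q\<close> and has smaller degree, so it is \<open>0\<close>. Hence every
  coefficient of \<open>t\<close> with respect to \<open>w\<close> is divisible by \<open>p\<close>.
\<close>

lemma ideal_membership:
  assumes p: "p \<noteq> 0" and q: "q \<noteq> 0"
    and van: "\<And>x y k l. poly (cpoly p) x = 0 \<Longrightarrow> poly (cpoly q) y = 0 \<Longrightarrow>
        k < mult_zero p x \<Longrightarrow> l < mult_zero q y \<Longrightarrow> taylor2 r x y k l = 0"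
  shows "\<exists>u v. r = in_first p * u + in_second q * v"
proof -
  let ?Q = "in_second q"
  define c where "c = complex_of_real (lead_coeff q)"
  have c: "c \<noteq> 0" using q by (simp add: c_def)
  have degQ: "degree ?Q = degree q" unfolding in_second_def by (rule degree_map_poly) simp
  have lcQ: "coeff ?Q (degree q) = [:c:]" by (simp add: in_second_def coeff_map_poly c_def)
  have Q0: "?Q \<noteq> 0" using lcQ c by auto
  obtain v0 t0 where vt: "pseudo_divmod r ?Q = (v0, t0)" by (cases "pseudo_divmod r ?Q")
  define n where "n = Suc (degree r) - degree q"
  have e1: "smult ([:c:] ^ n) r = ?Q * v0 + t0" and deg0: "t0 = 0 \<or> degree t0 < degree q"
    using pseudo_divmod[OF Q0 vt] by (auto simp: n_def degQ lcQ)
  define d where "d = [:inverse c:] ^ n"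
  have "d * [:c:] ^ n = 1"
    unfolding d_def power_mult_distrib[symmetric] using c by (simp flip: one_pCons)
  then have "r = smult d (smult ([:c:] ^ n) r)" by simp
  then have rt: "r = ?Q * smult d v0 + smult d t0" unfolding e1 by (simp add: smult_add_right)
  define t where "t = smult d t0"
  have degt: "t = 0 \<or> degree t < degree q"
    using deg0 degree_smult_le[of d t0] unfolding t_def by (metis le_less_trans smult_0_right)
  have van_t: "taylor2 t x y k l = 0" if "poly (cpoly p) x = 0" "poly (cpoly q) y = 0"
      "k < mult_zero p x" "l < mult_zero q y" for x y k l
    using van[OF that] taylor2_in_second_mult_low[OF that(4)]
    unfolding rt taylor2_add by (simp add: t_def del: mult_smult_right)
  have "cpoly p dvd coeff t l" for l
  proof (rule poly_dvd_if_root_powers_dvd)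
    show "cpoly p \<noteq> 0" using p by simp
    fix x assume x: "poly (cpoly p) x = 0"
    have "coeff (pcompose (coeff t l) [:x, 1:]) k = 0" if k: "k < order x (cpoly p)" for k
    proof -
      define tk where "tk = map_poly (\<lambda>c. coeff (pcompose c [:x, 1:]) k) t"
      have "cpoly q dvd tk"
      proof (rule poly_dvd_if_root_powers_dvd)
        show "cpoly q \<noteq> 0" using q by simp
        fix y assume y: "poly (cpoly q) y = 0"
        show "[:-y, 1:] ^ order y (cpoly q) dvd tk"
          unfolding power_dvd_iff_shift tk_def coeff_shift2[symmetric] taylor2_eq_coeff[symmetric]
          using van_t[OF x y] k by (simp add: mult_zero_def)
      qed
      moreover have "degree (cpoly q) = degree q" by (rule degree_map_poly) simp
      moreover have "degree tk \<le> degree t" unfolding tk_def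
        by (rule degree_le) (simp add: coeff_map_poly coeff_eq_0)
      moreover have "t = 0 \<Longrightarrow> tk = 0" by (simp add: tk_def)
      ultimately have "tk = 0" using degt dvd_imp_degree_le[of "cpoly q" tk] by fastforce
      then have "coeff tk l = 0" by simp
      then show ?thesis by (simp add: tk_def coeff_map_poly)
    qed
    then show "[:-x, 1:] ^ order x (cpoly p) dvd coeff t l" by (simp add: power_dvd_iff_shift)
  qed
  then have "[:cpoly p:] dvd t" by (simp add: const_poly_dvd_iff)
  then obtain u where "t = in_first p * u" unfolding in_first_def by (elim dvdE)
  then have "r = in_first p * u + ?Q * smult d v0" using rt by (simp add: t_def)
  then show ?thesis by blast
qed

section \<open>Polynomials of commuting operators\<close>

lemma poly_op_alt:
  assumes "degree r \<le> n"
  shows "poly_op r A x = (\<Sum>i\<le>n. coeff r i *\<^sub>C (A ^^ i) x)"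
  unfolding poly_op_def using assms
  by (intro sum.mono_neutral_left) (auto simp: coeff_eq_0)

lemma poly_op_0 [simp]: "poly_op 0 A x = 0"
  by (simp add: poly_op_def)

lemma poly_op_pCons:
  "poly_op (pCons a r) A x = a *\<^sub>C x + poly_op r A (A x)"
proof -
  have "poly_op (pCons a r) A x = (\<Sum>i\<le>Suc (degree r). coeff (pCons a r) i *\<^sub>C (A ^^ i) x)"
    by (rule poly_op_alt) (simp add: degree_pCons_le)
  then show ?thesis
    by (simp add: sum.atMost_Suc_shift poly_op_def funpow_swap1 del: sum.atMost_Suc)
qed

lemma poly2_op_eq: "poly2_op s A B x = (\<Sum>l\<le>degree s. poly_op (coeff s l) A ((B ^^ l) x))"
  by (simp add: poly2_op_def poly_op_def)

lemma poly2_op_0 [simp]: "poly2_op 0 A B x = 0"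
  by (simp add: poly2_op_eq)

lemma poly2_op_pCons:
  "poly2_op (pCons c s) A B x = poly_op c A x + poly2_op s A B (B x)"
proof -
  have "poly2_op (pCons c s) A B x = (\<Sum>l\<le>Suc (degree s). poly_op (coeff (pCons c s) l) A ((B ^^ l) x))"
    unfolding poly2_op_eq
    by (intro sum.mono_neutral_left) (auto simp: coeff_eq_0 degree_pCons_le)
  then show ?thesis
    by (simp add: sum.atMost_Suc_shift poly2_op_eq funpow_swap1 del: sum.atMost_Suc)
qed

lemma poly_op_add: "poly_op (r + t) A x = poly_op r A x + poly_op t A x"
proof -
  let ?n = "max (degree r) (degree t)"
  have "poly_op (r + t) A x = (\<Sum>i\<le>?n. coeff (r + t) i *\<^sub>C (A ^^ i) x)"
    by (rule poly_op_alt) (rule degree_add_le_max)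
  then show ?thesis
    by (simp add: poly_op_alt[of r ?n] poly_op_alt[of t ?n] scaleC_add_left sum.distrib)
qed

lemma poly2_op_add: "poly2_op (s + t) A B x = poly2_op s A B x + poly2_op t A B x"
proof (induction s t arbitrary: x rule: poly_induct2)
  case (pCons a p b q)
  then show ?case by (simp add: poly2_op_pCons poly_op_add algebra_simps)
qed simp

lemma poly2_op_diff: "poly2_op (s - t) A B x = poly2_op s A B x - poly2_op t A B x"
  using poly2_op_add[of "s - t" t A B x] by simp

lemma bounded_clinear_poly_op:
  assumes A: "bounded_clinear A"
  shows "bounded_clinear (poly_op r A)"
proof (induction r rule: pCons_induct)
  case 0
  then show ?case by (simp add: poly_op_def bounded_clinear_zero)
next
  case (pCons a r)
  have "poly_op (pCons a r) A = (\<lambda>x. a *\<^sub>C x + poly_op r A (A x))"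
    by (rule ext) (rule poly_op_pCons)
  then show ?case by (simp add: bounded_clinear_intros pCons.IH A)
qed

lemma poly_op_intertwine:
  assumes "bounded_clinear C" "\<And>x. C (A x) = A' (C x)"
  shows "C (poly_op r A x) = poly_op r A' (C x)"
  by (induction r arbitrary: x rule: pCons_induct)
    (simp_all add: bounded_clinearD[OF assms(1)] poly_op_pCons assms(2))

text \<open>
  With \<open>C = T*\<close> this moves \<open>u(A,B)\<close> from the Krein space to the Hilbert space.
\<close>

lemma poly2_op_intertwine:
  assumes "bounded_clinear C" "\<And>x. C (A x) = A' (C x)" "\<And>x. C (B x) = B' (C x)"
  shows "C (poly2_op s A B x) = poly2_op s A' B' (C x)"
  by (induction s arbitrary: x rule: pCons_induct)
    (simp_all add: bounded_clinearD[OF assms(1)] poly2_op_pCons assms(3) poly_op_intertwine[where C=C and A=A and A'=A', OF assms(1,2)])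

lemma poly_op_smult: "poly_op (smult a t) A x = a *\<^sub>C poly_op t A x"
  by (induction t arbitrary: x rule: pCons_induct)
    (simp_all add: poly_op_pCons scaleC_add_right scaleC_scaleC)

lemma poly_op_mult:
  assumes "bounded_clinear A"
  shows "poly_op (r * t) A x = poly_op r A (poly_op t A x)"
  by (induction r arbitrary: x rule: pCons_induct)
    (simp_all add: poly_op_pCons poly_op_add poly_op_smult poly_op_intertwine[OF assms, where A=A and A'=A])

lemma poly2_op_in_first_mult:
  assumes A: "bounded_clinear A"
  shows "poly2_op (in_first p * u) A B x = poly_op (cpoly p) A (poly2_op u A B x)"
proof -
  have "poly2_op (smult P u) A B x = poly_op P A (poly2_op u A B x)" for P
    by (induction u arbitrary: x rule: pCons_induct)
      (simp_all add: poly2_op_pCons poly_op_mult[OF A] bounded_clinearD[OF bounded_clinear_poly_op[OF A]])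
  then show ?thesis by (simp add: in_first_def)
qed

lemma poly2_op_in_second_mult:
  assumes A: "bounded_clinear A" and B: "bounded_clinear B" and AB: "\<And>x. B (A x) = A (B x)"
  shows "poly2_op (in_second q * u) A B x = poly_op (cpoly q) B (poly2_op u A B x)"
proof -
  have sm: "poly2_op (smult [:a:] u) A B x = a *\<^sub>C poly2_op u A B x" for a u x
    by (induction u arbitrary: x rule: pCons_induct)
      (simp_all add: poly2_op_pCons poly_op_smult scaleC_add_right)
  have "poly2_op (map_poly (\<lambda>c. [:c:]) Q * u) A B x = poly_op Q B (poly2_op u A B x)" for Q
    by (induction Q arbitrary: x rule: pCons_induct)
      (simp_all add: map_poly_pCons poly2_op_add sm poly2_op_pCons poly_op_pCons
        poly2_op_intertwine[OF B, where A=A and A'=A and B=B and B'=B] AB)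
  then show ?thesis by (simp add: in_second_eq)
qed

section \<open>Lifting operators along \<open>T\<close>\<close>

text \<open>
  If \<open>b = a\<^sub>1 / a\<^sub>0\<close> exceeded \<open>\<rho>\<close>, then \<open>a\<close> at \<open>2^n\<close> would be at least \<open>a\<^sub>0 b^(2^n)\<close>, which grows faster
  than \<open>C \<rho>^(2^n)\<close>. This is the usual iteration of the Cauchy-Schwarz inequality for symmetrizable operators.
\<close>

lemma doubling_sequence_bound:
  fixes a :: "nat \<Rightarrow> real"
  assumes nonneg: "\<And>k. 0 \<le> a k" and dbl: "\<And>k. (a k)\<^sup>2 \<le> a 0 * a (2 * k)"
    and bd: "\<And>k. a k \<le> C * \<rho> ^ k" and \<rho>: "\<rho> > 0"
  shows "a 1 \<le> \<rho> * a 0"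
proof (rule ccontr)
  assume "\<not> a 1 \<le> \<rho> * a 0"
  then have gt: "a 1 > \<rho> * a 0" by simp
  then have a1: "a 1 > 0" using nonneg[of 0] \<rho> by (smt (verit) mult_nonneg_nonneg)
  have a0: "a 0 > 0"
  proof -
    have "a 0 \<noteq> 0"
    proof
      assume "a 0 = 0"
      then have "(a 1)\<^sup>2 \<le> 0" using dbl[of 1] by simp
      then show False using a1 by simp
    qed
    then show ?thesis using nonneg[of 0] by simp
  qed
  define b where "b = a 1 / a 0"
  have b: "b > \<rho>" using gt a0 by (simp add: b_def field_simps)
  have low: "a 0 * b ^ (2 ^ n) \<le> a (2 ^ n)" for n
  proof (induction n)
    case 0
    then show ?case using a0 by (simp add: b_def)
  next
    case (Suc n)
    have "a 0 * (a 0 * b ^ (2 ^ Suc n)) = (a 0 * b ^ (2 ^ n))\<^sup>2"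
      by (simp add: power_even_eq power_mult_distrib power2_eq_square)
    also have "\<dots> \<le> (a (2 ^ n))\<^sup>2"
      using Suc a0 b \<rho> by (intro power_mono) auto
    also have "\<dots> \<le> a 0 * a (2 ^ Suc n)" using dbl[of "2 ^ n"] by simp
    finally show ?case using a0 by simp
  qed
  define t where "t = b / \<rho>"
  have t: "t > 1" using b \<rho> by (simp add: t_def)
  have "t ^ n \<le> C / a 0" for n
  proof -
    have "a 0 * b ^ (2 ^ n) \<le> C * \<rho> ^ (2 ^ n)" using low bd order_trans by blast
    then have "t ^ (2 ^ n) \<le> C / a 0" using a0 \<rho> by (simp add: t_def power_divide field_simps)
    moreover have "t ^ n \<le> t ^ (2 ^ n)" using t by (intro power_increasing) (auto intro: less_imp_le)
    ultimately show ?thesis by linarith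
  qed
  then show False using real_arch_pow[OF t, of "C / a 0"] by (meson not_le)
qed

lemma cinner_norm: "Re (cinner x x) = (norm x)\<^sup>2" for x :: "'v::complex_hilbert"
  by (simp add: cinner_self)

lemma cinner_Cauchy_Schwarz: "cmod (cinner x y) \<le> norm x * norm y" for x y :: "'v::complex_hilbert"
  using inner_product_bounded[OF equivalent_inner_product_cinner, of x y] by simp

context
  fixes f :: "'k::complex_banach \<Rightarrow> 'k \<Rightarrow> complex" and T :: "'v::complex_hilbert \<Rightarrow> 'k" and Ts
  assumes f: "riesz_form f" and T: "bounded_clinear T" and Ts: "bounded_clinear Ts"
    and adj: "\<And>x y. f (T x) y = cinner x (Ts y)"
begin

lemma adj': "f x (T y) = cinner (Ts x) y"
  by (subst hermitian_form_commute[OF riesz_form_hermitian[OF f]], subst cinner_commute) (simp add: adj)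

text \<open>
  The Cauchy-Schwarz inequality, after \<open>P\<close> has been moved past \<open>T Ts\<close> and then to the other side of \<open>f\<close>.
\<close>

lemma symmetrized_norm_le:
  assumes "\<And>x y. f (P x) y = f x (P' y)" "\<And>x. P (T (Ts x)) = T (Ts (P x))"
  shows "(norm (Ts (P x)))\<^sup>2 \<le> norm (Ts x) * norm (Ts (P' (P x)))"
proof -
  have "cinner (Ts (P x)) (Ts (P x)) = f (T (Ts (P x))) (P x)" by (simp add: adj)
  also have "\<dots> = f (P (T (Ts x))) (P x)" by (simp add: assms)
  also have "\<dots> = cinner (Ts x) (Ts (P' (P x)))" by (simp add: assms(1) adj)
  finally have "(norm (Ts (P x)))\<^sup>2 = Re (cinner (Ts x) (Ts (P' (P x))))" by (simp flip: cinner_norm)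
  also have "\<dots> \<le> norm (Ts x) * norm (Ts (P' (P x)))"
    using complex_Re_le_cmod cinner_Cauchy_Schwarz order_trans by blast
  finally show ?thesis .
qed

text \<open>
  In the semi-inner product \<open>f (T (Ts x)) y\<close> the operator \<open>M = N' N\<close> is symmetric, and bounded in the
  original norm; repeated use of \<open>symmetrized_norm_le\<close> for the powers of \<open>M\<close> shows that it is bounded
  in the semi-norm \<open>norm (Ts x)\<close> with the same constant \<open>\<rho>\<close>. One more use, for \<open>N\<close> itself, gives
  the constant \<open>sqrt \<rho>\<close> for \<open>N\<close>.
\<close>

lemma symmetrized_bounded:
  assumes N: "bounded_clinear N" "bounded_clinear N'"
    and adjN: "\<And>x y. f (N x) y = f x (N' y)"
    and comm: "\<And>x. N (T (Ts x)) = T (Ts (N x))" "\<And>x. N' (T (Ts x)) = T (Ts (N' x))"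
  obtains c where "c \<ge> 0" "\<And>x. norm (Ts (N x)) \<le> c * norm (Ts x)"
proof -
  have adjN': "f (N' x) y = f x (N y)" for x y
    by (subst (1 2) hermitian_form_commute[OF riesz_form_hermitian[OF f]]) (simp add: adjN)
  define M where "M x = N' (N x)" for x
  have M: "bounded_clinear M" unfolding M_def by (rule bounded_clinear_compose[OF N(2,1)])
  have Mk: "f ((M ^^ k) x) y = f x ((M ^^ k) y)" for k x y
  proof (induction k arbitrary: x y)
    case (Suc k)
    have "f (M x) y = f x (M y)" for x y by (simp add: M_def adjN adjN')
    then show ?case using Suc by (simp add: funpow_swap1[of M k y])
  qed simp
  have Mc: "(M ^^ k) (T (Ts x)) = T (Ts ((M ^^ k) x))" for k x
    by (induction k arbitrary: x) (simp_all add: M_def comm)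
  obtain \<rho> where \<rho>: "\<rho> > 0" "\<And>x. norm (M x) \<le> \<rho> * norm x" using bounded_clinear_bound[OF M] by blast
  obtain K where K: "K > 0" "\<And>x. norm (Ts x) \<le> K * norm x" using bounded_clinear_bound[OF Ts] by blast
  have "norm (Ts (M x)) \<le> \<rho> * norm (Ts x)" for x
  proof -
    have pw: "norm ((M ^^ k) x) \<le> \<rho> ^ k * norm x" for k
    proof (induction k)
      case (Suc k)
      have "norm (M ((M ^^ k) x)) \<le> \<rho> * (\<rho> ^ k * norm x)"
        using \<rho>(2)[of "(M ^^ k) x"] mult_left_mono[OF Suc, of \<rho>] \<rho>(1) by linarith
      then show ?case by (simp add: mult_ac)
    qed simp
    define a where "a k = norm (Ts ((M ^^ k) x))" for k
    have "a 1 \<le> \<rho> * a 0"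
    proof (rule doubling_sequence_bound[where C="K * norm x"])
      show "(a k)\<^sup>2 \<le> a 0 * a (2 * k)" for k
        using symmetrized_norm_le[of "M ^^ k" "M ^^ k", OF Mk Mc, of x]
        by (simp add: a_def mult_2 funpow_add)
      show "a k \<le> K * norm x * \<rho> ^ k" for k
        unfolding a_def using order_trans[OF K(2) mult_left_mono[OF pw[of k], of K]] K(1)
        by (simp add: mult_ac)
    qed (use \<rho> in \<open>auto simp: a_def\<close>)
    then show ?thesis by (simp add: a_def)
  qed
  then have le: "(norm (Ts (N x)))\<^sup>2 \<le> (sqrt \<rho> * norm (Ts x))\<^sup>2" for x
  proof -
    have "(norm (Ts (N x)))\<^sup>2 \<le> norm (Ts x) * norm (Ts (M x))"
      using symmetrized_norm_le[of N N', OF adjN comm(1)] by (simp add: M_def)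
    also have "\<dots> \<le> norm (Ts x) * (\<rho> * norm (Ts x))"
      by (intro mult_left_mono) (auto intro: \<open>\<And>x. norm (Ts (M x)) \<le> \<rho> * norm (Ts x)\<close>)
    also have "\<dots> = (sqrt \<rho> * norm (Ts x))\<^sup>2"
      using \<rho>(1) by (simp add: power_mult_distrib) (simp add: power2_eq_square)
    finally show ?thesis .
  qed
  then have "norm (Ts (N x)) \<le> sqrt \<rho> * norm (Ts x)" for x
    using \<rho>(1) by (auto intro: power2_le_imp_le[OF le])
  then show ?thesis using that[of "sqrt \<rho>"] \<rho>(1) by simp
qed

text \<open>
  The required \<open>D\<close> satisfies \<open>\<langle>Ts x, D v\<rangle> = \<langle>Ts (N' x), v\<rangle>\<close>. The right-hand side is a bounded
  functional of \<open>Ts x\<close> by \<open>symmetrized_bounded\<close>, so \<open>D v\<close> comes from the Riesz theorem on the range of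
  \<open>Ts\<close>. It is unique because injectivity of \<open>T\<close> makes this range dense.
\<close>

lemma Theta_exists:
  assumes inj: "inj T" and N: "bounded_clinear N" "bounded_clinear N'"
    and adjN: "\<And>x y. f (N x) y = f x (N' y)"
    and comm: "\<And>x. N (T (Ts x)) = T (Ts (N x))" "\<And>x. N' (T (Ts x)) = T (Ts (N' x))"
  shows "\<exists>D. bounded_clinear D \<and> T \<circ> D = N \<circ> T"
proof -
  note bT = bounded_clinearD[OF T] and bTs = bounded_clinearD[OF Ts] and bN' = bounded_clinearD[OF N(2)]
  have adjN': "f (N' x) y = f x (N y)" for x y
    by (subst (1 2) hermitian_form_commute[OF riesz_form_hermitian[OF f]]) (simp add: adjN)
  obtain c where c: "c \<ge> 0" "\<And>x. norm (Ts (N' x)) \<le> c * norm (Ts x)"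
    using symmetrized_bounded[OF N(2,1) adjN' comm(2,1)] by blast
  define L where "L = range Ts"
  define r where "r z = (SOME x. Ts x = z)" for z
  have r: "Ts (r z) = z" if "z \<in> L" for z
    using that someI_ex[of "\<lambda>x. Ts x = z"] by (auto simp: L_def r_def)
  define h where "h z = Ts (N' (r z))" for z
  have h: "h (Ts x) = Ts (N' x)" for x
  proof -
    have "norm (Ts (N' (r (Ts x) - x))) \<le> c * norm (Ts (r (Ts x) - x))" by (rule c)
    also have "\<dots> = 0" by (simp add: bTs r L_def)
    finally show ?thesis by (simp add: h_def bTs bN')
  qed
  have nondeg: "y = y'" if "\<And>x. cinner (Ts x) y = cinner (Ts x) y'" for y y'
  proof -
    have "T y = T y'" using that by (intro riesz_form_nondegenerate[OF f]) (simp add: adj')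
    then show ?thesis using inj by (simp add: inj_eq)
  qed
  have "\<exists>y. norm y \<le> (c * norm v) / 1 \<and> (\<forall>z\<in>L. cinner (h z) v = cinner z y)" for v
  proof (rule riesz_on_subspace[OF equivalent_inner_product_cinner])
    show "0 \<in> L" unfolding L_def using bTs(4) by (metis rangeI)
    show "x + y \<in> L" if "x \<in> L" "y \<in> L" for x y
      using that by (auto simp: L_def simp flip: bTs)
    show "d *\<^sub>C x \<in> L" if "x \<in> L" for d x
      using that by (auto simp: L_def simp flip: bTs)
    show "cinner (h (x + y)) v = cinner (h x) v + cinner (h y) v" if "x \<in> L" "y \<in> L" for x y
      using that by (auto simp: L_def h bTs(1)[symmetric]) (simp add: bTs bN' cinner_simps)
    show "cinner (h (d *\<^sub>C x)) v = d * cinner (h x) v" if "x \<in> L" for x d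
      using that by (auto simp: L_def h bTs(5)[symmetric]) (simp add: bTs bN' cinner_simps)
    show "cmod (cinner (h x) v) \<le> c * norm v * norm x" if x: "x \<in> L" for x
    proof -
      have "norm (h x) \<le> c * norm x" using c(2)[of "r x"] by (simp add: h_def r[OF x])
      then have "norm (h x) * norm v \<le> c * norm x * norm v" by (rule mult_right_mono) simp
      then show ?thesis using cinner_Cauchy_Schwarz[of "h x" v] by (simp add: mult_ac)
    qed
  qed (use c in auto)
  then obtain D where D: "\<And>v. norm (D v) \<le> c * norm v" "\<And>v z. z \<in> L \<Longrightarrow> cinner (h z) v = cinner z (D v)"
    by (metis div_by_1)
  have D': "cinner (Ts x) (D v) = cinner (Ts (N' x)) v" for x v
    using D(2)[of "Ts x" v] by (simp add: L_def h)
  have "bounded_clinear D"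
    by (rule bounded_clinearI[where K=c]) (auto intro!: nondeg D(1) simp: D' cinner_simps)
  moreover have "T (D v) = N (T v)" for v
    by (rule riesz_form_nondegenerate[OF f]) (simp add: adj' D' flip: adjN')
  ultimately show ?thesis by (intro exI[of _ D]) (auto simp: fun_eq_iff)
qed

end

lemma Theta_works:
  assumes "\<exists>D. bounded_clinear D \<and> T \<circ> D = N \<circ> T" "inj T"
  shows "bounded_clinear (Theta T N)" "T (Theta T N x) = N (T x)"
proof -
  from assms(1) obtain D where D: "bounded_clinear D" "T \<circ> D = N \<circ> T" by blast
  have "Theta T N = D" unfolding Theta_def
  proof (rule the_equality)
    fix D' assume "bounded_clinear D' \<and> T \<circ> D' = N \<circ> T"
    then have "T (D' x) = T (D x)" for x using D(2) by (metis comp_apply)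
    then show "D' = D" using assms(2) by (auto simp: inj_eq)
  qed (use D in auto)
  then show "bounded_clinear (Theta T N)" "T (Theta T N x) = N (T x)"
    using D(1) fun_cong[OF D(2), of x] by simp_all
qed

section \<open>The bounded Borel functional calculus of a spectral measure\<close>

text \<open>
  Operators on a complex Hilbert space are determined by their quadratic forms. This matches
  \<^const>\<open>spectral_integral\<close>, which specifies an operator by \<open>\<langle>D x, x\<rangle>\<close> only.
\<close>

lemma polarization:
  assumes "bounded_clinear D"
  shows "4 * cinner (D x) y = cinner (D (x + y)) (x + y) - cinner (D (x - y)) (x - y)
     + \<i> * cinner (D (x + \<i> *\<^sub>C y)) (x + \<i> *\<^sub>C y) - \<i> * cinner (D (x - \<i> *\<^sub>C y)) (x - \<i> *\<^sub>C y)"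
  by (simp add: bounded_clinearD[OF assms] cinner_simps algebra_simps)

text \<open>
  By homogeneity unit vectors suffice; for these the four arguments in \<open>polarization\<close> have norm at
  most \<open>2\<close>.
\<close>

lemma numerical_bound:
  fixes D :: "'v::complex_hilbert \<Rightarrow> 'v"
  assumes D: "bounded_clinear D" and b: "\<And>x. cmod (cinner (D x) x) \<le> b * (norm x)\<^sup>2" "b \<ge> 0"
  shows "cmod (cinner (D x) y) \<le> 4 * b * norm x * norm y"
proof -
  have unit: "cmod (cinner (D x) y) \<le> 4 * b" if "norm x = 1" "norm y = 1" for x y
  proof -
    have q: "cmod (cinner (D z) z) \<le> 4 * b" if "norm z \<le> 2" for z
    proof -
      have "(norm z)\<^sup>2 \<le> 2\<^sup>2" using that by (intro power_mono) auto
      then have "b * (norm z)\<^sup>2 \<le> b * 4" using b(2) by (intro mult_left_mono) auto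
      then show ?thesis using b(1)[of z] by simp
    qed
    have "norm (x + y) \<le> 2" "norm (x - y) \<le> 2" "norm (x + \<i> *\<^sub>C y) \<le> 2" "norm (x - \<i> *\<^sub>C y) \<le> 2"
      using that norm_triangle_ineq[of x y] norm_triangle_ineq4[of x y]
        norm_triangle_ineq[of x "\<i> *\<^sub>C y"] norm_triangle_ineq4[of x "\<i> *\<^sub>C y"]
      by (simp_all add: norm_scaleC)
    note qs = this[THEN q]
    have "cmod (4 * cinner (D x) y) \<le> 4 * b + 4 * b + 4 * b + 4 * b"
      unfolding polarization[OF D, of x y]
      using qs by (intro norm_triangle_mono norm_triangle_le_diff add_mono)
        (auto simp: norm_mult intro!: norm_triangle_mono order_trans[OF norm_triangle_ineq4] add_mono)
    then show ?thesis by (simp add: norm_mult)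
  qed
  show ?thesis
  proof (cases "x = 0 \<or> y = 0")
    case True
    then show ?thesis by (auto simp: cinner_simps bounded_clinearD[OF D])
  next
    case False
    define u where "u = complex_of_real (1 / norm x) *\<^sub>C x"
    define w where "w = complex_of_real (1 / norm y) *\<^sub>C y"
    have "norm u = 1" "norm w = 1" using False by (simp_all add: u_def w_def norm_scaleC norm_divide)
    then have "cmod (cinner (D u) w) \<le> 4 * b" by (rule unit)
    then show ?thesis using False
      by (simp add: u_def w_def bounded_clinearD[OF D] cinner_simps norm_mult norm_divide field_simps)
  qed
qed

lemma operator_eqI_quadratic_form:
  fixes D D' :: "'v::complex_hilbert \<Rightarrow> 'v"
  assumes "bounded_clinear D" "bounded_clinear D'" "\<And>x. cinner (D x) x = cinner (D' x) x"
  shows "D = D'"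
proof -
  have bc: "bounded_clinear (\<lambda>x. D x - D' x)" using assms by (intro bounded_clinear_diff)
  have "cinner (D x - D' x) (D x - D' x) = 0" for x
    using numerical_bound[OF bc, of 0 x "D x - D' x"] assms(3) by (simp add: cinner_simps)
  then show ?thesis by (auto simp: cinner_self)
qed

lemma weak_limit_tendsto:
  fixes D :: "nat \<Rightarrow> 'v::complex_hilbert \<Rightarrow> 'v"
  assumes "\<And>n. bounded_clinear (D n)" "bounded_clinear D'"
    and "\<And>x. (\<lambda>n. cinner (D n x) x) \<longlonglongrightarrow> cinner (D' x) x"
  shows "(\<lambda>n. cinner (D n x) y) \<longlonglongrightarrow> cinner (D' x) y"
proof -
  have "(\<lambda>n. 4 * cinner (D n x) y) \<longlonglongrightarrow> 4 * cinner (D' x) y"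
    unfolding polarization[OF assms(1)] polarization[OF assms(2)]
    by (intro tendsto_intros assms(3))
  then show ?thesis by (subst (asm) tendsto_mult_left_iff) auto
qed

text \<open>
  By \<open>polarization\<close> the sesquilinear forms \<open>\<langle>D n x, y\<rangle>\<close> converge. The limit is again sesquilinear and
  bounded, so the Riesz theorem yields the operator.
\<close>

lemma weak_limit_exists:
  fixes D :: "nat \<Rightarrow> 'v::complex_hilbert \<Rightarrow> 'v"
  assumes D: "\<And>n. bounded_clinear (D n)"
    and b: "\<And>n x. cmod (cinner (D n x) x) \<le> b * (norm x)\<^sup>2" "b \<ge> 0"
    and lim: "\<And>x. (\<lambda>n. cinner (D n x) x) \<longlonglongrightarrow> i x"
  shows "\<exists>D'. bounded_clinear D' \<and> (\<forall>x. cinner (D' x) x = i x)"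
proof -
  have "\<exists>l. (\<lambda>n. cinner (D n x) y) \<longlonglongrightarrow> l" for x y
  proof -
    let ?l = "i (x + y) - i (x - y) + \<i> * i (x + \<i> *\<^sub>C y) - \<i> * i (x - \<i> *\<^sub>C y)"
    have "(\<lambda>n. 4 * cinner (D n x) y) \<longlonglongrightarrow> ?l"
      unfolding polarization[OF D] by (intro tendsto_intros lim)
    from tendsto_divide[OF this tendsto_const, of 4] show ?thesis by auto
  qed
  then obtain L where L: "\<And>x y. (\<lambda>n. cinner (D n x) y) \<longlonglongrightarrow> L x y" by metis
  have Lbd: "cmod (L x y) \<le> 4 * b * norm x * norm y" for x y
    using numerical_bound[OF D b] by (intro LIMSEQ_le_const2[OF tendsto_norm[OF L]]) auto
  have Ll: "L (x + x') y = L x y + L x' y" "L (c *\<^sub>C x) y = c * L x y"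
    "L x (y + y') = L x y + L x y'" "L x (c *\<^sub>C y) = cnj c * L x y" for x x' y y' c
  proof -
    show "L (x + x') y = L x y + L x' y"
      using LIMSEQ_unique[OF L[of "x + x'" y]] tendsto_add[OF L[of x y] L[of x' y]]
      by (simp add: bounded_clinearD[OF D] cinner_simps)
    show "L (c *\<^sub>C x) y = c * L x y"
      using LIMSEQ_unique[OF L[of "c *\<^sub>C x" y]] tendsto_mult[OF tendsto_const L[of x y]]
      by (simp add: bounded_clinearD[OF D] cinner_simps)
    show "L x (y + y') = L x y + L x y'"
      using LIMSEQ_unique[OF L[of x "y + y'"]] tendsto_add[OF L[of x y] L[of x y']]
      by (simp add: bounded_clinearD[OF D] cinner_simps)
    show "L x (c *\<^sub>C y) = cnj c * L x y"
      using LIMSEQ_unique[OF L[of x "c *\<^sub>C y"]] tendsto_mult[OF tendsto_const L[of x y]]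
      by (simp add: bounded_clinearD[OF D] cinner_simps)
  qed
  have "\<exists>d. norm d \<le> (4 * b * norm x) / 1 \<and> (\<forall>y\<in>UNIV. cnj (L x y) = cinner y d)" for x
    using Lbd[of x] b(2) by (intro riesz_on_subspace[OF equivalent_inner_product_cinner]) (auto simp: Ll)
  then obtain D' where D': "\<And>x. norm (D' x) \<le> 4 * b * norm x" "\<And>x y. cnj (L x y) = cinner y (D' x)"
    by (metis UNIV_I div_by_1)
  have L': "L x y = cinner (D' x) y" for x y
    by (subst cinner_commute) (simp flip: D'(2))
  have "bounded_clinear D'"
  proof (rule bounded_clinearI[where K="4 * b"])
    show "D' (x + y) = D' x + D' y" for x y
      by (rule riesz_form_nondegenerate[OF riesz_form_cinner])
        (simp only: cinner_simps D'(2)[symmetric] Ll complex_cnj_add)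
    show "D' (c *\<^sub>C x) = c *\<^sub>C D' x" for c x
      by (rule riesz_form_nondegenerate[OF riesz_form_cinner])
        (simp only: cinner_simps D'(2)[symmetric] Ll complex_cnj_mult)
  qed (rule D'(1))
  moreover have "cinner (D' x) x = i x" for x
    using LIMSEQ_unique[OF L[of x x] lim[of x]] by (simp add: L')
  ultimately show ?thesis by blast
qed

locale spectral_measure =
  fixes S :: "complex set" and E :: "complex set \<Rightarrow> 'v \<Rightarrow> 'v::complex_hilbert"
  assumes pvm: "proj_valued_measure S E"
begin

abbreviation \<B> :: "complex measure" where "\<B> \<equiv> restrict_space borel S"

abbreviation \<mu> :: "'v \<Rightarrow> complex measure" where "\<mu> \<equiv> scalar_spectral_measure S E"

lemma space_\<B>: "space \<B> = S"
  by (simp add: space_restrict_space)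

lemma singleton_sets: "w \<in> S \<Longrightarrow> {w} \<in> sets \<B>"
  by (subst sets_restrict_space) (auto intro!: image_eqI[of _ _ "{w}"])

lemma compl_closed_sets:
  assumes "closed Z" shows "S - Z \<in> sets \<B>"
proof -
  have "S \<inter> (- Z) \<in> sets \<B>" using assms by (subst sets_restrict_space) (auto intro!: image_eqI[of _ _ "-Z"])
  then show ?thesis by (simp add: Diff_eq)
qed

lemma S_sets: "S \<in> sets \<B>"
  using sets.top[of \<B>] by (simp add: space_\<B>)

lemma E_clinear: "X \<in> sets \<B> \<Longrightarrow> bounded_clinear (E X)"
  and E_idem: "X \<in> sets \<B> \<Longrightarrow> E X (E X x) = E X x"
  and E_Int: "X \<in> sets \<B> \<Longrightarrow> Y \<in> sets \<B> \<Longrightarrow> E (X \<inter> Y) x = E X (E Y x)"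
  and E_space: "E S x = x"
  and E_sums: "range F \<subseteq> sets \<B> \<Longrightarrow> disjoint_family F \<Longrightarrow> (\<lambda>i::nat. E (F i) x) sums E (\<Union>i. F i) x"
  using pvm by (simp_all add: proj_valued_measure_def fun_eq_iff)

lemma E_selfadjoint:
  assumes "X \<in> sets \<B>" shows "cinner (E X x) y = cinner x (E X y)"
  using adjoint_works[OF riesz_form_cinner riesz_form_cinner E_clinear[OF assms], of x y] assms pvm
  by (simp add: proj_valued_measure_def)

lemma cinner_E: "X \<in> sets \<B> \<Longrightarrow> cinner (E X x) x = complex_of_real ((norm (E X x))\<^sup>2)"
  by (metis E_idem E_selfadjoint cinner_self)

lemma sets_\<mu>: "sets (\<mu> x) = sets \<B>" and space_\<mu>: "space (\<mu> x) = S"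
  using sets.sigma_sets_eq[of \<B>] sets.space_closed[of \<B>]
  by (simp_all add: scalar_spectral_measure_def sets_measure_of space_measure_of space_\<B>)

lemma emeasure_\<mu>:
  assumes X: "X \<in> sets \<B>"
  shows "emeasure (\<mu> x) X = ennreal ((norm (E X x))\<^sup>2)"
proof -
  let ?m = "\<lambda>X. ennreal (Re (cinner (E X x) x))"
  have "emeasure (measure_of S (sets \<B>) ?m) X = ?m X"
  proof (rule emeasure_measure_of_sigma[OF _ _ _ X])
    show "sigma_algebra S (sets \<B>)" using sets.sigma_algebra_axioms[of \<B>] by (simp add: space_\<B>)
    show "positive (sets \<B>) ?m"
      using pvm by (simp add: positive_def proj_valued_measure_def cinner_simps)
    show "countably_additive (sets \<B>) ?m"
      unfolding countably_additive_def
    proof (intro allI impI)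
      fix F :: "nat \<Rightarrow> complex set"
      assume F: "range F \<subseteq> sets \<B>" "disjoint_family F" "(\<Union>i. F i) \<in> sets \<B>"
      have bl: "bounded_linear (\<lambda>y. Re (cinner y x))"
      proof (rule bounded_linear_intro[where K="norm x"])
        show "Re (cinner (r *\<^sub>R y) x) = r *\<^sub>R Re (cinner y x)" for r y
          using cinner_simps(3)[of "complex_of_real r" y x] by (simp add: scaleC_of_real)
        show "norm (Re (cinner y x)) \<le> norm y * norm x" for y
          using abs_Re_le_cmod[of "cinner y x"] cinner_Cauchy_Schwarz[of y x] by simp
      qed (simp add: cinner_simps)
      have "(\<lambda>i. Re (cinner (E (F i) x) x)) sums Re (cinner (E (\<Union>i. F i) x) x)"
        by (rule bounded_linear.sums[OF bl E_sums[OF F(1,2)]])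
      moreover have "0 \<le> Re (cinner (E (F i) x) x)" for i
        using F(1) by (subst cinner_E) auto
      ultimately show "(\<Sum>i. ?m (F i)) = ?m (\<Union>i. F i)" by (intro suminf_ennreal_eq)
    qed
  qed
  then show ?thesis using cinner_E[OF X] by (simp add: scalar_spectral_measure_def)
qed

lemma finite_\<mu>: "finite_measure (\<mu> x)"
proof
  show "emeasure (\<mu> x) (space (\<mu> x)) \<noteq> \<infinity>" by (simp add: space_\<mu> emeasure_\<mu> S_sets)
qed

lemma measure_\<mu>: "X \<in> sets \<B> \<Longrightarrow> measure (\<mu> x) X = (norm (E X x))\<^sup>2"
  by (simp add: measure_def emeasure_\<mu>)

text \<open>
  The bounded Borel functions on \<open>S\<close>; values outside \<open>S\<close> are arbitrary.
\<close>

definition bounded_borel :: "(complex \<Rightarrow> complex) \<Rightarrow> bool" where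
  "bounded_borel h \<longleftrightarrow> h \<in> borel_measurable \<B> \<and> (\<exists>b. \<forall>z\<in>S. cmod (h z) \<le> b)"

lemma bounded_borel_measurable: "bounded_borel h \<Longrightarrow> h \<in> borel_measurable (\<mu> x)"
  by (simp add: bounded_borel_def sets_\<mu> cong: measurable_cong_sets)

lemma bounded_borel_bound:
  assumes "bounded_borel h" obtains b where "b \<ge> 0" "\<And>z. z \<in> S \<Longrightarrow> cmod (h z) \<le> b"
proof -
  obtain b where "\<forall>z\<in>S. cmod (h z) \<le> b" using assms by (auto simp: bounded_borel_def)
  then show ?thesis using that[of "max b 0"] by (simp add: le_max_iff_disj)
qed

lemma bounded_borel_integrable:
  assumes "bounded_borel h" shows "integrable (\<mu> x) h"
proof -
  obtain b where "\<And>z. z \<in> S \<Longrightarrow> cmod (h z) \<le> b" using bounded_borel_bound[OF assms] by blast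
  then have "AE z in \<mu> x. norm (h z) \<le> b" by (auto simp: space_\<mu>)
  then show ?thesis
    using bounded_borel_measurable[OF assms] by (rule finite_measure.integrable_const_bound[OF finite_\<mu>])
qed

lemma bounded_borel_intros:
  "bounded_borel (\<lambda>z. c)" "bounded_borel h \<Longrightarrow> bounded_borel k \<Longrightarrow> bounded_borel (\<lambda>z. h z + k z)" "bounded_borel h \<Longrightarrow> bounded_borel k \<Longrightarrow> bounded_borel (\<lambda>z. h z * k z)"
  "bounded_borel h \<Longrightarrow> bounded_borel k \<Longrightarrow> bounded_borel (\<lambda>z. h z - k z)" "bounded_borel h \<Longrightarrow> bounded_borel (\<lambda>z. cnj (h z))"
  "X \<in> sets \<B> \<Longrightarrow> bounded_borel (indicator X)"
proof -
  show "bounded_borel (\<lambda>z. c)" by (auto simp: bounded_borel_def)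
  show "bounded_borel (indicator X)" if "X \<in> sets \<B>"
    using that by (auto simp: bounded_borel_def indicator_def intro!: exI[of _ 1])
  show "bounded_borel (\<lambda>z. cnj (h z))" if "bounded_borel h" for h
  proof -
    have "(\<lambda>z. cnj (h z)) \<in> borel_measurable \<B>"
      using that by (intro measurable_compose[of h \<B> borel cnj borel] borel_measurable_continuous_onI continuous_intros)
        (simp_all add: bounded_borel_def)
    then show ?thesis using that by (auto simp: bounded_borel_def)
  qed
  assume h: "bounded_borel h" "bounded_borel k"
  then have m: "h \<in> borel_measurable \<B>" "k \<in> borel_measurable \<B>" by (auto simp: bounded_borel_def)
  obtain b b' where b: "b \<ge> 0" "\<And>z. z \<in> S \<Longrightarrow> cmod (h z) \<le> b" "b' \<ge> 0" "\<And>z. z \<in> S \<Longrightarrow> cmod (k z) \<le> b'"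
    using h by (metis bounded_borel_bound)
  have "\<forall>z\<in>S. cmod (h z + k z) \<le> b + b'" using b by (auto intro: norm_triangle_mono)
  then show "bounded_borel (\<lambda>z. h z + k z)" using m unfolding bounded_borel_def by (blast intro: borel_measurable_add)
  have "\<forall>z\<in>S. cmod (h z - k z) \<le> b + b'" using b by (auto intro: order_trans[OF norm_triangle_ineq4] add_mono)
  then show "bounded_borel (\<lambda>z. h z - k z)" using m unfolding bounded_borel_def by (blast intro: borel_measurable_diff)
  have "\<forall>z\<in>S. cmod (h z * k z) \<le> b * b'" using b by (auto simp: norm_mult intro: mult_mono)
  then show "bounded_borel (\<lambda>z. h z * k z)" using m unfolding bounded_borel_def by (blast intro: borel_measurable_times)
qed

text \<open>
  Simple functions are linear combinations of indicators, and a bounded Borel function is a pointwise limit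
  of simple functions with a common bound. The limit rule with a constant sequence also covers the
  passage between functions that agree on \<open>S\<close>.
\<close>

lemma bounded_borel_induct [consumes 1, case_names indicator add scale limit]:
  assumes h: "bounded_borel h"
    and ind: "\<And>X. X \<in> sets \<B> \<Longrightarrow> P (indicator X)"
    and add: "\<And>h k. bounded_borel h \<Longrightarrow> bounded_borel k \<Longrightarrow> P h \<Longrightarrow> P k \<Longrightarrow> P (\<lambda>z. h z + k z)"
    and scale: "\<And>c h. bounded_borel h \<Longrightarrow> P h \<Longrightarrow> P (\<lambda>z. c * h z)"
    and lim: "\<And>h k b. (\<And>n. bounded_borel (h n)) \<Longrightarrow> (\<And>n. P (h n)) \<Longrightarrow> b \<ge> 0 \<Longrightarrow>
        (\<And>n z. z \<in> S \<Longrightarrow> cmod (h n z) \<le> b) \<Longrightarrow> (\<And>z. z \<in> S \<Longrightarrow> (\<lambda>n. h n z) \<longlonglongrightarrow> k z) \<Longrightarrow> bounded_borel k \<Longrightarrow> P k"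
  shows "P h"
proof -
  have sum: "P (\<lambda>z. \<Sum>c\<in>A. c * indicator (X c) z) \<and> bounded_borel (\<lambda>z. \<Sum>c\<in>A. c * indicator (X c) z)"
    if "finite A" "\<And>c. c \<in> A \<Longrightarrow> X c \<in> sets \<B>" for A X
    using that
  proof (induction A)
    case empty
    have "P (indicator {})" by (rule ind) simp
    then show ?case by (simp add: bounded_borel_intros indicator_def[abs_def])
  next
    case (insert c A)
    have "P (\<lambda>z. c * indicator (X c) z)" "bounded_borel (\<lambda>z. c * indicator (X c) z)"
      using insert.prems by (auto intro!: scale ind bounded_borel_intros)
    moreover have "P (\<lambda>z. \<Sum>c\<in>A. c * indicator (X c) z)" "bounded_borel (\<lambda>z. \<Sum>c\<in>A. c * indicator (X c) z)"
      using insert.IH insert.prems by blast+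
    ultimately show ?case
      unfolding sum.insert[OF insert.hyps(1,2)] using insert.prems by (intro conjI add bounded_borel_intros) auto
  qed
  have simple: "P s \<and> bounded_borel s" if s: "simple_function \<B> s" "bounded_borel s" for s
  proof -
    define k where "k z = (\<Sum>c\<in>s ` S. c * indicator (s -` {c} \<inter> S) z)" for z
    have fin: "finite (s ` S)" using s(1) by (simp add: simple_function_def space_\<B>)
    have "P k \<and> bounded_borel k" unfolding k_def using s(1)
      by (intro sum fin) (auto simp: simple_function_def space_\<B>)
    moreover have ks: "k z = s z" if "z \<in> S" for z
    proof -
      have "k z = (\<Sum>c\<in>{s z}. c * indicator (s -` {c} \<inter> S) z)" unfolding k_def
        using that fin by (intro sum.mono_neutral_right) (auto simp: indicator_def)
      then show ?thesis using that by simp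
    qed
    moreover obtain b where "b \<ge> 0" "\<And>z. z \<in> S \<Longrightarrow> cmod (s z) \<le> b" using bounded_borel_bound[OF s(2)] by blast
    ultimately show ?thesis using lim[of "\<lambda>n. k" b s] s(2) by simp
  qed
  obtain F where F: "\<And>i. simple_function \<B> (F i)" "\<And>z. z \<in> S \<Longrightarrow> (\<lambda>i. F i z) \<longlonglongrightarrow> h z"
    "\<And>i z. z \<in> S \<Longrightarrow> cmod (F i z) \<le> 2 * cmod (h z)"
  proof -
    have "h \<in> borel_measurable \<B>" using h by (simp add: bounded_borel_def)
    then have "\<exists>F. (\<forall>i. simple_function \<B> (F i)) \<and> (\<forall>z\<in>S. (\<lambda>i. F i z) \<longlonglongrightarrow> h z) \<and>
        (\<forall>i. \<forall>z\<in>S. cmod (F i z) \<le> 2 * cmod (h z))"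
      using borel_measurable_implies_sequence_metric[of h \<B> 0] by (simp add: space_\<B>)
    then show thesis using that by blast
  qed
  obtain b where b: "b \<ge> 0" "\<And>z. z \<in> S \<Longrightarrow> cmod (h z) \<le> b" using bounded_borel_bound[OF h] by blast
  have le: "cmod (F i z) \<le> 2 * b" if "z \<in> S" for i z using F(3)[OF that, of i] b(2)[OF that] by linarith
  have "bounded_borel (F i)" for i
    using le F(1)[THEN borel_measurable_simple_function] by (auto simp: bounded_borel_def)
  then show ?thesis using F le b h simple by (intro lim[of F "2 * b" h]) auto
qed

text \<open>
  \<open>D\<close> is the operator integral of \<open>h\<close> with respect to \<open>E\<close>. Working with a relation separates
  uniqueness from existence, which is only available for bounded Borel functions.
\<close>

definition represents :: "(complex \<Rightarrow> complex) \<Rightarrow> ('v \<Rightarrow> 'v) \<Rightarrow> bool" where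
  "represents h D \<longleftrightarrow> bounded_clinear D \<and> (\<forall>x. cinner (D x) x = (LINT z|\<mu> x. h z))"

lemma represents_unique: "represents h D \<Longrightarrow> represents h D' \<Longrightarrow> D = D'"
  by (rule operator_eqI_quadratic_form) (auto simp: represents_def)

lemma represents_cong:
  assumes "\<And>z. z \<in> S \<Longrightarrow> h z = k z"
  shows "represents h D \<longleftrightarrow> represents k D"
proof -
  have "(LINT z|\<mu> x. h z) = (LINT z|\<mu> x. k z)" for x
    by (rule Bochner_Integration.integral_cong) (auto simp: space_\<mu> assms)
  then show ?thesis by (simp add: represents_def)
qed

lemma represents_clinear: "represents h D \<Longrightarrow> bounded_clinear D"
  by (simp add: represents_def)

lemma represents_indicator: "X \<in> sets \<B> \<Longrightarrow> represents (indicator X) (E X)"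
proof -
  assume X: "X \<in> sets \<B>"
  have "(LINT z|\<mu> x. indicator X z) = cinner (E X x) x" for x
  proof -
    have "(LINT z|\<mu> x. (indicator X z :: complex)) = (LINT z|\<mu> x. complex_of_real (indicator X z))"
      by (rule Bochner_Integration.integral_cong) (simp_all add: indicator_def)
    also have "\<dots> = complex_of_real (LINT z|\<mu> x. indicator X z)" by (rule integral_complex_of_real)
    also have "\<dots> = cinner (E X x) x"
      using X sets.sets_into_space[OF X] by (simp add: measure_\<mu> cinner_E space_\<mu> space_\<B> Int_absorb2)
    finally show ?thesis .
  qed
  then show ?thesis using X by (simp add: represents_def E_clinear)
qed

lemma represents_const: "represents (\<lambda>z. c) (\<lambda>x. c *\<^sub>C x)"
proof -
  have "(LINT z|\<mu> x. c) = c * complex_of_real ((norm x)\<^sup>2)" for x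
    using measure_\<mu>[OF S_sets, of x] finite_\<mu>[of x]
    by (simp add: space_\<mu> E_space scaleR_conv_of_real)
  then show ?thesis
    by (simp add: represents_def bounded_clinear_intros cinner_simps cinner_self)
qed

lemma represents_add: "bounded_borel h \<Longrightarrow> bounded_borel k \<Longrightarrow> represents h D \<Longrightarrow> represents k G \<Longrightarrow> represents (\<lambda>z. h z + k z) (\<lambda>x. D x + G x)"
  by (simp add: represents_def bounded_clinear_add cinner_simps bounded_borel_integrable)

lemma represents_scale: "represents h D \<Longrightarrow> represents (\<lambda>z. c * h z) (\<lambda>x. c *\<^sub>C D x)"
  by (simp add: represents_def bounded_clinear_scaleC cinner_simps)

lemma represents_diff: "bounded_borel h \<Longrightarrow> bounded_borel k \<Longrightarrow> represents h D \<Longrightarrow> represents k G \<Longrightarrow> represents (\<lambda>z. h z - k z) (\<lambda>x. D x - G x)"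
  by (simp add: represents_def bounded_clinear_diff cinner_simps bounded_borel_integrable)

lemma LINT_limit:
  assumes h: "\<And>n. bounded_borel (h n)" "bounded_borel k" and b: "\<And>n z. z \<in> S \<Longrightarrow> cmod (h n z) \<le> b"
    and lim: "\<And>z. z \<in> S \<Longrightarrow> (\<lambda>n. h n z) \<longlonglongrightarrow> k z"
  shows "(\<lambda>n. LINT z|\<mu> x. h n z) \<longlonglongrightarrow> (LINT z|\<mu> x. k z)"
proof (rule integral_dominated_convergence[where w="\<lambda>_. b"])
  show "integrable (\<mu> x) (\<lambda>_. b)" using finite_\<mu> by (simp add: finite_measure.integrable_const)
qed (auto simp: bounded_borel_measurable[OF h(1)] bounded_borel_measurable[OF h(2)] space_\<mu> b lim)

lemma LINT_bound:
  assumes h: "bounded_borel h" and b: "\<And>z. z \<in> S \<Longrightarrow> cmod (h z) \<le> b" "b \<ge> 0"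
  shows "cmod (LINT z|\<mu> x. h z) \<le> b * (norm x)\<^sup>2"
proof -
  have "cmod (LINT z|\<mu> x. h z) \<le> (LINT z|\<mu> x. cmod (h z))" by (rule integral_norm_bound)
  also have "\<dots> \<le> (LINT z|\<mu> x. b)"
    using finite_\<mu>[of x] bounded_borel_integrable[OF h] b
    by (intro integral_mono) (auto simp: space_\<mu> finite_measure.integrable_const)
  also have "\<dots> = b * (norm x)\<^sup>2"
    using measure_\<mu>[OF S_sets, of x] by (simp add: space_\<mu> E_space)
  finally show ?thesis .
qed

text \<open>
  Dominated convergence for the quadratic forms, turned into weak convergence by \<open>polarization\<close>.
\<close>

lemma represents_weak_limit:
  assumes "\<And>n. bounded_borel (h n)" "bounded_borel k" "\<And>n z. z \<in> S \<Longrightarrow> cmod (h n z) \<le> b"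
    "\<And>z. z \<in> S \<Longrightarrow> (\<lambda>n. h n z) \<longlonglongrightarrow> k z"
    and D: "\<And>n. represents (h n) (D n)" and G: "represents k G"
  shows "(\<lambda>n. cinner (D n x) y) \<longlonglongrightarrow> cinner (G x) y"
proof (rule weak_limit_tendsto[where D=D and D'=G])
  show "(\<lambda>n. cinner (D n x) x) \<longlonglongrightarrow> cinner (G x) x" for x
    using LINT_limit[OF assms(1-4), of x] D G by (simp add: represents_def)
qed (use D G in \<open>auto simp: represents_def\<close>)

text \<open>
  For the limit step the quadratic forms converge by dominated convergence, with a common bound.
\<close>

lemma represents_exists: "bounded_borel h \<Longrightarrow> \<exists>D. represents h D"
proof (induction rule: bounded_borel_induct)
  case (limit h k b)
  have "\<forall>n. \<exists>D. represents (h n) D" using limit.IH by blast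
  then obtain D where D: "\<And>n. represents (h n) (D n)" using choice[of "\<lambda>n. represents (h n)"] by blast
  have "\<exists>G. bounded_clinear G \<and> (\<forall>x. cinner (G x) x = (LINT z|\<mu> x. k z))"
  proof (rule weak_limit_exists)
    show "bounded_clinear (D n)" for n using D by (simp add: represents_def)
    show "cmod (cinner (D n x) x) \<le> b * (norm x)\<^sup>2" for n x
      using LINT_bound[OF limit.hyps(1,3,2)] D by (simp add: represents_def)
    show "(\<lambda>n. cinner (D n x) x) \<longlonglongrightarrow> (LINT z|\<mu> x. k z)" for x
      using LINT_limit[OF limit.hyps(1,5,3,4), of x] D by (simp add: represents_def)
  qed (rule limit.hyps)
  then show ?case by (simp add: represents_def)
qed (blast intro: represents_indicator represents_add represents_scale)+

text \<open>
  For indicators this is \<open>E (Y \<inter> X) = E Y \<circ> E X\<close>. In the limit step the operators converge weakly,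
  which is enough since the factor \<open>E X\<close> stands on the right.
\<close>

lemma represents_mult_indicator:
  assumes h: "bounded_borel h" and D: "represents h D" and X: "X \<in> sets \<B>"
  shows "represents (\<lambda>z. h z * indicator X z) (\<lambda>x. D (E X x))"
  using h D
proof (induction arbitrary: D rule: bounded_borel_induct)
  case (indicator Y)
  have "D = E Y" using represents_unique[OF indicator(2) represents_indicator[OF indicator(1)]] .
  moreover have "E (Y \<inter> X) = (\<lambda>x. E Y (E X x))" using E_Int[of Y X] indicator(1) X by auto
  moreover have "indicator (Y \<inter> X) = (\<lambda>z. indicator Y z * indicator X z :: complex)"
    by (rule ext) (rule indicator_inter_arith)
  ultimately show ?case using represents_indicator[of "Y \<inter> X"] indicator(1) X by (simp add: sets.Int)
next
  case (add h k)
  obtain D1 D2 where 1: "represents h D1" and 2: "represents k D2" using represents_exists add.hyps by metis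
  then have "D = (\<lambda>x. D1 x + D2 x)" using represents_unique[OF add.prems] represents_add add.hyps by blast
  then show ?case
    using represents_add[OF _ _ add.IH(1)[OF 1] add.IH(2)[OF 2]] add.hyps X
    by (simp add: bounded_borel_intros distrib_right)
next
  case (scale c h)
  obtain D1 where 1: "represents h D1" using represents_exists scale.hyps by metis
  then have "D = (\<lambda>x. c *\<^sub>C D1 x)" using represents_unique[OF scale.prems] represents_scale by blast
  then show ?case using represents_scale[OF scale.IH[OF 1], of c] by (simp add: mult.assoc)
next
  case (limit h k b)
  have "\<forall>n. \<exists>D. represents (h n) D" using limit.hyps(1) represents_exists by blast
  then obtain Dn where Dn: "\<And>n. represents (h n) (Dn n)" using choice[of "\<lambda>n. represents (h n)"] by blast
  have "cinner (D (E X x)) x = (LINT z|\<mu> x. k z * indicator X z)" for x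
  proof (rule LIMSEQ_unique)
    show "(\<lambda>n. cinner (Dn n (E X x)) x) \<longlonglongrightarrow> cinner (D (E X x)) x"
      by (rule represents_weak_limit[OF limit.hyps(1,5,3,4) Dn limit.prems])
    have "(\<lambda>n. LINT z|\<mu> x. h n z * indicator X z) \<longlonglongrightarrow> (LINT z|\<mu> x. k z * indicator X z)"
      using limit.hyps(1,5,3,4) X limit.hyps(2)
      by (intro LINT_limit[where b=b] bounded_borel_intros tendsto_mult_right) (auto simp: norm_mult indicator_def)
    then show "(\<lambda>n. cinner (Dn n (E X x)) x) \<longlonglongrightarrow> (LINT z|\<mu> x. k z * indicator X z)"
      using limit.IH[OF Dn] by (simp add: represents_def)
  qed
  then show ?case using limit.prems X by (simp add: represents_def bounded_clinear_compose E_clinear)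
qed

text \<open>
  The second induction, on the right factor. Here the weak limit passes through \<open>D\<close> by taking the
  adjoint of \<open>D\<close> to the other side.
\<close>

lemma represents_mult:
  assumes h: "bounded_borel h" and D: "represents h D" and k: "bounded_borel k" and G: "represents k G"
  shows "represents (\<lambda>z. h z * k z) (\<lambda>x. D (G x))"
  using k G
proof (induction arbitrary: G rule: bounded_borel_induct)
  case (indicator Y)
  have "G = E Y" using represents_unique[OF indicator(2) represents_indicator[OF indicator(1)]] .
  then show ?case using represents_mult_indicator[OF h D indicator(1)] by simp
next
  case (add k l)
  obtain D1 D2 where 1: "represents k D1" and 2: "represents l D2" using represents_exists add.hyps by metis
  then have "G = (\<lambda>x. D1 x + D2 x)" using represents_unique[OF add.prems] represents_add add.hyps by blast
  then show ?case
    using represents_add[OF _ _ add.IH(1)[OF 1] add.IH(2)[OF 2]] add.hyps h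
    by (simp add: bounded_borel_intros distrib_left bounded_clinearD[OF represents_clinear[OF D]])
next
  case (scale c k)
  obtain D1 where 1: "represents k D1" using represents_exists scale.hyps by metis
  then have "G = (\<lambda>x. c *\<^sub>C D1 x)" using represents_unique[OF scale.prems] represents_scale by blast
  then show ?case using represents_scale[OF scale.IH[OF 1], of c]
    by (simp add: mult.left_commute bounded_clinearD[OF represents_clinear[OF D]])
next
  case (limit l k b)
  have "\<forall>n. \<exists>D. represents (l n) D" using limit.hyps(1) represents_exists by blast
  then obtain Gn where Gn: "\<And>n. represents (l n) (Gn n)" using choice[of "\<lambda>n. represents (l n)"] by blast
  let ?A = "adjoint_wrt cinner cinner D"
  have A: "cinner (D x) y = cinner x (?A y)" for x y
    by (rule adjoint_works[OF riesz_form_cinner riesz_form_cinner represents_clinear[OF D]])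
  obtain b' where b': "b' \<ge> 0" "\<And>z. z \<in> S \<Longrightarrow> cmod (h z) \<le> b'" using bounded_borel_bound[OF h] by blast
  have "cinner (D (G x)) x = (LINT z|\<mu> x. h z * k z)" for x
  proof (rule LIMSEQ_unique)
    show "(\<lambda>n. cinner (D (Gn n x)) x) \<longlonglongrightarrow> cinner (D (G x)) x"
      unfolding A by (rule represents_weak_limit[OF limit.hyps(1,5,3,4) Gn limit.prems])
    have "(\<lambda>n. LINT z|\<mu> x. h z * l n z) \<longlonglongrightarrow> (LINT z|\<mu> x. h z * k z)"
      using limit.hyps(1,5,3,4,2) h b'
      by (intro LINT_limit[where b="b' * b"] bounded_borel_intros tendsto_mult_left) (auto simp: norm_mult intro!: mult_mono)
    then show "(\<lambda>n. cinner (D (Gn n x)) x) \<longlonglongrightarrow> (LINT z|\<mu> x. h z * k z)"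
      using limit.IH[OF Gn] by (simp add: represents_def)
  qed
  then show ?case using represents_clinear[OF limit.prems] represents_clinear[OF D] by (simp add: represents_def bounded_clinear_compose)
qed

lemma represents_cnj:
  assumes D: "represents h D" and G: "bounded_clinear G" "\<And>x y. cinner (D x) y = cinner x (G y)"
  shows "represents (\<lambda>z. cnj (h z)) G"
proof -
  have "cinner (G x) x = cnj (cinner (D x) x)" for x using G(2)[of x x] cinner_commute by metis
  then show ?thesis using D G(1) by (simp add: represents_def)
qed

lemma represents_poly_op:
  assumes h: "bounded_borel h" "represents h D"
  shows "represents (\<lambda>z. poly r (h z)) (poly_op r D) \<and> bounded_borel (\<lambda>z. poly r (h z))"
proof (induction r rule: pCons_induct)
  case 0
  have "poly_op 0 D = (\<lambda>x. 0)" by (rule ext) simp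
  then show ?case using represents_const[of 0] by (simp add: bounded_borel_intros)
next
  case (pCons a r)
  have eq: "poly_op (pCons a r) D = (\<lambda>x. a *\<^sub>C x + poly_op r D (D x))" by (rule ext) (rule poly_op_pCons)
  have "represents (\<lambda>z. a + poly r (h z) * h z) (poly_op (pCons a r) D)"
    unfolding eq using pCons.IH h by (intro represents_add represents_const represents_mult bounded_borel_intros) auto
  then show ?case using pCons.IH h by (auto simp: mult.commute intro!: bounded_borel_intros)
qed

lemma represents_poly2_op:
  assumes h: "bounded_borel h" "represents h D" and k: "bounded_borel k" "represents k G"
  shows "represents (\<lambda>z. poly2 s (h z) (k z)) (poly2_op s D G) \<and> bounded_borel (\<lambda>z. poly2 s (h z) (k z))"
proof (induction s rule: pCons_induct)
  case 0
  have "poly2_op 0 D G = (\<lambda>x. 0)" by (rule ext) simp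
  then show ?case using represents_const[of 0] by (simp add: bounded_borel_intros poly2_def)
next
  case (pCons c s)
  have eq: "poly2_op (pCons c s) D G = (\<lambda>x. poly_op c D x + poly2_op s D G (G x))" by (rule ext) (rule poly2_op_pCons)
  have e2: "poly2 (pCons c s) x y = poly c x + poly2 s x y * y" for x y by (simp add: poly2_def)
  show ?case
    unfolding eq e2 using pCons.IH represents_poly_op[OF h, of c] k by (intro conjI represents_add represents_mult bounded_borel_intros) auto
qed

lemma represents_spectral_integral:
  assumes "bounded_borel (\<lambda>z. indicator X z *\<^sub>R h z)"
  shows "represents (\<lambda>z. indicator X z *\<^sub>R h z) (spectral_integral S E X h)"
proof -
  obtain D where D: "represents (\<lambda>z. indicator X z *\<^sub>R h z) D" using represents_exists[OF assms] by blast
  have "spectral_integral S E X h = D" unfolding spectral_integral_def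
  proof (rule the_equality)
    fix D' assume "bounded_clinear D' \<and> (\<forall>x. cinner (D' x) x = (LINT z:X|\<mu> x. h z))"
    then have "represents (\<lambda>z. indicator X z *\<^sub>R h z) D'" by (simp add: represents_def set_lebesgue_integral_def)
    then show "D' = D" using represents_unique D by blast
  qed (use D in \<open>simp add: represents_def set_lebesgue_integral_def\<close>)
  then show ?thesis using D by simp
qed

lemma bounded_borel_restrict:
  assumes m: "h \<in> borel_measurable (restrict_space borel (S - Z))" and b: "bounded (h ` (S - Z))"
    and Z: "closed Z"
  shows "bounded_borel (\<lambda>z. indicator (S - Z) z *\<^sub>R h z)"
proof -
  have SZ: "S - Z \<in> sets \<B>" using Z by (rule compl_closed_sets)
  have "sets (restrict_space \<B> (S - Z)) = sets (restrict_space borel (S - Z))"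
    by (simp add: sets_restrict_restrict_space Int_absorb1)
  then have "h \<in> borel_measurable (restrict_space \<B> (S - Z))"
    using m by (simp cong: measurable_cong_sets)
  then have "(\<lambda>z. indicator (S - Z) z *\<^sub>R h z) \<in> borel_measurable \<B>"
    using SZ by (subst (asm) borel_measurable_restrict_space_iff) (auto simp: space_\<B> Int_absorb2)
  moreover obtain c where "\<And>z. z \<in> S - Z \<Longrightarrow> cmod (h z) \<le> c" using b by (auto simp: bounded_iff)
  then have "\<forall>z\<in>S. cmod (indicator (S - Z) z *\<^sub>R h z) \<le> max c 0"
    by (auto simp: indicator_def le_max_iff_disj)
  ultimately show ?thesis unfolding bounded_borel_def by blast
qed

end

text \<open>
  If \<open>cmod z\<close> exceeds a bound of \<open>C\<close>, then \<open>C x - z x = y\<close> is the fixed point equation of the contraction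
  \<open>x \<mapsto> (C x - y) / z\<close>.
\<close>

lemma spectrum_bounded:
  fixes C :: "'a::complex_banach \<Rightarrow> 'a"
  assumes C: "bounded_clinear C"
  obtains K where "\<And>z. z \<in> spectrum C \<Longrightarrow> cmod z \<le> K"
proof -
  note bC = bounded_clinearD[OF C]
  obtain K where K: "K > 0" "\<And>x. norm (C x) \<le> K * norm x" using bounded_clinear_bound[OF C] by blast
  have "z \<notin> spectrum C" if z: "cmod z > K" for z
  proof -
    have z0: "z \<noteq> 0" using z K by auto
    have ex: "\<exists>!x. inverse z *\<^sub>C (C x - y) = x" for y
    proof (rule banach_fix_type[of "K / cmod z"])
      show "\<forall>x x'. dist (inverse z *\<^sub>C (C x - y)) (inverse z *\<^sub>C (C x' - y)) \<le> K / cmod z * dist x x'"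
      proof (intro allI)
        fix x x'
        have "inverse z *\<^sub>C (C x - y) - inverse z *\<^sub>C (C x' - y) = inverse z *\<^sub>C C (x - x')"
          by (simp add: bC complex_vector.scale_right_diff_distrib)
        then have "dist (inverse z *\<^sub>C (C x - y)) (inverse z *\<^sub>C (C x' - y)) = norm (C (x - x')) / cmod z"
          by (simp only: dist_norm norm_scaleC norm_inverse) (simp add: field_simps)
        also have "\<dots> \<le> K / cmod z * dist x x'"
          using divide_right_mono[OF K(2)[of "x - x'"], of "cmod z"] by (simp add: dist_norm)
        finally show "dist (inverse z *\<^sub>C (C x - y)) (inverse z *\<^sub>C (C x' - y)) \<le> K / cmod z * dist x x'" .
      qed
    qed (use K z in \<open>auto simp: divide_less_eq\<close>)
    have iff: "inverse z *\<^sub>C (C x - y) = x \<longleftrightarrow> C x - z *\<^sub>C x = y" for x y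
    proof
      assume "inverse z *\<^sub>C (C x - y) = x"
      then have "z *\<^sub>C x = z *\<^sub>C inverse z *\<^sub>C (C x - y)" by simp
      then show "C x - z *\<^sub>C x = y" using z0 by (simp add: scaleC_scaleC)
    next
      assume "C x - z *\<^sub>C x = y"
      then have "C x - y = z *\<^sub>C x" by (simp add: algebra_simps)
      then show "inverse z *\<^sub>C (C x - y) = x" using z0 by (simp add: scaleC_scaleC)
    qed
    define D where "D y = (THE x. C x - z *\<^sub>C x = y)" for y
    have ex': "\<exists>!x. C x - z *\<^sub>C x = y" for y using ex[of y] by (simp add: iff)
    have D: "C (D y) - z *\<^sub>C D y = y" for y unfolding D_def by (rule theI'[OF ex'])
    have D': "D y = x" if "C x - z *\<^sub>C x = y" for x y using ex'[of y] D[of y] that by blast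
    have "bounded_clinear D"
    proof (rule bounded_clinearI[where K="1 / (cmod z - K)"])
      show "D (x + y) = D x + D y" for x y
        by (rule D') (use D[of x] D[of y] in \<open>simp add: bC scaleC_add_right algebra_simps\<close>)
      show "D (c *\<^sub>C x) = c *\<^sub>C D x" for c x
      proof (rule D')
        have "C (c *\<^sub>C D x) - z *\<^sub>C c *\<^sub>C D x = c *\<^sub>C (C (D x) - z *\<^sub>C D x)"
          by (simp add: bC scaleC_scaleC complex_vector.scale_right_diff_distrib mult.commute)
        then show "C (c *\<^sub>C D x) - z *\<^sub>C c *\<^sub>C D x = c *\<^sub>C x" by (simp add: D)
      qed
      show "norm (D y) \<le> 1 / (cmod z - K) * norm y" for y
      proof -
        have "norm (z *\<^sub>C D y) \<le> norm (C (D y)) + norm (C (D y) - z *\<^sub>C D y)"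
          using norm_triangle_ineq4[of "C (D y)" "C (D y) - z *\<^sub>C D y"] by simp
        then have "cmod z * norm (D y) \<le> K * norm (D y) + norm y"
          using K(2)[of "D y"] by (simp add: D norm_scaleC)
        then show ?thesis using z by (simp add: field_simps)
      qed
    qed
    moreover have "D \<circ> (\<lambda>x. C x - z *\<^sub>C x) = id" using D' by auto
    moreover have "(\<lambda>x. C x - z *\<^sub>C x) \<circ> D = id" using D by auto
    ultimately show ?thesis by (auto simp: spectrum_def)
  qed
  then show ?thesis using that[of K] by force
qed

section \<open>Comparison of two admissible decompositions\<close>

lemma poly_cpoly_of_real: "poly (cpoly p) (complex_of_real x) = complex_of_real (poly p x)"
  by (induction p rule: pCons_induct) (simp_all add: map_poly_pCons)

lemma finite_Zreal:
  assumes "p \<noteq> 0" "q \<noteq> 0"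
  shows "finite (Zreal p q)"
proof -
  have "Zreal p q \<subseteq> (\<lambda>(x, y). Complex x y) ` ({x. poly p x = 0} \<times> {y. poly q y = 0})"
    by (auto simp: Zreal_def image_iff complex_eq_iff)
  then show ?thesis
    using assms by (blast intro: finite_subset finite_imageI finite_cartesian_product poly_roots_finite)
qed

text \<open>
  The jets of \<open>s\<close> and \<open>s'\<close> agree with that of \<open>\<phi>\<close> below the multiplicities, so \<open>ideal_membership\<close>
  applies. At \<open>w\<close> in \<open>Zreal p q\<close> with multiplicities \<open>m\<close>, \<open>n\<close>, the entry \<open>(m,0)\<close> of \<open>p u + q v\<close> is
  the leading Taylor coefficient of \<open>p\<close> times \<open>u(w)\<close>, as \<open>q(w)\<close> contributes nothing; the same factor
  stands in front of \<open>g(w)\<^sub>1\<close>, and it is nonzero. The entry \<open>(0,n)\<close> gives \<open>v(w)\<close> in the same way.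
\<close>

lemma admissible_difference:
  assumes p: "p \<noteq> 0" and q: "q \<noteq> 0"
    and adm: "admissible S p q \<phi> s g" and adm': "admissible S p q \<phi> s' g'"
  shows "\<exists>u v. s - s' = in_first p * u + in_second q * v \<and>
     (\<forall>z\<in>S - Zreal p q. (poly (cpoly p) (Re z) + poly (cpoly q) (Im z)) * (gscalar g' z - gscalar g z) =
        poly (cpoly p) (Re z) * poly2 u (Re z) (Im z) + poly (cpoly q) (Im z) * poly2 v (Re z) (Im z)) \<and>
     (\<forall>w\<in>S \<inter> Zreal p q. poly2 u (Re w) (Im w) = fst (gpair g' w) - fst (gpair g w) \<and>
        poly2 v (Re w) (Im w) = snd (gpair g' w) - snd (gpair g w))"
proof -
  have jr: "jet_real \<phi> z k l = taylor2 t (Re z) (Im z) k l"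
    if "admissible S p q \<phi> t h" "z \<in> Zreal p q" "k < mult_zero p (Re z)" "l < mult_zero q (Im z)" for t h z k l
    using that unfolding admissible_def Let_def R_N_def mfun_minus_def poly_N_def
    by (auto simp: box_idx_def idx_real_def jet_idx_def)
  have ji: "jet_imag \<phi> (x, y) k l = taylor2 t x y k l"
    if "admissible S p q \<phi> t h" "(x, y) \<in> Zimag p q" "k < mult_zero p x" "l < mult_zero q y" for t h x y k l
    using that unfolding admissible_def Let_def R_N_def mfun_minus_def poly_N_def
    by (auto simp: box_idx_def idx_imag_def)
  have van: "taylor2 (s - s') x y k l = 0"
    if "poly (cpoly p) x = 0" "poly (cpoly q) y = 0" "k < mult_zero p x" "l < mult_zero q y" for x y k l
  proof (cases "x \<in> \<real> \<and> y \<in> \<real>")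
    case True
    \<comment> \<open>real zeros \<open>x\<close>, \<open>y\<close> are encoded as one point \<open>x + iy\<close>\<close>
    define z where "z = Complex (Re x) (Re y)"
    have xy: "x = complex_of_real (Re z)" "y = complex_of_real (Im z)" using True by (auto simp: z_def complex_is_Real_iff complex_eq_iff)
    have "z \<in> Zreal p q" using that(1,2) unfolding xy by (simp add: Zreal_def poly_cpoly_of_real)
    then show ?thesis
      using jr[OF adm] jr[OF adm'] that(3,4) unfolding xy taylor2_diff by (metis right_minus_eq)
  next
    case False
    then have "(x, y) \<in> Zimag p q" using that by (auto simp: Zimag_def)
    then show ?thesis
      using ji[OF adm] ji[OF adm'] that(3,4) unfolding taylor2_diff by (metis right_minus_eq)
  qed
  obtain u v where uv: "s - s' = in_first p * u + in_second q * v"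
    using ideal_membership[OF p q van] by blast
  have reg: "(poly (cpoly p) (Re z) + poly (cpoly q) (Im z)) * (gscalar g' z - gscalar g z) =
        poly (cpoly p) (Re z) * poly2 u (Re z) (Im z) + poly (cpoly q) (Im z) * poly2 v (Re z) (Im z)"
    if z: "z \<in> S - Zreal p q" for z
  proof -
    have e: "regular \<phi> z = poly2 t (Re z) (Im z) + (poly (cpoly p) (Re z) + poly (cpoly q) (Im z)) * gscalar h z"
      if "admissible S p q \<phi> t h" for t h
      using that z unfolding admissible_def Let_def poly_N_def mfun_plus_def
      by (auto simp: poly2_in_first poly2_in_second)
    have "poly2 (s - s') (Re z) (Im z) =
        (poly (cpoly p) (Re z) + poly (cpoly q) (Im z)) * (gscalar g' z - gscalar g z)"
      using e[OF adm] e[OF adm'] by (simp add: poly2_diff algebra_simps)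
    then show ?thesis unfolding uv by (simp add: poly2_add poly2_mult poly2_in_first poly2_in_second)
  qed
  have pair: "poly2 u (Re w) (Im w) = fst (gpair g' w) - fst (gpair g w) \<and>
        poly2 v (Re w) (Im w) = snd (gpair g' w) - snd (gpair g w)" if w: "w \<in> S \<inter> Zreal p q" for w
  proof -
    let ?x = "complex_of_real (Re w)" and ?y = "complex_of_real (Im w)"
    let ?m = "mult_zero p ?x" and ?n = "mult_zero q ?y"
    have m: "?m > 0" and n: "?n > 0"
      using w p q by (auto simp: Zreal_def mult_zero_def order_gt_0_iff poly_cpoly_of_real)
    have one: "taylor2 (in_first p) ?x ?y k l = taylor2 (in_first p * 1) ?x ?y k l"
      "taylor2 (in_second q) ?x ?y k l = taylor2 (in_second q * 1) ?x ?y k l" for k l by simp_all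
    have t1: "taylor2 1 ?x ?y 0 0 = 1" by (simp add: taylor2_0_0 poly2_def)
    let ?cp = "coeff (pcompose (cpoly p) [:?x, 1:]) ?m" and ?cq = "coeff (pcompose (cpoly q) [:?y, 1:]) ?n"
    have pq1: "taylor2 (in_first p) ?x ?y ?m 0 + taylor2 (in_second q) ?x ?y ?m 0 = ?cp"
      and pq2: "taylor2 (in_first p) ?x ?y 0 ?n + taylor2 (in_second q) ?x ?y 0 ?n = ?cq"
      unfolding one by (simp_all add: taylor2_in_first_mult_order taylor2_in_second_mult_order t1
        taylor2_in_first_mult_low[OF m] taylor2_in_second_mult_low[OF n] del: mult_1_right)
    have idx: "(?m, 0) \<in> idx_real p q w" "(0, ?n) \<in> idx_real p q w"
      by (simp_all add: idx_real_def jet_idx_def)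
    have e: "jet_real \<phi> w ?m 0 = taylor2 t ?x ?y ?m 0 + ?cp * fst (gpair h w) \<and>
        jet_real \<phi> w 0 ?n = taylor2 t ?x ?y 0 ?n + ?cq * snd (gpair h w)"
      if "admissible S p q \<phi> t h" for t h
    proof -
      have "jet_real \<phi> w k l = jet_real (poly_N S p q t) w k l +
            jet_times_pair ?m ?n (jet_real (mfun_plus (poly_N S p q (in_first p)) (poly_N S p q (in_second q))) w)
              (gpair h w) k l" for k l
        using that w unfolding admissible_def Let_def by blast
      from this[of ?m 0] this[of 0 ?n] show ?thesis
        using w idx m n by (simp add: poly_N_def mfun_plus_def jet_times_pair_def pq1 pq2)
    qed
    have "taylor2 (s - s') ?x ?y ?m 0 = ?cp * (fst (gpair g' w) - fst (gpair g w))"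
      "taylor2 (s - s') ?x ?y 0 ?n = ?cq * (snd (gpair g' w) - snd (gpair g w))"
      using e[OF adm] e[OF adm'] by (auto simp: taylor2_diff algebra_simps)
    then have "?cp * poly2 u ?x ?y = ?cp * (fst (gpair g' w) - fst (gpair g w))"
      "?cq * poly2 v ?x ?y = ?cq * (snd (gpair g' w) - snd (gpair g w))"
      unfolding uv taylor2_add
      by (simp_all add: taylor2_in_first_mult_order taylor2_in_second_mult_order taylor2_0_0
        taylor2_in_first_mult_low[OF m] taylor2_in_second_mult_low[OF n])
    moreover have "?cp \<noteq> 0" "?cq \<noteq> 0" using coeff_shift_at_order p q by blast+
    ultimately show ?thesis by simp
  qed
  show ?thesis using uv reg pair by blast
qed

context spectral_measure
begin

text \<open>
  Finite additivity, read off from \<open>1 = 1\<^bsub>S - Z\<^esub> + \<Sum>\<^bsub>w\<in>S\<inter>Z\<^esub> 1\<^bsub>{w}\<^esub>\<close> on \<open>S\<close>.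
\<close>

lemma E_decompose:
  assumes Z: "finite Z"
  shows "y = E (S - Z) y + (\<Sum>w\<in>S \<inter> Z. E {w} y)"
proof -
  have SZ: "S - Z \<in> sets \<B>" using Z by (simp add: compl_closed_sets finite_imp_closed)
  have sum: "represents (\<lambda>z. \<Sum>w\<in>F. indicator {w} z) (\<lambda>y. \<Sum>w\<in>F. E {w} y) \<and> bounded_borel (\<lambda>z. \<Sum>w\<in>F. indicator {w} z)"
    if "finite F" "F \<subseteq> S" for F
    using that
  proof (induction F)
    case empty
    then show ?case using represents_const[of 0] by (simp add: bounded_borel_intros)
  next
    case (insert w F)
    have "{w} \<in> sets \<B>" using insert.prems by (intro singleton_sets) auto
    then show ?case
      unfolding sum.insert[OF insert.hyps(1,2)] using insert.IH insert.prems
      by (intro conjI represents_add bounded_borel_intros represents_indicator) auto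
  qed
  let ?h = "\<lambda>z. indicator (S - Z) z + (\<Sum>w\<in>S \<inter> Z. indicator {w} z) :: complex"
  have "represents ?h (\<lambda>y. E (S - Z) y + (\<Sum>w\<in>S \<inter> Z. E {w} y))"
    using sum[of "S \<inter> Z"] Z SZ by (intro represents_add bounded_borel_intros represents_indicator) auto
  moreover have "represents ?h (\<lambda>y. 1 *\<^sub>C y)"
  proof (subst represents_cong[where k="\<lambda>_. 1"])
    show "?h z = 1" if "z \<in> S" for z
    proof (cases "z \<in> Z")
      case True
      have "(\<Sum>w\<in>S \<inter> Z. indicator {w} z) = (\<Sum>w\<in>{z}. indicator {w} z :: complex)"
        using True that Z by (intro sum.mono_neutral_right) (auto simp: indicator_def)
      then show ?thesis using True by simp
    next
      case False
      have "(\<Sum>w\<in>S \<inter> Z. indicator {w} z :: complex) = 0"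
        using False by (intro sum.neutral) (auto simp: indicator_def)
      then show ?thesis using False that by simp
    qed
  qed (rule represents_const)
  ultimately show ?thesis using represents_unique by (metis (no_types, lifting) complex_vector.scale_one)
qed

text \<open>
  The operator \<open>W = p(a) + q(b)\<close> has no bounded inverse in general, but the difference \<open>K\<close> of both sides
  on the range of \<open>P = E (S - Zreal p q)\<close> satisfies \<open>K W P = 0\<close>. Passing to the adjoint, \<open>W P K* = 0\<close>, and
  injectivity of \<open>W\<close> on the range of \<open>P\<close> yields \<open>P K* = 0\<close>, that is, \<open>K P = 0\<close>. In the application
  \<open>X1\<close> and \<open>X2\<close> are \<open>R\<^sub>1 R\<^sub>1*\<close> and \<open>R\<^sub>2 R\<^sub>2*\<close>.
\<close>

lemma calculus_split:
  assumes bmRI: "bounded_borel (\<lambda>z. complex_of_real (Re z))" "bounded_borel (\<lambda>z. complex_of_real (Im z))"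
    and a: "represents (\<lambda>z. complex_of_real (Re z)) a" and b: "represents (\<lambda>z. complex_of_real (Im z)) b"
    and X1: "bounded_clinear X1" "\<And>y. X1 (poly_op (cpoly p) a y + poly_op (cpoly q) b y) = poly_op (cpoly p) a y"
    and X2: "bounded_clinear X2" "\<And>y. X2 (poly_op (cpoly p) a y + poly_op (cpoly q) b y) = poly_op (cpoly q) b y"
    and pq: "p \<noteq> 0" "q \<noteq> 0"
    and H: "represents (\<lambda>z. indicator (S - Zreal p q) z *\<^sub>R h z) H" "bounded_borel (\<lambda>z. indicator (S - Zreal p q) z *\<^sub>R h z)"
    and h: "\<And>z. z \<in> S - Zreal p q \<Longrightarrow> (poly (cpoly p) (Re z) + poly (cpoly q) (Im z)) * h z =
        poly (cpoly p) (Re z) * poly2 u (Re z) (Im z) + poly (cpoly q) (Im z) * poly2 v (Re z) (Im z)"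
  shows "X1 (poly2_op u a b y) + X2 (poly2_op v a b y) = H y +
    (\<Sum>w\<in>S \<inter> Zreal p q. poly2 u (Re w) (Im w) *\<^sub>C X1 (E {w} y) + poly2 v (Re w) (Im w) *\<^sub>C X2 (E {w} y))"
proof -
  let ?Z = "Zreal p q"
  have finZ: "finite ?Z" by (rule finite_Zreal[OF pq])
  have SZ: "S - ?Z \<in> sets \<B>" using finZ by (simp add: compl_closed_sets finite_imp_closed)
  define P where "P = E (S - ?Z)"
  note ra = bmRI(1) a and rb = bmRI(2) b
  define pa where "pa = poly_op (cpoly p) a"
  define qb where "qb = poly_op (cpoly q) b"
  define ua where "ua = poly2_op u a b"
  define va where "va = poly2_op v a b"
  define W where "W y = pa y + qb y" for y
  have rp: "represents (\<lambda>z. poly (cpoly p) (Re z)) pa" "bounded_borel (\<lambda>z. poly (cpoly p) (Re z))"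
    using represents_poly_op[OF ra, of "cpoly p"] by (auto simp: pa_def)
  have rq: "represents (\<lambda>z. poly (cpoly q) (Im z)) qb" "bounded_borel (\<lambda>z. poly (cpoly q) (Im z))"
    using represents_poly_op[OF rb, of "cpoly q"] by (auto simp: qb_def)
  have ru: "represents (\<lambda>z. poly2 u (Re z) (Im z)) ua" "bounded_borel (\<lambda>z. poly2 u (Re z) (Im z))"
    and rv: "represents (\<lambda>z. poly2 v (Re z) (Im z)) va" "bounded_borel (\<lambda>z. poly2 v (Re z) (Im z))"
    using represents_poly2_op[OF ra rb] by (auto simp: ua_def va_def)
  have rP: "represents (indicator (S - ?Z)) P" "bounded_borel (indicator (S - ?Z))"
    using SZ by (auto simp: P_def represents_indicator bounded_borel_intros)
  have rW: "represents (\<lambda>z. poly (cpoly p) (Re z) + poly (cpoly q) (Im z)) W"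
    "bounded_borel (\<lambda>z. poly (cpoly p) (Re z) + poly (cpoly q) (Im z))"
    unfolding W_def using rp rq by (auto intro!: represents_add bounded_borel_intros)
  have comm: "D (G x) = G (D x)" if "represents k D" "bounded_borel k" "represents l G" "bounded_borel l" for k l D G x
    using represents_unique[OF represents_mult[OF that(2,1,4,3)]] represents_mult[OF that(4,3,2,1)]
    by (metis (no_types, lifting) mult.commute represents_cong)
  have X1W: "X1 (W y) = pa y" and X2W: "X2 (W y) = qb y" for y
    using X1(2) X2(2) by (simp_all add: W_def pa_def qb_def)
  have clP: "bounded_clinear P" using represents_clinear[OF rP(1)] .
  have Psa: "cinner (P x) y = cinner x (P y)" for x y unfolding P_def by (rule E_selfadjoint[OF SZ])
  have PP: "P (P x) = P x" for x unfolding P_def by (rule E_idem[OF SZ])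
  have real_sa: "cinner (D x) y = cinner x (D y)"
    if "represents k D" "\<And>z. z \<in> S \<Longrightarrow> cnj (k z) = k z" for k D x y
  proof -
    have ad: "bounded_clinear (adjoint_wrt cinner cinner D)" "\<And>x y. cinner (D x) y = cinner x (adjoint_wrt cinner cinner D y)"
      using bounded_clinear_adjoint[OF riesz_form_cinner riesz_form_cinner represents_clinear[OF that(1)]]
        adjoint_works[OF riesz_form_cinner riesz_form_cinner represents_clinear[OF that(1)]] by auto
    have "represents k (adjoint_wrt cinner cinner D)" using represents_cnj[OF that(1) ad] that(2) by (simp add: represents_cong[where h="\<lambda>z. cnj (k z)" and k=k])
    then have "adjoint_wrt cinner cinner D = D" using represents_unique that(1) by blast
    then show ?thesis using ad(2) by simp
  qed
  have cW: "cnj (poly (cpoly p) (Re z) + poly (cpoly q) (Im z)) = poly (cpoly p) (Re z) + poly (cpoly q) (Im z)"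
    and cp: "cnj (poly (cpoly p) (Re z)) = poly (cpoly p) (Re z)"
    and cq: "cnj (poly (cpoly q) (Im z)) = poly (cpoly q) (Im z)" for z
    by (simp_all add: poly_cpoly_of_real)
  have Wsa: "cinner (W x) y = cinner x (W y)" for x y by (rule real_sa[OF rW(1) cW])
  have inj: "P x = 0" if "W (P x) = 0" for x
  proof -
    \<comment> \<open>both \<open>pa\<close> and \<open>qb\<close> factor through \<open>W\<close>, so that the nonnegative \<open>p\<^sup>2 + q\<^sup>2\<close> integrates to \<open>0\<close>\<close>
    have 1: "pa (P x) = 0" "qb (P x) = 0"
      using X1W[of "P x"] X2W[of "P x"] that bounded_clinearD(4)[OF X1(1)] bounded_clinearD(4)[OF X2(1)] by auto
    let ?y = "P x"
    have "represents (\<lambda>z. poly (cpoly p) (Re z) * poly (cpoly p) (Re z) + poly (cpoly q) (Im z) * poly (cpoly q) (Im z))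
        (\<lambda>x. pa (pa x) + qb (qb x))"
      using rp rq by (intro represents_add represents_mult bounded_borel_intros)
    then have "(LINT z|\<mu> ?y. poly (cpoly p) (Re z) * poly (cpoly p) (Re z) + poly (cpoly q) (Im z) * poly (cpoly q) (Im z)) = 0"
      using 1 bounded_clinearD(4)[OF represents_clinear[OF rp(1)]] bounded_clinearD(4)[OF represents_clinear[OF rq(1)]]
      unfolding represents_def by (metis add_0 cinner_simps(7))
    then have "(LINT z|\<mu> ?y. complex_of_real ((poly p (Re z))\<^sup>2 + (poly q (Im z))\<^sup>2)) = 0"
      by (simp add: poly_cpoly_of_real power2_eq_square)
    then have 0: "(LINT z|\<mu> ?y. (poly p (Re z))\<^sup>2 + (poly q (Im z))\<^sup>2) = 0"
      by (simp only: integral_complex_of_real of_real_eq_0_iff)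
    have "integrable (\<mu> ?y) (\<lambda>z. poly (cpoly p) (Re z) * poly (cpoly p) (Re z) + poly (cpoly q) (Im z) * poly (cpoly q) (Im z))"
      using rp rq by (intro bounded_borel_integrable bounded_borel_intros)
    then have "integrable (\<mu> ?y) (\<lambda>z. complex_of_real ((poly p (Re z))\<^sup>2 + (poly q (Im z))\<^sup>2))"
      by (simp add: poly_cpoly_of_real power2_eq_square)
    then have "integrable (\<mu> ?y) (\<lambda>z. (poly p (Re z))\<^sup>2 + (poly q (Im z))\<^sup>2)"
      by (simp only: complex_of_real_integrable_eq)
    then have "AE z in \<mu> ?y. (poly p (Re z))\<^sup>2 + (poly q (Im z))\<^sup>2 = 0"
      using 0 by (subst (asm) integral_nonneg_eq_0_iff_AE) auto
    then have "AE z in \<mu> ?y. z \<notin> S - ?Z"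
      by (rule AE_mp) (auto simp: Zreal_def sum_power2_eq_zero_iff)
    then have "emeasure (\<mu> ?y) (S - ?Z) = 0"
      using SZ by (subst (asm) AE_iff_measurable[where N="S - ?Z"]) (auto simp: space_\<mu> sets_\<mu>)
    then have "(norm (P ?y))\<^sup>2 = 0" using emeasure_\<mu>[OF SZ, of ?y] by (simp add: P_def)
    then show ?thesis by (simp add: PP)
  qed
  define K where "K y = X1 (ua y) + X2 (va y) - H y" for y
  have clK: "bounded_clinear K"
    unfolding K_def
    by (rule bounded_clinear_diff[OF bounded_clinear_add[OF
          bounded_clinear_compose[OF X1(1) represents_clinear[OF ru(1)]]
          bounded_clinear_compose[OF X2(1) represents_clinear[OF rv(1)]]] represents_clinear[OF H(1)]])
  have KWP: "K (W (P y)) = 0" for y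
  proof -
    have "represents (\<lambda>z. (poly (cpoly p) (Re z) * poly2 u (Re z) (Im z) + poly (cpoly q) (Im z) * poly2 v (Re z) (Im z)) * indicator (S - ?Z) z)
        (\<lambda>y. pa (ua (P y)) + qb (va (P y)))"
      using represents_mult[OF bounded_borel_intros(2)[OF bounded_borel_intros(3)[OF rp(2) ru(2)] bounded_borel_intros(3)[OF rq(2) rv(2)]]
          represents_add[OF bounded_borel_intros(3)[OF rp(2) ru(2)] bounded_borel_intros(3)[OF rq(2) rv(2)]
            represents_mult[OF rp(2,1) ru(2,1)] represents_mult[OF rq(2,1) rv(2,1)]] rP(2,1)] .
    moreover have "represents (\<lambda>z. (indicator (S - ?Z) z *\<^sub>R h z) * (poly (cpoly p) (Re z) + poly (cpoly q) (Im z)) * indicator (S - ?Z) z)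
        (\<lambda>y. H (W (P y)))"
      using represents_mult[OF bounded_borel_intros(3)[OF H(2) rW(2)] represents_mult[OF H(2,1) rW(2,1)] rP(2,1)] .
    then have "represents (\<lambda>z. (poly (cpoly p) (Re z) * poly2 u (Re z) (Im z) + poly (cpoly q) (Im z) * poly2 v (Re z) (Im z)) * indicator (S - ?Z) z)
        (\<lambda>y. H (W (P y)))"
      by (subst (asm) represents_cong) (auto simp: indicator_def h[symmetric] mult.commute)
    ultimately have "(\<lambda>y. pa (ua (P y)) + qb (va (P y))) = (\<lambda>y. H (W (P y)))" by (rule represents_unique)
    then have "pa (ua (P y)) + qb (va (P y)) = H (W (P y))" by (rule fun_cong)
    moreover have "ua (W (P y)) = W (ua (P y))" "va (W (P y)) = W (va (P y))"
      using comm[OF ru rW] comm[OF rv rW] by auto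
    ultimately show ?thesis by (simp add: K_def X1W X2W)
  qed
  have KP: "K (P y) = 0" for y
  proof -
    let ?A = "adjoint_wrt cinner cinner K"
    have A: "cinner (K x) y = cinner x (?A y)" for x y
      by (rule adjoint_works[OF riesz_form_cinner riesz_form_cinner clK])
    have "W (P (?A x)) = 0" for x
    proof (rule riesz_form_nondegenerate[OF riesz_form_cinner])
      fix y'
      have "cinner y' (W (P (?A x))) = cinner (K (P (W y'))) x" by (simp add: A Psa Wsa)
      also have "P (W y') = W (P y')" by (rule comm[OF rP rW])
      finally show "cinner y' (W (P (?A x))) = cinner y' 0" by (simp add: KWP cinner_simps)
    qed
    then have "P (?A x) = 0" for x by (rule inj)
    then have "cinner (K (P y)) (K (P y)) = 0" by (simp add: A Psa cinner_simps)
    then show ?thesis by (simp add: cinner_self)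
  qed
  have off: "X1 (ua (P y)) + X2 (va (P y)) = H y" for y
  proof -
    have "represents (\<lambda>z. (indicator (S - ?Z) z *\<^sub>R h z) * indicator (S - ?Z) z) (\<lambda>y. H (P y))"
      using represents_mult[OF H(2,1) rP(2,1)] .
    then have "represents (\<lambda>z. indicator (S - ?Z) z *\<^sub>R h z) (\<lambda>y. H (P y))"
      by (subst (asm) represents_cong) (auto simp: indicator_def)
    then have "H = (\<lambda>y. H (P y))" by (rule represents_unique[OF H(1)])
    then have "H (P y) = H y" by (rule fun_cong[symmetric])
    then show ?thesis using KP[of y] by (simp add: K_def)
  qed
  have at: "ua (E {w} y) = poly2 u (Re w) (Im w) *\<^sub>C E {w} y" "va (E {w} y) = poly2 v (Re w) (Im w) *\<^sub>C E {w} y"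
    if w: "w \<in> S" for w y
  proof -
    have ev: "D (E {w} y) = k w *\<^sub>C E {w} y" if "represents k D" "bounded_borel k" for k D
    proof -
      have "represents (\<lambda>z. k z * indicator {w} z) (\<lambda>y. D (E {w} y))"
        by (rule represents_mult_indicator[OF that(2,1) singleton_sets[OF w]])
      moreover have "represents (\<lambda>z. k w * indicator {w} z) (\<lambda>y. k w *\<^sub>C E {w} y)"
        by (rule represents_scale[OF represents_indicator[OF singleton_sets[OF w]]])
      moreover have "(\<lambda>z. k z * indicator {w} z) = (\<lambda>z. k w * indicator {w} z)" by (auto simp: indicator_def)
      ultimately have "(\<lambda>y. D (E {w} y)) = (\<lambda>y. k w *\<^sub>C E {w} y)"
        by (simp only:) (rule represents_unique)
      then show ?thesis by (rule fun_cong)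
    qed
    show "ua (E {w} y) = poly2 u (Re w) (Im w) *\<^sub>C E {w} y" "va (E {w} y) = poly2 v (Re w) (Im w) *\<^sub>C E {w} y"
      by (rule ev[OF ru] ev[OF rv])+
  qed
  note lX1 = bounded_clinearD[OF X1(1)] and lX2 = bounded_clinearD[OF X2(1)]
  note lu = bounded_clinearD[OF represents_clinear[OF ru(1)]] and lv = bounded_clinearD[OF represents_clinear[OF rv(1)]]
  have y: "y = P y + (\<Sum>w\<in>S \<inter> ?Z. E {w} y)" unfolding P_def by (rule E_decompose[OF finZ])
  have "X1 (ua y) + X2 (va y) = X1 (ua (P y + (\<Sum>w\<in>S \<inter> ?Z. E {w} y))) + X2 (va (P y + (\<Sum>w\<in>S \<inter> ?Z. E {w} y)))"
    using y by simp
  also have "\<dots> = (X1 (ua (P y)) + X2 (va (P y))) +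
      (\<Sum>w\<in>S \<inter> ?Z. X1 (ua (E {w} y)) + X2 (va (E {w} y)))"
    by (simp add: lX1 lX2 lu lv sum.distrib)
  also have "\<dots> = H y + (\<Sum>w\<in>S \<inter> ?Z. poly2 u (Re w) (Im w) *\<^sub>C X1 (E {w} y) + poly2 v (Re w) (Im w) *\<^sub>C X2 (E {w} y))"
    unfolding off by (auto simp: at lX1 lX2 intro!: sum.cong)
  finally show ?thesis by (simp add: ua_def va_def)
qed

end

section \<open>Independence of the decomposition\<close>

theorem theorem5p3:
  fixes f :: "'k::complex_banach \<Rightarrow> 'k \<Rightarrow> complex"
    and N :: "'k \<Rightarrow> 'k"
    and p q :: "real poly"
    and T1 :: "'v1::complex_hilbert \<Rightarrow> 'k"
    and T2 :: "'v2::complex_hilbert \<Rightarrow> 'k"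
    and T :: "'v::complex_hilbert \<Rightarrow> 'k"
    and R1 :: "'v1 \<Rightarrow> 'v"
    and R2 :: "'v2 \<Rightarrow> 'v"
    and E :: "complex set \<Rightarrow> 'v \<Rightarrow> 'v"
    and \<phi> :: mfun
    and s s' :: "complex poly poly"
    and g g' :: gfun
  assumes krein: "krein_space f"
    and N: "bounded_clinear N" "normal_wrt f N"
    and definitizing: "p \<noteq> 0" "q \<noteq> 0"
      "\<And>x. f (poly_op (cpoly p) (re_part f N) x) x \<in> \<real>\<^sub>\<ge>\<^sub>0"
      "\<And>x. f (poly_op (cpoly q) (im_part f N) x) x \<in> \<real>\<^sub>\<ge>\<^sub>0"
    and T1: "bounded_clinear T1" "inj T1"
      "T1 \<circ> adjoint_wrt cinner f T1 = poly_op (cpoly p) (re_part f N)"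
    and T2: "bounded_clinear T2" "inj T2"
      "T2 \<circ> adjoint_wrt cinner f T2 = poly_op (cpoly q) (im_part f N)"
    and T: "bounded_clinear T" "inj T"
      "T \<circ> adjoint_wrt cinner f T =
         (\<lambda>x. poly_op (cpoly p) (re_part f N) x + poly_op (cpoly q) (im_part f N) x)"
    and R1: "bounded_clinear R1" "inj R1" "\<And>x. norm (R1 x) \<le> norm x" "T1 = T \<circ> R1"
    and R2: "bounded_clinear R2" "inj R2" "\<And>x. norm (R2 x) \<le> norm x" "T2 = T \<circ> R2"
    and E: "spectral_measure_of (Theta T N) E"
    and \<phi>: "\<phi> \<in> F_N (spectrum (Theta T N)) p q"
    and decomp: "admissible (spectrum (Theta T N)) p q \<phi> s g"
    and decomp': "admissible (spectrum (Theta T N)) p q \<phi> s' g'"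
  shows
    "(\<lambda>x. poly2_op s (re_part f N) (im_part f N) x +
       Xi f T (spectral_integral_R (spectrum (Theta T N)) p q R1 R2 E g) x) =
     (\<lambda>x. poly2_op s' (re_part f N) (im_part f N) x +
       Xi f T (spectral_integral_R (spectrum (Theta T N)) p q R1 R2 E g') x)"
proof -
  define A where "A = re_part f N"
  define B where "B = im_part f N"
  define Ns where "Ns = adjoint_wrt f f N"
  define Ts where "Ts = adjoint_wrt cinner f T"
  define C where "C = Theta T N"
  define S where "S = spectrum C"
  note rf = riesz_form_krein[OF krein] and rc = riesz_form_cinner
  have Ns: "bounded_clinear Ns" "\<And>x y. f (N x) y = f x (Ns y)"
    unfolding Ns_def by (rule bounded_clinear_adjoint[OF rf rf N(1)], rule adjoint_works[OF rf rf N(1)])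
  have Ts: "bounded_clinear Ts" "\<And>x y. f (T x) y = cinner x (Ts y)"
    unfolding Ts_def by (rule bounded_clinear_adjoint[OF rc rf T(1)], rule adjoint_works[OF rc rf T(1)])
  have Ts': "f x (T y) = cinner (Ts x) y" for x y
    unfolding Ts_def by (rule adjoint_works'[OF rc rf T(1)])
  note lN = bounded_clinearD[OF N(1)] and lNs = bounded_clinearD[OF Ns(1)]
    and lT = bounded_clinearD[OF T(1)] and lTs = bounded_clinearD[OF Ts(1)]
  have NNs: "N (Ns x) = Ns (N x)" for x
    using fun_cong[OF N(2)[unfolded normal_wrt_def], of x] by (simp add: Ns_def)
  have A_def': "A = (\<lambda>x. (1 / 2) *\<^sub>C (N x + Ns x))" and B_def': "B = (\<lambda>x. (1 / (2 * \<i>)) *\<^sub>C (N x - Ns x))"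
    by (auto simp: A_def B_def Ns_def re_part_def im_part_def)
  have clA: "bounded_clinear A" and clB: "bounded_clinear B"
    unfolding A_def' B_def'
    by (rule bounded_clinear_scaleC[OF bounded_clinear_add[OF N(1) Ns(1)]],
        rule bounded_clinear_scaleC[OF bounded_clinear_diff[OF N(1) Ns(1)]])
  have NA: "N (A x) = A (N x)" "N (B x) = B (N x)" "Ns (A x) = A (Ns x)" "Ns (B x) = B (Ns x)" for x
    by (simp_all add: A_def' B_def' lN lNs NNs)
  have BA: "B (A x) = A (B x)" for x
    using bounded_clinearD[OF clA] by (simp add: B_def' NA)
  have TTs: "T (Ts x) = poly_op (cpoly p) A x + poly_op (cpoly q) B x" for x
    using fun_cong[OF T(3), of x] by (simp add: Ts_def A_def B_def)
  \<comment> \<open>normality of \<open>N\<close> enters here: \<open>T T*\<close> is a polynomial in \<open>A\<close> and \<open>B\<close>\<close>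
  have comm: "N (T (Ts x)) = T (Ts (N x))" "Ns (T (Ts x)) = T (Ts (Ns x))" for x
    by (simp_all add: TTs lN lNs poly_op_intertwine[OF N(1), where A=A and A'=A, OF NA(1)]
        poly_op_intertwine[OF N(1), where A=B and A'=B, OF NA(2)]
        poly_op_intertwine[OF Ns(1), where A=A and A'=A, OF NA(3)]
        poly_op_intertwine[OF Ns(1), where A=B and A'=B, OF NA(4)])
  have C: "bounded_clinear C" "\<And>x. T (C x) = N (T x)"
    unfolding C_def using Theta_works[OF Theta_exists[OF rf T(1) Ts T(2) N(1) Ns comm] T(2)] by blast+
  have Tinj: "x = y" if "T x = T y" for x y using that T(2) by (simp add: inj_eq)
  define Cs where "Cs = adjoint_wrt cinner cinner C"
  have Cs: "bounded_clinear Cs" "\<And>x y. cinner (C x) y = cinner x (Cs y)"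
    unfolding Cs_def by (rule bounded_clinear_adjoint[OF rc rc C(1)], rule adjoint_works[OF rc rc C(1)])
  have CTs: "C (Ts x) = Ts (N x)" for x by (rule Tinj) (simp add: C(2) comm)
  have TCs: "T (Cs v) = Ns (T v)" for v
  proof (rule riesz_form_nondegenerate[OF rf])
    show "f x (T (Cs v)) = f x (Ns (T v))" for x
      by (simp add: Ts' CTs flip: Cs(2) Ns(2))
  qed
  have CsTs: "Cs (Ts x) = Ts (Ns x)" for x by (rule Tinj) (simp add: TCs comm)
  define a where "a = (\<lambda>y. (1 / 2) *\<^sub>C (C y + Cs y))"
  define b where "b = (\<lambda>y. (1 / (2 * \<i>)) *\<^sub>C (C y - Cs y))"
  have cla: "bounded_clinear a" and clb: "bounded_clinear b"
    unfolding a_def b_def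
    by (rule bounded_clinear_scaleC[OF bounded_clinear_add[OF C(1) Cs(1)]],
        rule bounded_clinear_scaleC[OF bounded_clinear_diff[OF C(1) Cs(1)]])
  have Tab: "T (a y) = A (T y)" "T (b y) = B (T y)" for y
    by (simp_all add: a_def b_def A_def' B_def' lT C(2) TCs)
  have Tsab: "Ts (A x) = a (Ts x)" "Ts (B x) = b (Ts x)" for x
    by (simp_all add: a_def b_def A_def' B_def' lTs CTs CsTs)
  have pvm: "proj_valued_measure S E" and spec: "spectral_integral S E S (\<lambda>z. z) = C"
    using E by (simp_all add: spectral_measure_of_def S_def C_def)
  interpret spectral_measure S E by unfold_locales (rule pvm)
  \<comment> \<open>boundedness of the spectrum makes the identity a bounded Borel function on it, so that \<open>C\<close> really is its integral and not a default value of the definite description\<close>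
  obtain M where M: "\<And>z. z \<in> S \<Longrightarrow> cmod z \<le> M" using spectrum_bounded[OF C(1)] unfolding S_def by blast
  have mid: "(\<lambda>z. z) \<in> borel_measurable \<B>" by (rule measurable_restrict_space1) simp
  then have bmz: "bounded_borel (\<lambda>z. z)" using M by (auto simp: bounded_borel_def)
  have "(\<lambda>z. indicator S z *\<^sub>R z) = (\<lambda>z. indicator S z * z)" by (auto simp: indicator_def)
  then have bmS: "bounded_borel (\<lambda>z. indicator S z *\<^sub>R z)" using S_sets bmz by (simp only: bounded_borel_intros)
  have repz: "represents (\<lambda>z. z) C"
    using represents_spectral_integral[OF bmS] unfolding spec by (subst (asm) represents_cong[where k="\<lambda>z. z"]) auto
  have repc: "represents (\<lambda>z. cnj z) Cs" by (rule represents_cnj[OF repz Cs])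
  have bmc: "bounded_borel (\<lambda>z. cnj z)" by (rule bounded_borel_intros(5)[OF bmz])
  have Re_eq: "(\<lambda>z. complex_of_real (Re z)) = (\<lambda>z. (1 / 2) * (z + cnj z))"
    and Im_eq: "(\<lambda>z. complex_of_real (Im z)) = (\<lambda>z. (1 / (2 * \<i>)) * (z - cnj z))"
    by (auto simp: complex_eq_iff fun_eq_iff complex_add_cnj complex_diff_cnj)
  have bmRI: "bounded_borel (\<lambda>z. complex_of_real (Re z))" "bounded_borel (\<lambda>z. complex_of_real (Im z))"
    unfolding Re_eq Im_eq by (intro bounded_borel_intros bmz bmc)+
  have repa: "represents (\<lambda>z. complex_of_real (Re z)) a" and repb: "represents (\<lambda>z. complex_of_real (Im z)) b"
    unfolding Re_eq Im_eq a_def b_def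
    using represents_scale[OF represents_add[OF bmz bmc repz repc]] represents_scale[OF represents_diff[OF bmz bmc repz repc]] by blast+
  \<comment> \<open>\<open>X = R R*\<close>, because \<open>T0* = R* T*\<close>\<close>
  have X: "\<exists>X. bounded_clinear X \<and> (\<forall>y. X y = R (adjoint_wrt cinner cinner R y)) \<and> (\<forall>x. T (X (Ts x)) = Q x)"
    if R: "bounded_clinear R" "T0 = T \<circ> R" and T0: "T0 \<circ> adjoint_wrt cinner f T0 = Q"
    for R :: "'w::complex_hilbert \<Rightarrow> 'v" and T0 Q
  proof -
    define Rs where "Rs = adjoint_wrt cinner cinner R"
    have Rs: "bounded_clinear Rs" "\<And>x y. cinner (R x) y = cinner x (Rs y)"
      unfolding Rs_def by (rule bounded_clinear_adjoint[OF rc rc R(1)], rule adjoint_works[OF rc rc R(1)])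
    have "adjoint_wrt cinner f T0 = (\<lambda>x. Rs (Ts x))"
      by (rule adjoint_eqI[OF rc bounded_clinear_compose[OF Rs(1) Ts(1)]]) (simp add: R(2) Ts(2) Rs(2))
    then have "T (R (Rs (Ts x))) = Q x" for x using T0 R(2) by (auto simp: fun_eq_iff)
    then show ?thesis
      using bounded_clinear_compose[OF R(1) Rs(1)] by (intro exI[of _ "\<lambda>y. R (Rs y)"]) (auto simp: Rs_def)
  qed
  obtain X1 where X1: "bounded_clinear X1" "\<And>y. X1 y = R1 (adjoint_wrt cinner cinner R1 y)"
    "\<And>x. T (X1 (Ts x)) = poly_op (cpoly p) A x"
    using X[OF R1(1,4) T1(3)] unfolding A_def by blast
  obtain X2 where X2: "bounded_clinear X2" "\<And>y. X2 y = R2 (adjoint_wrt cinner cinner R2 y)"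
    "\<And>x. T (X2 (Ts x)) = poly_op (cpoly q) B x"
    using X[OF R2(1,4) T2(3)] unfolding B_def by blast
  have Tpa: "T (poly_op (cpoly p) a y) = poly_op (cpoly p) A (T y)" for y
    by (rule poly_op_intertwine[OF T(1), where A=a and A'=A, OF Tab(1)])
  have Tqb: "T (poly_op (cpoly q) b y) = poly_op (cpoly q) B (T y)" for y
    by (rule poly_op_intertwine[OF T(1), where A=b and A'=B, OF Tab(2)])
  \<comment> \<open>this is \<open>p(a) + q(b) = T*T\<close>; identities on the Hilbert space are checked after applying \<open>T\<close>\<close>
  have W: "poly_op (cpoly p) a y + poly_op (cpoly q) b y = Ts (T y)" for y
    by (rule Tinj) (simp add: lT Tpa Tqb TTs)
  have X1W: "X1 (poly_op (cpoly p) a y + poly_op (cpoly q) b y) = poly_op (cpoly p) a y"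
    and X2W: "X2 (poly_op (cpoly p) a y + poly_op (cpoly q) b y) = poly_op (cpoly q) b y" for y
    unfolding W by (rule Tinj, simp add: X1(3) X2(3) Tpa Tqb)+
  let ?Z = "Zreal p q"
  obtain u v where uv: "s - s' = in_first p * u + in_second q * v"
    and reg: "\<forall>z\<in>S - ?Z. (poly (cpoly p) (Re z) + poly (cpoly q) (Im z)) * (gscalar g' z - gscalar g z) =
        poly (cpoly p) (Re z) * poly2 u (Re z) (Im z) + poly (cpoly q) (Im z) * poly2 v (Re z) (Im z)"
    and pair: "\<forall>w\<in>S \<inter> ?Z. poly2 u (Re w) (Im w) = fst (gpair g' w) - fst (gpair g w) \<and>
        poly2 v (Re w) (Im w) = snd (gpair g' w) - snd (gpair g w)"
    using admissible_difference[OF definitizing(1,2) decomp decomp'] unfolding S_def C_def by blast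
  have clZ: "closed ?Z" by (rule finite_imp_closed[OF finite_Zreal[OF definitizing(1,2)]])
  have bmg: "bounded_borel (\<lambda>z. indicator (S - ?Z) z *\<^sub>R gscalar h z)" if "admissible S p q \<phi> t h" for t h
    using that clZ unfolding admissible_def Let_def by (elim conjE) (rule bounded_borel_restrict)
  have dec: "admissible S p q \<phi> s g" "admissible S p q \<phi> s' g'"
    using decomp decomp' by (simp_all add: S_def C_def)
  define H where "H = (\<lambda>y. spectral_integral S E (S - ?Z) (gscalar g') y - spectral_integral S E (S - ?Z) (gscalar g) y)"
  have hd: "(\<lambda>z. indicator (S - ?Z) z *\<^sub>R (gscalar g' z - gscalar g z)) =
      (\<lambda>z. indicator (S - ?Z) z *\<^sub>R gscalar g' z - indicator (S - ?Z) z *\<^sub>R gscalar g z)"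
    by (simp add: scaleR_diff_right)
  have H: "represents (\<lambda>z. indicator (S - ?Z) z *\<^sub>R (gscalar g' z - gscalar g z)) H"
    "bounded_borel (\<lambda>z. indicator (S - ?Z) z *\<^sub>R (gscalar g' z - gscalar g z))"
    unfolding hd H_def by (intro represents_diff bounded_borel_intros represents_spectral_integral bmg[OF dec(1)] bmg[OF dec(2)])+
  have split: "X1 (poly2_op u a b y) + X2 (poly2_op v a b y) =
      spectral_integral_R S p q R1 R2 E g' y - spectral_integral_R S p q R1 R2 E g y" for y
  proof -
    have "X1 (poly2_op u a b y) + X2 (poly2_op v a b y) = H y +
      (\<Sum>w\<in>S \<inter> ?Z. poly2 u (Re w) (Im w) *\<^sub>C X1 (E {w} y) + poly2 v (Re w) (Im w) *\<^sub>C X2 (E {w} y))"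
      by (rule calculus_split[OF bmRI repa repb X1(1) X1W X2(1) X2W definitizing(1,2) H]) (use reg in auto)
    also have "(\<Sum>w\<in>S \<inter> ?Z. poly2 u (Re w) (Im w) *\<^sub>C X1 (E {w} y) + poly2 v (Re w) (Im w) *\<^sub>C X2 (E {w} y)) =
       (\<Sum>w\<in>S \<inter> ?Z. (fst (gpair g' w) *\<^sub>C X1 (E {w} y) + snd (gpair g' w) *\<^sub>C X2 (E {w} y)) -
          (fst (gpair g w) *\<^sub>C X1 (E {w} y) + snd (gpair g w) *\<^sub>C X2 (E {w} y)))"
      by (intro sum.cong refl) (simp add: bspec[OF pair] complex_vector.scale_left_diff_distrib)
    finally show ?thesis
      by (simp add: spectral_integral_R_def H_def sum_subtractf X1(2) X2(2))
  qed
  have inter: "Ts (poly2_op t A B x) = poly2_op t a b (Ts x)" for t x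
    by (rule poly2_op_intertwine[OF Ts(1), where A=A and A'=a and B=B and B'=b, OF Tsab])
  have key: "poly2_op s A B x - poly2_op s' A B x =
      T (spectral_integral_R S p q R1 R2 E g' (Ts x)) - T (spectral_integral_R S p q R1 R2 E g (Ts x))" for x
  proof -
    have "poly2_op s A B x - poly2_op s' A B x = poly2_op (in_first p * u + in_second q * v) A B x"
      by (simp flip: uv poly2_op_diff)
    also have "\<dots> = poly_op (cpoly p) A (poly2_op u A B x) + poly_op (cpoly q) B (poly2_op v A B x)"
      by (simp add: poly2_op_add poly2_op_in_first_mult[OF clA] poly2_op_in_second_mult[OF clA clB BA])
    also have "\<dots> = T (X1 (poly2_op u a b (Ts x)) + X2 (poly2_op v a b (Ts x)))"
      by (simp add: lT inter flip: X1(3) X2(3))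
    finally show ?thesis by (simp add: split lT)
  qed
  have "poly2_op s A B x + T (spectral_integral_R S p q R1 R2 E g (Ts x)) =
      poly2_op s' A B x + T (spectral_integral_R S p q R1 R2 E g' (Ts x))" for x
    using key[of x] by (simp add: algebra_simps)
  then show ?thesis
    by (simp add: Xi_def A_def B_def S_def C_def Ts_def)
qed

end
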